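(* Let $a\in\mathbb{R}$, $I\in\mathbb{I}_{a+}$, $m\in\mathbb{N}^*$, $A=(A_{ij})\in\mathrm{L}^\infty_{\mathrm{loc}}(I,\mathbb{R}^{m\times m})$ and $\alpha=(\alpha_i)\in(0,1]^m$. Let $Z(\cdot,\cdot)$ be the left Riemann-Liouville state-transition matrix associated to $A$ and $\overline{\alpha}\in(0,1]^{m\times m}$. Then, for almost every $t\in I$, $t>a$, the function $Z(t,\cdot)$ is the unique (global) solution, on $[a,t]$, of $$\mathrm{D}^{\underline{\alpha}}_{t-}[Z](s)=Z(s)\times A(s),\qquad \mathrm{I}^{1-\underline{\alpha}}_{t-}[Z](t)=\mathrm{Id}_m .$$
   Context: $\mathbb{N}^*$ is the set of positive integers; $\times$ denotes the usual matrix product and $\mathrm{Id}_m$ the identity matrix. For $a\in\mathbb{R}$, $\mathbb{I}_{a+}$ denotes the set of intervals $I\subset\mathbb{R}$ with $\{a\}\subsetneq I\subset[a,+\infty)$ (not necessarily compact). $\mathrm{L}^1_{\mathrm{loc}}(I)$, $\mathrm{L}^\infty_{\mathrm{loc}}(I)$, $\mathrm{AC}_{\mathrm{loc}}(I)$ are the sets of functions on $I$ that are respectively integrable, essentially bounded, absolutely continuous on every compact subinterval of $I$. Functions equal a.e. are identified. Left Riemann-Liouville operators. Let $I\in\mathbb{I}_{a+}$ and $q\in \mathrm{L}^1_{\mathrm{loc}}(I,\mathbb{R})$. For a real $\alpha>0$, $\mathrm{I}^\alpha_{a+}[q](t):=\int_a^t\frac{1}{\Gamma(\alpha)}(t-\tau)^{\alpha-1}q(\tau)\,d\tau$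 (a.e. $t\in I$), and $\mathrm{I}^0_{a+}[q]:=q$. For $0\le\alpha\le1$, $\mathrm{AC}^\alpha_{a+}(I,\mathbb{R})$ is the set of $q\in \mathrm{L}^1_{\mathrm{loc}}(I,\mathbb{R})$ with $\mathrm{I}^{1-\alpha}_{a+}[q]\in\mathrm{AC}_{\mathrm{loc}}(I,\mathbb{R})$, and then $\mathrm{D}^\alpha_{a+}[q]:=\frac{d}{dt}\mathrm{I}^{1-\alpha}_{a+}[q]$ a.e. on $I$. The same operators with base point $s$ are denoted with the subscript $s+$. Right Riemann-Liouville operators. Let $b\in\mathbb{R}$, $J$ an interval with $\{b\}\subsetneq J\subset(-\infty,b]$ and $q\in\mathrm{L}^1_{\mathrm{loc}}(J,\mathbb{R})$. For $\alpha>0$, $\mathrm{I}^\alpha_{b-}[q](t):=\int_t^b\frac{1}{\Gamma(\alpha)}(\tau-t)^{\alpha-1}q(\tau)\,d\tau$, and $\mathrm{I}^0_{b-}[q]:=q$. For $0\le\alpha\le1$, $\mathrm{AC}^\alpha_{b-}(J,\mathbb{R})$ is the set of $q\in\mathrm{L}^1_{\mathrm{loc}}(J,\mathbb{R})$ with $\mathrm{I}^{1-\alpha}_{b-}[q]\in\mathrm{AC}_{\mathrm{loc}}(J,\mathbb{R})$, and then $\mathrm{D}^\alpha_{b-}[q]:=-\frac{d}{dt}\mathrm{I}^{1-\alpha}_{b-}[q]$ a.e. on $J$. In both cases, a fractional integral that is a.e. equal to a continuous function is identified with it. For matrix functions and a matrix multi-order of the same size, everything is taken entrywise, each entry with the corresponding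 order. For $\alpha=(\alpha_i)\in(0,1]^m$, $\overline{\alpha}\in(0,1]^{m\times m}$ is the row constant matrix with entries $\overline{\alpha}_{ij}=\alpha_i$, and $\underline{\alpha}:=\overline{\alpha}^\top$ is the column constant matrix with entries $\underline{\alpha}_{ij}=\alpha_j$. Left Riemann-Liouville state-transition matrix. Let $\beta=(\beta_{ij})\in(0,1]^{m\times m}$. For $s\in I$, $s<\sup I$, put $I^s:=I\cap[s,+\infty)$. The matrix Cauchy problem $\mathrm{D}^\beta_{s+}[Z](t)=A(t)\times Z(t)$ for a.e. $t\in I^s$, $\mathrm{I}^{1-\beta}_{s+}[Z](s)=\mathrm{Id}_m$, admits a unique (global) solution in $\mathrm{AC}^\beta_{s+}(I^s,\mathbb{R}^{m\times m})$, denoted by $Z(\cdot,s)$. The function $Z(\cdot,\cdot)$ is the left Riemann-Liouville state-transition matrix associated to $A$ and $\beta$. It satisfies $$Z(t,s)=\Big[\tfrac{1}{\Gamma(\beta)}(t-s)^{\beta-1}\Big]\otimes\mathrm{Id}_m+\int_s^t\Big[\tfrac{1}{\Gamma(\beta)}(t-\tau)^{\beta-1}\Big]\otimes\big[A(\tau)\times Z(\tau,s)\big]\,d\tau$$ for almost every $t,s\in I$ with $t>s$, where $\otimes$ is the Hadamard (entrywise) product and $\big[\frac{1}{\Gamma(\beta)}(t-\tau)^{\beta-1}\big]$ is the matrix with entries $\frac{1}{\Gamma(\beta_{ij})}(t-\tau)^{\beta_{ij}-1}$. A (global) solution on $[a,t]$ of the right Cauchy problem in the claim is a function $Z\in\mathrm{AC}^{\underline{\alpha}}_{t-}([a,t],\mathbb{R}^{m\times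 m})$ with $\mathrm{I}^{1-\underline{\alpha}}_{t-}[Z](t)=\mathrm{Id}_m$ and $\mathrm{D}^{\underline{\alpha}}_{t-}[Z](s)=Z(s)\times A(s)$ for a.e. $s\in[a,t]$. *)

theory Defs
  imports "HOL-Analysis.Analysis"
begin

definition intervals_from :: "real \<Rightarrow> real set set" where
  "intervals_from a = {I. is_interval I \<and> {a} \<subset> I \<and> I \<subseteq> {a..}}"

definition L1_loc :: "real set \<Rightarrow> (real \<Rightarrow> real) \<Rightarrow> bool" where
  "L1_loc J q \<longleftrightarrow> (\<forall>c d. {c..d} \<subseteq> J \<longrightarrow> q absolutely_integrable_on {c..d})"

definition Linf_loc :: "real set \<Rightarrow> (real \<Rightarrow> real) \<Rightarrow> bool" where
  "Linf_loc J q \<longleftrightarrow> (\<forall>c d. {c..d} \<subseteq> J \<longrightarrow>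
     q \<in> borel_measurable (lebesgue_on {c..d}) \<and>
     (\<exists>C. AE t in lebesgue_on {c..d}. \<bar>q t\<bar> \<le> C))"

text \<open>The usual epsilon-delta definition; a division is a finite family of nonoverlapping
  compact intervals, and the interval k = [u, v] has Inf k = u and Sup k = v.\<close>

definition abs_cont_on :: "real set \<Rightarrow> (real \<Rightarrow> real) \<Rightarrow> bool" where
  "abs_cont_on J f \<longleftrightarrow> (\<forall>\<epsilon>>0. \<exists>\<delta>>0. \<forall>d T. d division_of T \<and> T \<subseteq> J \<and> (\<Sum>k\<in>d. measure lborel k) < \<delta>
     \<longrightarrow> (\<Sum>k\<in>d. \<bar>f (Sup k) - f (Inf k)\<bar>) < \<epsilon>)"

definition AC_loc :: "real set \<Rightarrow> (real \<Rightarrow> real) \<Rightarrow> bool" where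
  "AC_loc J f \<longleftrightarrow> (\<forall>c d. {c..d} \<subseteq> J \<longrightarrow> abs_cont_on {c..d} f)"

text \<open>A function that is a.e. equal on J to a continuous function is identified with it. On a
  nondegenerate interval J the continuous function is unique (on J). Other functions are kept.
  This matters for initial values: the integral formula itself gives 0 at the base point.\<close>

definition continuous_version :: "real set \<Rightarrow> (real \<Rightarrow> real) \<Rightarrow> real \<Rightarrow> real" where
  "continuous_version J g =
     (if \<exists>F. continuous_on J F \<and> (AE t in lebesgue_on J. F t = g t)
      then SOME F. continuous_on J F \<and> (AE t in lebesgue_on J. F t = g t)
      else g)"

text \<open>Riemann-Liouville operators with base point s (left) and b (right) on the interval J.
  The integrals exist for a.e. t in J when q is in L1_loc J; the value 0 that the Lebesgue integral
  takes at the other points is irrelevant. Likewise the derivatives are only meaningful a.e.\<close>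

definition left_RL_integral :: "real \<Rightarrow> real \<Rightarrow> real set \<Rightarrow> (real \<Rightarrow> real) \<Rightarrow> real \<Rightarrow> real" where
  "left_RL_integral \<alpha> s J q = continuous_version J
     (if \<alpha> = 0 then q
      else (\<lambda>t. LINT \<tau>:{s..t}|lebesgue. 1 / Gamma \<alpha> * (t - \<tau>) powr (\<alpha> - 1) * q \<tau>))"

definition left_AC :: "real \<Rightarrow> real \<Rightarrow> real set \<Rightarrow> (real \<Rightarrow> real) \<Rightarrow> bool" where
  "left_AC \<alpha> s J q \<longleftrightarrow> L1_loc J q \<and> AC_loc J (left_RL_integral (1 - \<alpha>) s J q)"

definition left_RL_deriv :: "real \<Rightarrow> real \<Rightarrow> real set \<Rightarrow> (real \<Rightarrow> real) \<Rightarrow> real \<Rightarrow> real" where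
  "left_RL_deriv \<alpha> s J q t = deriv (left_RL_integral (1 - \<alpha>) s J q) t"

definition right_RL_integral :: "real \<Rightarrow> real \<Rightarrow> real set \<Rightarrow> (real \<Rightarrow> real) \<Rightarrow> real \<Rightarrow> real" where
  "right_RL_integral \<alpha> b J q = continuous_version J
     (if \<alpha> = 0 then q
      else (\<lambda>t. LINT \<tau>:{t..b}|lebesgue. 1 / Gamma \<alpha> * (\<tau> - t) powr (\<alpha> - 1) * q \<tau>))"

definition right_AC :: "real \<Rightarrow> real \<Rightarrow> real set \<Rightarrow> (real \<Rightarrow> real) \<Rightarrow> bool" where
  "right_AC \<alpha> b J q \<longleftrightarrow> L1_loc J q \<and> AC_loc J (right_RL_integral (1 - \<alpha>) b J q)"

definition right_RL_deriv :: "real \<Rightarrow> real \<Rightarrow> real set \<Rightarrow> (real \<Rightarrow> real) \<Rightarrow> real \<Rightarrow> real" where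
  "right_RL_deriv \<alpha> b J q t = - deriv (right_RL_integral (1 - \<alpha>) b J q) t"

definition row_constant :: "real ^ 'm \<Rightarrow> real ^ 'm ^ 'm" where
  "row_constant \<alpha> = (\<chi> i j. \<alpha> $ i)"

definition column_constant :: "real ^ 'm \<Rightarrow> real ^ 'm ^ 'm" where
  "column_constant \<alpha> = transpose (row_constant \<alpha>)"

text \<open>Global solutions on J of the left Cauchy problem (base point s) and of the right one
  (base point b), with matrix orders acting entrywise.\<close>

definition left_solution ::
  "(real \<Rightarrow> real ^ 'm ^ 'm) \<Rightarrow> real ^ 'm ^ 'm \<Rightarrow> real \<Rightarrow> real set \<Rightarrow> (real \<Rightarrow> real ^ 'm ^ 'm) \<Rightarrow> bool" where
  "left_solution A \<beta> s J Y \<longleftrightarrow>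
     (\<forall>i j. left_AC (\<beta> $ i $ j) s J (\<lambda>t. Y t $ i $ j)) \<and>
     (AE t in lebesgue_on J. (\<chi> i j. left_RL_deriv (\<beta> $ i $ j) s J (\<lambda>t. Y t $ i $ j) t) = A t ** Y t) \<and>
     (\<chi> i j. left_RL_integral (1 - \<beta> $ i $ j) s J (\<lambda>t. Y t $ i $ j) s) = mat 1"

definition right_solution ::
  "(real \<Rightarrow> real ^ 'm ^ 'm) \<Rightarrow> real ^ 'm ^ 'm \<Rightarrow> real \<Rightarrow> real set \<Rightarrow> (real \<Rightarrow> real ^ 'm ^ 'm) \<Rightarrow> bool" where
  "right_solution A \<beta> b J Y \<longleftrightarrow>
     (\<forall>i j. right_AC (\<beta> $ i $ j) b J (\<lambda>s. Y s $ i $ j)) \<and>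
     (AE s in lebesgue_on J. (\<chi> i j. right_RL_deriv (\<beta> $ i $ j) b J (\<lambda>s. Y s $ i $ j) s) = Y s ** A s) \<and>
     (\<chi> i j. right_RL_integral (1 - \<beta> $ i $ j) b J (\<lambda>s. Y s $ i $ j) b) = mat 1"

text \<open>For s in I with s < sup I (possibly infinite), the function Z(-, s) is a representative of the
  a.e. class that solves the Cauchy problem on the part of I to the right of s. Since the
  representatives can be changed on a null set depending on s, the functions Z(t, -) make sense (for
  a.e. t, up to a.e. equality) only if Z is measurable jointly in (t, s); no further choice is made.\<close>

definition state_transition_matrix ::
  "real set \<Rightarrow> (real \<Rightarrow> real ^ 'm ^ 'm) \<Rightarrow> real ^ 'm ^ 'm \<Rightarrow> (real \<Rightarrow> real \<Rightarrow> real ^ 'm ^ 'm) \<Rightarrow> bool" where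
  "state_transition_matrix I A \<beta> Z \<longleftrightarrow>
     (\<forall>s\<in>I. (\<exists>r\<in>I. s < r) \<longrightarrow> left_solution A \<beta> s (I \<inter> {s..}) (\<lambda>t. Z t s)) \<and>
     (\<forall>i j. (\<lambda>(t, s). Z t s $ i $ j)
        \<in> borel_measurable (lebesgue_on {(t, s). t \<in> I \<and> s \<in> I \<and> s < t}))"

end

theory Submission
  imports Defs
begin

text \<open>Both Cauchy problems are equivalent to weakly singular Volterra equations. Write
  \<open>K(t, s)\<close> for the diagonal matrix with entries \<open>(t - s) powr (\<alpha>\<^sub>i - 1) / Gamma \<alpha>\<^sub>i\<close> and
  \<open>X \<circ> Y\<close> for the composition \<open>\<integral> X(t, \<tau>) Y(\<tau>, s) d\<tau>\<close> of kernels. The left problem says that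
  \<open>Z = K + (K A) \<circ> Z\<close>, the right one that \<open>Z = K + (Z A) \<circ> K\<close>. Put \<open>W = Z - (Z A) \<circ> K\<close>.
  Associativity of the composition and the left equation give \<open>W - K = (K A) \<circ> (W - K)\<close>, and
  this homogeneous equation has only the zero solution, because \<open>K A\<close> is a contraction for
  the norm of \<open>L\<^sup>1\<close> with a weight \<open>exp (- \<mu> t)\<close> and large \<open>\<mu>\<close>. Fubini's theorem transfers the
  right equation from almost every \<open>s\<close> to almost every \<open>t\<close>. Uniqueness for the right problem is
  uniqueness for the left one after reflecting time and transposing.\<close>

section \<open>Oscillation and variation of absolutely continuous functions\<close>

text \<open>Derivatives and initial values are pointwise and rest on epsilon-delta absolute
  continuity. Passing to integral equations and back therefore needs the fundamental theorem of
  calculus for absolutely continuous functions in both directions, and the injectivity of fractional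
  integration.

  The main obstacle is that \<open>Z\<close> is given column by column: for each \<open>s\<close>
  the function \<open>Z(-, s)\<close> is integrable and solves a problem, but nothing is assumed
  about the rows \<open>Z(t, -)\<close> or about bounds uniform in \<open>s\<close>. The contraction
  estimate supplies both. Its constant does not depend on \<open>s\<close>, so it bounds all columns
  at once and makes \<open>Z\<close> a kernel; applying this kernel to the indicator of
  \<open>[a, c]\<close> shows that almost every row is integrable.

  The contraction comes from the Laplace transform \<open>\<mu> powr (- \<beta>)\<close> of the
  kernel of order \<beta>, which tends to 0 as \<mu> grows. It needs bounded coefficients, and
  \<open>A\<close> is bounded only locally; hence the work on compact intervals
  \<open>[a, c]\<close> and a final exhaustion of \<open>I\<close> by countably many of
  them.\<close>

abbreviation clamp :: "real \<Rightarrow> real \<Rightarrow> real \<Rightarrow> real" where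
  "clamp u v t \<equiv> max u (min v t)"

definition osc :: "(real \<Rightarrow> real) \<Rightarrow> real set set \<Rightarrow> real" where
  "osc F d = (\<Sum>k\<in>d. \<bar>F (Sup k) - F (Inf k)\<bar>)"

definition osc_small :: "real set \<Rightarrow> (real \<Rightarrow> real) \<Rightarrow> real \<Rightarrow> real \<Rightarrow> bool" where
  "osc_small J F \<delta> \<epsilon> \<longleftrightarrow>
     (\<forall>d T. d division_of T \<longrightarrow> T \<subseteq> J \<longrightarrow> (\<Sum>k\<in>d. measure lborel k) < \<delta> \<longrightarrow> osc F d < \<epsilon>)"

lemma osc_smallD:
  "osc_small J F \<delta> \<epsilon> \<Longrightarrow> d division_of T \<Longrightarrow> T \<subseteq> J \<Longrightarrow> (\<Sum>k\<in>d. measure lborel k) < \<delta> \<Longrightarrow> osc F d < \<epsilon>"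
  unfolding osc_small_def by blast

lemma abs_cont_on_iff: "abs_cont_on J F \<longleftrightarrow> (\<forall>\<epsilon>>0. \<exists>\<delta>>0. osc_small J F \<delta> \<epsilon>)"
  unfolding abs_cont_on_def osc_small_def osc_def by (simp only: imp_conjL)

lemma division_of_real_interval:
  fixes T :: "real set"
  assumes "d division_of T" "k \<in> d"
  shows "k = {Inf k..Sup k}" "Inf k \<le> Sup k" "{Inf k..Sup k} \<subseteq> T"
    "measure lborel k = Sup k - Inf k"
proof -
  obtain p q where k: "k = {p..q}" using division_ofD(4)[OF assms] by auto
  moreover have "k \<noteq> {}" using division_ofD(3)[OF assms] .
  ultimately have "p \<le> q" by auto
  then show "k = {Inf k..Sup k}" "Inf k \<le> Sup k" "measure lborel k = Sup k - Inf k"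
    using k by auto
  then show "{Inf k..Sup k} \<subseteq> T" using division_ofD(2)[OF assms] by auto
qed

text \<open>Divisions are sets of intervals, so cutting or joining them may identify members. Only
  intervals without interior are affected, and these contribute nothing to the oscillation.\<close>

lemma osc_degenerate:
  assumes "k = {p..q::real}" "interior k = {}" "k \<noteq> {}"
  shows "Sup k = Inf k"
  using assms by (auto simp: interior_atLeastAtMost_real)

text \<open>Composing \<open>F\<close> with the clamping map, instead of cutting the intervals of a division at
  \<open>u\<close> and \<open>v\<close>, makes the oscillation additive under splitting by the pointwise triangle inequality.\<close>

lemma division_restrict:
  fixes F :: "real \<Rightarrow> real"
  assumes d: "d division_of T" and uv: "u \<le> v"
  obtains d' where "d' division_of (T \<inter> {u..v})"
    "(\<Sum>k\<in>d. \<bar>F (clamp u v (Sup k)) - F (clamp u v (Inf k))\<bar>) = osc F d'"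
proof -
  define e where "e = {k\<in>d. k \<inter> {u..v} \<noteq> {}}"
  define h where "h = (\<lambda>k. k \<inter> {u..v})"
  have fin: "finite d" "finite e" using d by (auto simp: e_def)
  have hk: "h k = {max u (Inf k)..min v (Sup k)}" "max u (Inf k) \<le> min v (Sup k)"
    "max u (Inf k) = clamp u v (Inf k)" "min v (Sup k) = clamp u v (Sup k)" if "k \<in> e" for k
  proof -
    have "k \<in> d" using that by (auto simp: e_def)
    note k = division_of_real_interval[OF d this]
    show *: "h k = {max u (Inf k)..min v (Sup k)}"
      unfolding h_def using k(1) by (metis Int_atLeastAtMost inf_commute inf_min sup_max)
    have "h k \<noteq> {}" using that by (auto simp: e_def h_def)
    then show "max u (Inf k) \<le> min v (Sup k)" using * by auto
    then show "max u (Inf k) = clamp u v (Inf k)" "min v (Sup k) = clamp u v (Sup k)" using uv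
      by auto
  qed
  have 1: "(h ` e) division_of (T \<inter> {u..v})"
  proof (rule division_ofI)
    show "finite (h ` e)" using fin by auto
    show "K \<subseteq> T \<inter> {u..v}" if "K \<in> h ` e" for K
      using that division_ofD(2)[OF d] unfolding h_def e_def by blast
    show "K \<noteq> {}" if "K \<in> h ` e" for K
      using that unfolding h_def e_def by blast
    show "\<exists>a b. K = cbox a b" if "K \<in> h ` e" for K
      using that hk by (auto simp: cbox_interval)
    show "interior K1 \<inter> interior K2 = {}" if "K1 \<in> h ` e" "K2 \<in> h ` e" "K1 \<noteq> K2" for K1 K2
    proof -
      from that obtain k1 k2 where k: "k1 \<in> d" "k2 \<in> d" "K1 = h k1" "K2 = h k2"
        unfolding e_def by fast
      then have "k1 \<noteq> k2" using that by auto
      then have "interior k1 \<inter> interior k2 = {}" using division_ofD(5)[OF d] k by auto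
      moreover have "interior K1 \<subseteq> interior k1" "interior K2 \<subseteq> interior k2"
        unfolding k h_def by (auto intro: interior_mono)
      ultimately show ?thesis by auto
    qed
    show "\<Union>(h ` e) = T \<inter> {u..v}"
      using division_ofD(6)[OF d] unfolding h_def e_def by auto
  qed
  have "(\<Sum>k\<in>d. \<bar>F (clamp u v (Sup k)) - F (clamp u v (Inf k))\<bar>) =
      (\<Sum>k\<in>e. \<bar>F (clamp u v (Sup k)) - F (clamp u v (Inf k))\<bar>)"
  proof (rule sum.mono_neutral_right[OF fin(1)])
    show "e \<subseteq> d" by (auto simp: e_def)
    show "\<forall>k\<in>d - e. \<bar>F (clamp u v (Sup k)) - F (clamp u v (Inf k))\<bar> = 0"
    proof
      fix k assume k: "k \<in> d - e"
      note k' = division_of_real_interval[OF d, of k]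
      have "k \<inter> {u..v} = {}" using k by (auto simp: e_def)
      with k k' have "Sup k < u \<or> v < Inf k"
        using uv by (metis DiffD1 Int_atLeastAtMost atLeastatMost_empty_iff inf_real_def max_def min_def not_le sup_real_def)
      with k k' uv have "clamp u v (Sup k) = clamp u v (Inf k)" by auto
      then show "\<bar>F (clamp u v (Sup k)) - F (clamp u v (Inf k))\<bar> = 0" by simp
    qed
  qed
  also have "\<dots> = (\<Sum>k\<in>e. \<bar>F (Sup (h k)) - F (Inf (h k))\<bar>)"
    using hk by (intro sum.cong) auto
  also have "\<dots> = osc F (h ` e)"
    unfolding osc_def
  proof (rule sum.reindex_nontrivial[OF fin(2), symmetric, unfolded o_def])
    fix x y assume xy: "x \<in> e" "y \<in> e" "x \<noteq> y" "h x = h y"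
    then have "interior x \<inter> interior y = {}" using division_ofD(5)[OF d] by (auto simp: e_def)
    moreover have "interior (h x) \<subseteq> interior x" "interior (h x) \<subseteq> interior y"
      using xy(4) unfolding h_def by (metis inf_le1 interior_mono)+
    ultimately have "interior (h x) = {}" by blast
    then have "Sup (h x) = Inf (h x)" using osc_degenerate[OF hk(1)[OF xy(1)]] xy
      by (auto simp: e_def h_def)
    then show "\<bar>F (Sup (h x)) - F (Inf (h x))\<bar> = 0" by simp
  qed
  finally show ?thesis using 1 that by blast
qed

lemma division_union:
  fixes T1 T2 :: "real set"
  assumes d: "d1 division_of T1" "d2 division_of T2"
    and disj: "\<And>k1 k2. k1 \<in> d1 \<Longrightarrow> k2 \<in> d2 \<Longrightarrow> interior k1 \<inter> interior k2 = {}"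
  shows "(d1 \<union> d2) division_of (T1 \<union> T2)" "osc F (d1 \<union> d2) = osc F d1 + osc F d2"
proof -
  show "(d1 \<union> d2) division_of (T1 \<union> T2)"
  proof (rule division_ofI)
    show "interior K1 \<inter> interior K2 = {}" if "K1 \<in> d1 \<union> d2" "K2 \<in> d1 \<union> d2" "K1 \<noteq> K2" for K1 K2
    proof -
      from that consider "K1 \<in> d1" "K2 \<in> d1" | "K1 \<in> d2" "K2 \<in> d2" | "K1 \<in> d1" "K2 \<in> d2" | "K1 \<in> d2" "K2 \<in> d1"
        by blast
      then show ?thesis
      proof cases
        case 1 then show ?thesis using division_ofD(5)[OF d(1)] that by simp
      next
        case 2 then show ?thesis using division_ofD(5)[OF d(2)] that by simp
      next
        case 3 then show ?thesis using disj by simp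
      next
        case 4 then show ?thesis using disj[of K2 K1] by (simp only: Int_commute)
      qed
    qed
  next
    fix K assume "K \<in> d1 \<union> d2"
    then consider "K \<in> d1" | "K \<in> d2" by blast
    then show "K \<noteq> {}" using division_ofD(3)[OF d(1), of K] division_ofD(3)[OF d(2), of K]
      by cases auto
  qed (use division_ofD(1,2,4,6)[OF d(1)] division_ofD(1,2,4,6)[OF d(2)] in auto)
  have "osc F (d1 \<inter> d2) = 0"
    unfolding osc_def
  proof (rule sum.neutral, rule ballI)
    fix k assume k: "k \<in> d1 \<inter> d2"
    then have "interior k = {}" using disj by blast
    then show "\<bar>F (Sup k) - F (Inf k)\<bar> = 0"
      using osc_degenerate[of k "Inf k" "Sup k"] k division_ofD(3)[OF d(1), of k] division_of_real_interval(1)[OF d(1), of k]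
      by simp
  qed
  moreover have "osc F (d1 \<union> d2) + osc F (d1 \<inter> d2) = osc F d1 + osc F d2"
    unfolding osc_def using d by (intro sum.union_inter) auto
  ultimately show "osc F (d1 \<union> d2) = osc F d1 + osc F d2" by simp
qed

lemma division_Union:
  fixes T :: "'i \<Rightarrow> real set"
  assumes "finite D" "\<And>i. i \<in> D \<Longrightarrow> d i division_of T i"
    and "\<And>i j. i \<in> D \<Longrightarrow> j \<in> D \<Longrightarrow> i \<noteq> j \<Longrightarrow> interior (T i) \<inter> interior (T j) = {}"
  shows "(\<Union>i\<in>D. d i) division_of (\<Union>i\<in>D. T i) \<and> osc F (\<Union>i\<in>D. d i) = (\<Sum>i\<in>D. osc F (d i))"
  using assms
proof (induction rule: finite_induct)
  case empty
  then show ?case by (simp add: osc_def)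
next
  case (insert i D)
  have IH: "(\<Union>i\<in>D. d i) division_of (\<Union>i\<in>D. T i)" "osc F (\<Union>i\<in>D. d i) = (\<Sum>i\<in>D. osc F (d i))"
    using insert by auto
  have "interior k1 \<inter> interior k2 = {}" if k: "k1 \<in> d i" "k2 \<in> (\<Union>i\<in>D. d i)" for k1 k2
  proof -
    obtain j where j: "j \<in> D" "k2 \<in> d j" using k by auto
    then have "i \<noteq> j" using insert by auto
    then have "interior (T i) \<inter> interior (T j) = {}" using insert j by auto
    moreover have "k1 \<subseteq> T i" "k2 \<subseteq> T j"
      using division_ofD(2)[OF insert(4), of i] division_ofD(2)[OF insert(4), of j] j k by auto
    ultimately show ?thesis using interior_mono by blast
  qed
  note u = division_union[OF insert(4)[of i] IH(1) this]
  show ?case using u IH insert(1,2) by (simp add: Un_commute)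
qed

lemma division_measure:
  fixes T :: "real set"
  assumes d: "d division_of T"
  shows "(\<Sum>k\<in>d. measure lborel k) = measure lborel T" "T \<in> sets borel" "emeasure lborel T \<noteq> \<infinity>"
    "compact T"
proof -
  show "compact T"
    using d division_ofD(1,4,6)[OF d] by (metis compact_Union compact_cbox)
  then show T: "T \<in> sets borel" by (rule borel_compact)
  have "(\<Sum>k\<in>d. measure lborel k) = (\<Sum>k\<in>d. measure lebesgue k)"
  proof (rule sum.cong)
    fix k assume "k \<in> d"
    then obtain a b where "k = cbox a b" using division_ofD(4)[OF d] by blast
    then show "measure lborel k = measure lebesgue k" by (simp add: measure_completion)
  qed simp
  also have "\<dots> = measure lebesgue T" by (rule content_division[OF d])
  finally show "(\<Sum>k\<in>d. measure lborel k) = measure lborel T" using T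
    by (simp add: measure_completion)
  show "emeasure lborel T \<noteq> \<infinity>" using emeasure_compact_finite[OF \<open>compact T\<close>] by simp
qed

section \<open>Densities of absolutely continuous functions\<close>

lemma abs_cont_onE:
  assumes "abs_cont_on J F" "\<epsilon> > 0"
  obtains \<delta> where "\<delta> > 0" "osc_small J F \<delta> \<epsilon>"
  using assms unfolding abs_cont_on_iff by blast

lemma abs_cont_on_diff:
  assumes F: "abs_cont_on J F" and G: "abs_cont_on J G"
  shows "abs_cont_on J (\<lambda>x. F x - G x)"
  unfolding abs_cont_on_iff
proof (intro allI impI)
  fix \<epsilon> :: real assume "\<epsilon> > 0"
  then have e: "\<epsilon> / 2 > 0" by simp
  obtain \<delta>1 where 1: "\<delta>1 > 0" "osc_small J F \<delta>1 (\<epsilon> / 2)" by (rule abs_cont_onE[OF F e])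
  obtain \<delta>2 where 2: "\<delta>2 > 0" "osc_small J G \<delta>2 (\<epsilon> / 2)" by (rule abs_cont_onE[OF G e])
  have "osc_small J (\<lambda>x. F x - G x) (min \<delta>1 \<delta>2) \<epsilon>"
    unfolding osc_small_def
  proof (intro allI impI)
    fix d T assume d: "d division_of T" "T \<subseteq> J" "(\<Sum>k\<in>d. measure lborel k) < min \<delta>1 \<delta>2"
    have "osc (\<lambda>x. F x - G x) d \<le> osc F d + osc G d"
      unfolding osc_def sum.distrib[symmetric] by (intro sum_mono) auto
    moreover have "osc F d < \<epsilon> / 2" by (rule osc_smallD[OF 1(2) d(1,2)]) (use d(3) in simp)
    moreover have "osc G d < \<epsilon> / 2" by (rule osc_smallD[OF 2(2) d(1,2)]) (use d(3) in simp)
    ultimately show "osc (\<lambda>x. F x - G x) d < \<epsilon>" by linarith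
  qed
  then show "\<exists>\<delta>>0. osc_small J (\<lambda>x. F x - G x) \<delta> \<epsilon>" using 1(1) 2(1)
    by (intro exI[of _ "min \<delta>1 \<delta>2"]) simp
qed

lemma abs_cont_on_subset:
  assumes "abs_cont_on J F" "K \<subseteq> J"
  shows "abs_cont_on K F"
  using assms unfolding abs_cont_on_def by (meson order_trans)

lemma abs_cont_on_imp_continuous_on:
  assumes F: "abs_cont_on {c..e} F"
  shows "continuous_on {c..e} F"
proof (rule continuous_onI)
  fix x \<epsilon> :: real assume x: "x \<in> {c..e}" and "\<epsilon> > 0"
  from abs_cont_onE[OF F \<open>\<epsilon> > 0\<close>] obtain \<delta> where d: "\<delta> > 0" "osc_small {c..e} F \<delta> \<epsilon>" .
  have *: "\<bar>F v - F u\<bar> < \<epsilon>" if "u \<le> v" "{u..v} \<subseteq> {c..e}" "v - u < \<delta>" for u v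
    using osc_smallD[OF d(2), of "{{u..v}}" "{u..v}"] that division_of_self[of u v]
    by (simp add: cbox_interval osc_def)
  show "\<exists>\<delta>>0. \<forall>x'\<in>{c..e}. dist x' x < \<delta> \<longrightarrow> dist (F x') (F x) \<le> \<epsilon>"
  proof (intro exI[of _ \<delta>] conjI ballI impI)
    fix y assume "y \<in> {c..e}" "dist y x < \<delta>"
    then show "dist (F y) (F x) \<le> \<epsilon>"
      using *[of x y] *[of y x] x by (cases "x \<le> y") (auto simp: dist_real_def abs_minus_commute)
  qed (use d in auto)
qed

text \<open>Radon-Nikodym for the Stieltjes measure \<mu> of the constant extension
  \<open>H\<close>. Absolute continuity of \<open>G\<close> controls \<mu> on finite unions of
  intervals, then on open sets as increasing limits of such unions, and finally on null sets by
  outer regularity.\<close>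

lemma mono_abs_cont_imp_density:
  fixes G :: "real \<Rightarrow> real"
  assumes ce: "c \<le> e" and mono: "\<And>x y. c \<le> x \<Longrightarrow> x \<le> y \<Longrightarrow> y \<le> e \<Longrightarrow> G x \<le> G y"
    and ac: "abs_cont_on {c..e} G"
  obtains g where "g \<in> borel_measurable borel" "set_integrable lborel {c..e} g"
    "\<And>x. x \<in> {c..e} \<Longrightarrow> (LINT y:{c..x}|lborel. g y) = G x - G c"
proof -
  define H where "H = (\<lambda>x. G (clamp c e x))"
  have Hmono: "H x \<le> H y" if "x \<le> y" for x y
    unfolding H_def using that ce by (intro mono) auto
  have Hcont: "continuous_on UNIV H"
  proof -
    have "continuous_on UNIV (\<lambda>x. clamp c e x)" by (intro continuous_intros)
    moreover have "range (\<lambda>x. clamp c e x) \<subseteq> {c..e}" using ce by auto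
    ultimately show ?thesis
      unfolding H_def by (rule continuous_on_compose2[OF abs_cont_on_imp_continuous_on[OF ac]])
  qed
  define \<mu> where "\<mu> = interval_measure H"
  have sets[simp, measurable_cong]: "sets \<mu> = sets borel" by (simp add: \<mu>_def)
  have Icc: "emeasure \<mu> {x..y} = H y - H x" if "x \<le> y" for x y
    unfolding \<mu>_def by (rule emeasure_interval_measure_Icc[OF that Hmono Hcont])
  \<comment> \<open>\<open>H\<close> is constant outside \<open>{c..e}\<close>, so the parts of
    \<open>E\<close> that stick out carry no \<mu>-mass. Clamping the endpoints accounts for this
    and leads back to a division inside \<open>{c..e}\<close>, where \<delta> applies.\<close>
  have small: "\<exists>\<delta>>0. \<forall>E. finite E \<longrightarrow> (\<forall>k\<in>E. \<exists>a b. k = cbox a b) \<longrightarrow> measure lborel (\<Union>E) < \<delta> \<longrightarrow>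
      emeasure \<mu> (\<Union>E) \<le> ennreal \<epsilon>" if "\<epsilon> > 0" for \<epsilon>
  proof -
    from abs_cont_onE[OF ac that]
    obtain \<delta> where d: "\<delta> > 0" "osc_small {c..e} G \<delta> \<epsilon>" .
    show ?thesis
    proof (intro exI[of _ \<delta>] conjI allI impI)
      fix E :: "real set set"
      assume E: "finite E" "\<forall>k\<in>E. \<exists>a b. k = cbox a b" "measure lborel (\<Union>E) < \<delta>"
      obtain d where dE: "d division_of (\<Union>E)" using elementary_unions_intervals[of E] E by metis
      obtain d' where d': "d' division_of (\<Union>E \<inter> {c..e})"
        "(\<Sum>k\<in>d. \<bar>G (clamp c e (Sup k)) - G (clamp c e (Inf k))\<bar>) = osc G d'"
        by (rule division_restrict[OF dE ce])
      have "(\<Sum>k\<in>d'. measure lborel k) = measure lborel (\<Union>E \<inter> {c..e})"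
        by (rule division_measure(1)[OF d'(1)])
      also have "\<dots> \<le> measure lborel (\<Union>E)"
        using division_measure[OF dE] division_measure[OF d'(1)]
        by (intro measure_mono_fmeasurable) (auto simp: fmeasurable_def top.not_eq_extremum)
      finally have "osc G d' < \<epsilon>"
        using E d' by (intro osc_smallD[OF d(2)]) auto
      have "emeasure \<mu> (\<Union>E) = emeasure \<mu> (\<Union>k\<in>d. k)" using division_ofD(6)[OF dE] by simp
      also have "\<dots> \<le> (\<Sum>k\<in>d. emeasure \<mu> k)"
      proof (rule emeasure_subadditive_finite)
        show "(\<lambda>k. k) ` d \<subseteq> sets \<mu>" using division_ofD(4)[OF dE] by fastforce
      qed (use dE in auto)
      also have "\<dots> = (\<Sum>k\<in>d. ennreal (H (Sup k) - H (Inf k)))"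
      proof (rule sum.cong)
        fix k assume k: "k \<in> d"
        show "emeasure \<mu> k = ennreal (H (Sup k) - H (Inf k))"
          using Icc[OF division_of_real_interval(2)[OF dE k]] division_of_real_interval(1)[OF dE k]
            by simp
      qed simp
      also have "\<dots> = ennreal (\<Sum>k\<in>d. H (Sup k) - H (Inf k))"
        using division_of_real_interval(2)[OF dE] Hmono by (intro sum_ennreal) auto
      also have "\<dots> \<le> ennreal (osc G d')"
        unfolding d'(2)[symmetric] H_def by (intro ennreal_leI sum_mono) auto
      also have "\<dots> \<le> ennreal \<epsilon>"
        using \<open>osc G d' < \<epsilon>\<close> by (intro ennreal_leI) auto
      finally show "emeasure \<mu> (\<Union>E) \<le> ennreal \<epsilon>" .
    qed (fact d(1))
  qed
  have ac\<mu>: "absolutely_continuous lborel \<mu>"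
    unfolding absolutely_continuous_def
  proof
    fix N :: "real set" assume N: "N \<in> null_sets lborel"
    have le: "emeasure \<mu> N \<le> ennreal \<epsilon>" if \<epsilon>: "\<epsilon> > 0" for \<epsilon>
    proof -
      obtain \<delta> where \<delta>: "\<delta> > 0" "\<And>E. finite E \<Longrightarrow> (\<forall>k\<in>E. \<exists>a b. k = cbox a b) \<Longrightarrow> measure lborel (\<Union>E) < \<delta> \<Longrightarrow>
        emeasure \<mu> (\<Union>E) \<le> ennreal \<epsilon>" using small[OF \<epsilon>] by blast
      have "N \<in> sets borel" using N by auto
      from outer_regular_lborel[OF this \<delta>(1)]
      obtain U where U: "open U" "N \<subseteq> U" "emeasure lborel (U - N) < ennreal \<delta>" by blast
      then have "emeasure lborel U < ennreal \<delta>"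
        using N by (metis borel_open emeasure_Diff_null_set sets_lborel)
      obtain D where D: "countable D" "D \<subseteq> Pow U" "\<And>X. X \<in> D \<Longrightarrow> \<exists>a b. X = cbox a b" "\<Union>D = U"
        using open_countable_Union_open_cbox[OF U(1)] by metis
      have "emeasure \<mu> U \<le> ennreal \<epsilon>"
      proof (cases "D = {}")
        case False
        define X where "X = from_nat_into D"
        have X: "range X = D" unfolding X_def by (rule range_from_nat_into[OF False D(1)])
        have bX: "\<exists>a b. X n = cbox a b" for n using D(3)[of "X n"] X by auto
        have mX: "X n \<in> sets borel" for n using bX[of n] by auto
        define W where "W n = (\<Union>i\<le>n. X i)" for n
        have "emeasure \<mu> (\<Union>n. W n) = (SUP n. emeasure \<mu> (W n))"
        proof (rule SUP_emeasure_incseq[symmetric])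
          show "range W \<subseteq> sets \<mu>" unfolding W_def using mX by auto
          show "incseq W" unfolding W_def incseq_def by (intro allI impI UN_mono) auto
        qed
        moreover have "(\<Union>n. W n) = U" unfolding W_def using X D(4) by auto
        moreover have "emeasure \<mu> (W n) \<le> ennreal \<epsilon>" for n
          unfolding W_def
        proof (rule \<delta>(2))
          have "(\<Union>i\<le>n. X i) \<subseteq> U" using X D(4) by auto
          then have "emeasure lborel (\<Union>i\<le>n. X i) \<le> emeasure lborel U"
            using U(1) by (intro emeasure_mono) auto
          then have "emeasure lborel (\<Union>i\<le>n. X i) < ennreal \<delta>"
            using \<open>emeasure lborel U < ennreal \<delta>\<close> by simp
          then show "measure lborel (\<Union>i\<le>n. X i) < \<delta>"
            using \<delta>(1) unfolding measure_def
            by (subst enn2real_less_iff) (auto intro: order.strict_trans[OF _ ennreal_less_top])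
        qed (use bX in auto)
        ultimately show ?thesis by (metis SUP_least)
      qed (use D in auto)
      then show ?thesis using emeasure_mono[OF U(2), of \<mu>] U(1)
        by (metis borel_open order_trans sets)
    qed
    have "emeasure \<mu> N \<le> 0"
    proof (rule ennreal_le_epsilon)
      fix \<epsilon> :: real assume "\<epsilon> > 0"
      then show "emeasure \<mu> N \<le> 0 + ennreal \<epsilon>" using le[of \<epsilon>] by simp
    qed
    then show "N \<in> null_sets \<mu>" using N by (auto simp: null_sets_def)
  qed
  obtain f where f: "f \<in> borel_measurable lborel" "density lborel f = \<mu>"
    using sigma_finite_measure.Radon_Nikodym[OF sigma_finite_lborel ac\<mu>] by auto
  have [measurable]: "f \<in> borel_measurable borel" using f by simp
  have nn: "(\<integral>\<^sup>+y\<in>{c..x}. f y \<partial>lborel) = ennreal (G x - G c)" if "x \<in> {c..e}" for x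
  proof -
    have "(\<integral>\<^sup>+y\<in>{c..x}. f y \<partial>lborel) = emeasure \<mu> {c..x}"
      using f by (subst f(2)[symmetric], subst emeasure_density) auto
    also have "\<dots> = ennreal (G x - G c)" using Icc[of c x] that by (simp add: H_def)
    finally show ?thesis .
  qed
  \<comment> \<open>The density \<open>f\<close> is extended-real valued, but its integral over
    \<open>{c..e}\<close> is finite. It is therefore finite almost everywhere there, and
    \<open>enn2real\<close> does not change the integrals.\<close>
  define g where "g = (\<lambda>y. enn2real (f y))"
  have [measurable]: "g \<in> borel_measurable borel" unfolding g_def by measurable
  have fin: "AE y in lborel. f y * indicator {c..e} y \<noteq> \<infinity>"
    by (rule nn_integral_noteq_infinite) (use nn[of e] ce in auto)
  have nng: "(\<integral>\<^sup>+y. ennreal (indicator {c..x} y *\<^sub>R g y) \<partial>lborel) = ennreal (G x - G c)"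
    if x: "x \<in> {c..e}" for x
  proof -
    have "(\<integral>\<^sup>+y. ennreal (indicator {c..x} y *\<^sub>R g y) \<partial>lborel) = (\<integral>\<^sup>+y\<in>{c..x}. f y \<partial>lborel)"
      by (rule nn_integral_cong_AE)
         (use fin x in \<open>auto elim!: eventually_mono simp: g_def top.not_eq_extremum split: split_indicator\<close>)
    then show ?thesis using nn[OF x] by simp
  qed
  show ?thesis
  proof (rule that[of g])
    show "set_integrable lborel {c..e} g"
      unfolding set_integrable_def
      by (rule integrableI_nonneg) (use nng[of e] ce in \<open>auto simp: g_def\<close>)
    show "(LINT y:{c..x}|lborel. g y) = G x - G c" if x: "x \<in> {c..e}" for x
      unfolding set_lebesgue_integral_def
      by (subst integral_eq_nn_integral) (use nng[OF x] mono[of c x] x in \<open>auto simp: g_def\<close>)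
  qed auto
qed

text \<open>The divisions need not cover \<open>{u..v}\<close>. Gaps can only lower the oscillation,
  so the supremum is the usual total variation, and divisions of subintervals may be put together
  freely.\<close>

definition variation :: "(real \<Rightarrow> real) \<Rightarrow> real \<Rightarrow> real \<Rightarrow> real" where
  "variation F u v = (SUP d\<in>{d. \<exists>T\<subseteq>{u..v}. d division_of T}. osc F d)"

lemma osc_split:
  assumes d: "d division_of T" "T \<subseteq> {u..w}" and uvw: "u \<le> v" "v \<le> w"
  obtains d1 d2 where "d1 division_of (T \<inter> {u..v})" "d2 division_of (T \<inter> {v..w})"
    "osc F d \<le> osc F d1 + osc F d2"
proof -
  obtain d1 where d1: "d1 division_of (T \<inter> {u..v})"
     "(\<Sum>k\<in>d. \<bar>F (clamp u v (Sup k)) - F (clamp u v (Inf k))\<bar>) = osc F d1"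
    by (rule division_restrict[OF d(1) uvw(1)])
  obtain d2 where d2: "d2 division_of (T \<inter> {v..w})"
     "(\<Sum>k\<in>d. \<bar>F (clamp v w (Sup k)) - F (clamp v w (Inf k))\<bar>) = osc F d2"
    by (rule division_restrict[OF d(1) uvw(2)])
  have "osc F d \<le> (\<Sum>k\<in>d. \<bar>F (clamp u v (Sup k)) - F (clamp u v (Inf k))\<bar>
     + \<bar>F (clamp v w (Sup k)) - F (clamp v w (Inf k))\<bar>)"
    unfolding osc_def
  proof (rule sum_mono)
    fix k assume "k \<in> d"
    note k = division_of_real_interval(2,3)[OF d(1) this]
    have *: "F x = F (clamp u v x) + F (clamp v w x) - F v" if "x \<in> {u..w}" for x
    proof (cases "x \<le> v")
      case True
      then have "clamp u v x = x" "clamp v w x = v" using that uvw by auto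
      then show ?thesis by simp
    next
      case False
      then have "clamp u v x = v" "clamp v w x = x" using that uvw by auto
      then show ?thesis by simp
    qed
    have "{Inf k..Sup k} \<subseteq> {u..w}" using k(2) d(2) by blast
    then have "Inf k \<in> {u..w}" "Sup k \<in> {u..w}" using k(1) by auto
    then have "F (Inf k) = F (clamp u v (Inf k)) + F (clamp v w (Inf k)) - F v"
      "F (Sup k) = F (clamp u v (Sup k)) + F (clamp v w (Sup k)) - F v"
      using * by blast+
    then show "\<bar>F (Sup k) - F (Inf k)\<bar> \<le> \<bar>F (clamp u v (Sup k)) - F (clamp u v (Inf k))\<bar>
     + \<bar>F (clamp v w (Sup k)) - F (clamp v w (Inf k))\<bar>"
      by linarith
  qed
  then show ?thesis using d1 d2 that by (simp add: sum.distrib)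
qed

text \<open>Bisection: bounds on two adjacent intervals add up, and an interval shorter than the
  \<delta> that belongs to 1 has oscillations below 1.\<close>

lemma abs_cont_bounded_variation:
  assumes ac: "abs_cont_on {c..e} F" and "c \<le> e"
  obtains B where "\<And>d T. d division_of T \<Longrightarrow> T \<subseteq> {c..e} \<Longrightarrow> osc F d \<le> B"
proof -
  \<comment> \<open>The guard is part of \<open>P\<close> because the local step of the bisection
    also asks about intervals that stick out of \<open>{c..e}\<close>.\<close>
  define P where "P u v \<longleftrightarrow> (c \<le> u \<and> v \<le> e \<longrightarrow>
      (\<exists>B. \<forall>d T. d division_of T \<and> T \<subseteq> {u..v} \<longrightarrow> osc F d \<le> B))" for u v
  have "P c e"
    using \<open>c \<le> e\<close>
  proof (induction rule: Bolzano)
    case (trans u v w)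
    show ?case
      unfolding P_def
    proof
      assume *: "c \<le> u \<and> w \<le> e"
      have uv: "c \<le> u \<and> v \<le> e" "c \<le> v \<and> w \<le> e" using trans(3,4) * by auto
      from mp[OF trans(1)[unfolded P_def] uv(1)]
      obtain B1 where B1: "\<And>d T. d division_of T \<Longrightarrow> T \<subseteq> {u..v} \<Longrightarrow> osc F d \<le> B1" by metis
      from mp[OF trans(2)[unfolded P_def] uv(2)]
      obtain B2 where B2: "\<And>d T. d division_of T \<Longrightarrow> T \<subseteq> {v..w} \<Longrightarrow> osc F d \<le> B2" by metis
      show "\<exists>B. \<forall>d T. d division_of T \<and> T \<subseteq> {u..w} \<longrightarrow> osc F d \<le> B"
      proof (intro exI[of _ "B1 + B2"] allI impI)
        fix d T assume d: "d division_of T \<and> T \<subseteq> {u..w}"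
        from osc_split[OF conjunct1[OF d] conjunct2[OF d] trans(3,4)]
        obtain d1 d2 where "d1 division_of (T \<inter> {u..v})" "d2 division_of (T \<inter> {v..w})"
          "osc F d \<le> osc F d1 + osc F d2" by metis
        then show "osc F d \<le> B1 + B2" using B1[of d1 "T \<inter> {u..v}"] B2[of d2 "T \<inter> {v..w}"] by simp
      qed
    qed
  next
    case (local x)
    from abs_cont_onE[OF ac zero_less_one]
    obtain \<delta> where \<delta>: "\<delta> > 0" "osc_small {c..e} F \<delta> 1" .
    show ?case
      unfolding P_def
    proof (rule exI[of _ \<delta>], intro conjI allI impI)
      fix u v assume uv: "u \<le> x \<and> x \<le> v \<and> v - u < \<delta>" "c \<le> u \<and> v \<le> e"
      show "\<exists>B. \<forall>d T. d division_of T \<and> T \<subseteq> {u..v} \<longrightarrow> osc F d \<le> B"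
      proof (rule exI[of _ 1], intro allI impI)
        fix d T assume d: "d division_of T \<and> T \<subseteq> {u..v}"
        have "(\<Sum>k\<in>d. measure lborel k) = measure lborel T"
          using division_measure(1) d by blast
        also have "\<dots> \<le> measure lborel {u..v}"
          using d division_measure(2)[of d T]
            by (intro measure_mono_fmeasurable) (auto simp: fmeasurable_def emeasure_lborel_Icc_eq)
        also have "\<dots> < \<delta>" using uv by simp
        finally have "osc F d < 1" using d uv by (intro osc_smallD[OF \<delta>(2)]) auto
        then show "osc F d \<le> 1" by simp
      qed
    qed (fact \<delta>(1))
  qed
  then show ?thesis using that unfolding P_def by blast
qed

text \<open>Jordan decomposition: with the variation function \<open>V\<close>, both
  \<open>V\<close> and \<open>V - F\<close> are increasing and absolutely continuous, and the
  difference of their densities is a density of \<open>F\<close>.\<close>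

lemma abs_cont_imp_density:
  fixes F :: "real \<Rightarrow> real"
  assumes ce: "c \<le> e" and ac: "abs_cont_on {c..e} F"
  obtains g where "g \<in> borel_measurable borel" "set_integrable lborel {c..e} g"
    "\<And>x. x \<in> {c..e} \<Longrightarrow> (LINT y:{c..x}|lborel. g y) = F x - F c"
proof -
  obtain B where B: "\<And>d T. d division_of T \<Longrightarrow> T \<subseteq> {c..e} \<Longrightarrow> osc F d \<le> B"
    using abs_cont_bounded_variation[OF ac ce] by metis
  have bdd: "bdd_above (osc F ` {d. \<exists>T\<subseteq>{u..v}. d division_of T})" if "c \<le> u" "v \<le> e" for u v
  proof (rule bdd_aboveI2)
    fix d assume "d \<in> {d. \<exists>T\<subseteq>{u..v}. d division_of T}"
    then obtain T where "T \<subseteq> {u..v}" "d division_of T" by blast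
    then show "osc F d \<le> B" using that by (intro B[of d T]) auto
  qed
  have upper: "osc F d \<le> variation F u v" if "d division_of T" "T \<subseteq> {u..v}" "c \<le> u" "v \<le> e"
    for d T u v
    unfolding variation_def using that by (intro cSUP_upper bdd) auto
  have ne: "{d. \<exists>T\<subseteq>{u..v}. d division_of T} \<noteq> {}" for u v :: real
  proof -
    have "{} \<in> {d. \<exists>T\<subseteq>{u..v}. d division_of T}" by (auto intro!: exI[of _ "{}"])
    then show ?thesis by blast
  qed
  have approx: "\<exists>d T. d division_of T \<and> T \<subseteq> {u..v} \<and> variation F u v - \<eta> < osc F d"
    if "\<eta> > 0" "c \<le> u" "v \<le> e" for u v \<eta>
  proof -
    have "\<exists>d\<in>{d. \<exists>T\<subseteq>{u..v}. d division_of T}. variation F u v - \<eta> < osc F d"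
      using that by (subst less_cSUP_iff[OF ne bdd, symmetric]) (auto simp: variation_def)
    then show ?thesis by blast
  qed
  have sub: "variation F u w \<le> variation F u v + variation F v w" if "c \<le> u" "u \<le> v" "v \<le> w" "w \<le> e"
    for u v w
    unfolding variation_def[of F u w]
  proof (rule cSUP_least[OF ne])
    fix d assume "d \<in> {d. \<exists>T\<subseteq>{u..w}. d division_of T}"
    then obtain T where T: "T \<subseteq> {u..w}" "d division_of T" by blast
    from osc_split[OF T(2,1) that(2,3)]
    obtain d1 d2 where d: "d1 division_of (T \<inter> {u..v})" "d2 division_of (T \<inter> {v..w})"
      "osc F d \<le> osc F d1 + osc F d2" by metis
    have "osc F d1 \<le> variation F u v" "osc F d2 \<le> variation F v w"
      using d that by (auto intro: upper)
    then show "osc F d \<le> variation F u v + variation F v w" using d(3) by linarith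
  qed
  have super: "variation F u v + \<bar>F w - F v\<bar> \<le> variation F u w" if "c \<le> u" "u \<le> v" "v \<le> w" "w \<le> e"
    for u v w
  proof (rule field_le_epsilon)
    fix \<eta> :: real assume "\<eta> > 0"
    have "v \<le> e" using that by simp
    from approx[OF \<open>\<eta> > 0\<close> that(1) this]
    obtain d T where d: "d division_of T" "T \<subseteq> {u..v}" "variation F u v - \<eta> < osc F d"
      by blast
    have 2: "{{v..w}} division_of {v..w}" using division_of_self[of v w] that by simp
    have 3: "interior k1 \<inter> interior k2 = {}" if k: "k1 \<in> d" "k2 \<in> {{v..w}}" for k1 k2
    proof -
      have "k1 \<subseteq> {u..v}" using division_ofD(2)[OF d(1) k(1)] d(2) by blast
      then have "interior k1 \<subseteq> interior {u..v}" by (rule interior_mono)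
      moreover have "interior {u..v} \<inter> interior {v..w} = {}" by auto
      ultimately show ?thesis using k by auto
    qed
    have u: "(d \<union> {{v..w}}) division_of (T \<union> {v..w})" "osc F (d \<union> {{v..w}}) = osc F d + osc F {{v..w}}"
      by (rule division_union[OF d(1) 2], rule 3, assumption+)+
    have "osc F (d \<union> {{v..w}}) \<le> variation F u w"
      by (rule upper[OF u(1)]) (use d that in auto)
    moreover have "osc F {{v..w}} = \<bar>F w - F v\<bar>" using that by (simp add: osc_def)
    ultimately show "variation F u v + \<bar>F w - F v\<bar> \<le> variation F u w + \<eta>"
      using u(2) d(3) by linarith
  qed
  define V where "V = variation F c"
  have Vmono: "\<bar>F y - F x\<bar> \<le> V y - V x" if "c \<le> x" "x \<le> y" "y \<le> e" for x y
    using super[of c x y] that by (simp add: V_def)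
  have Vac: "abs_cont_on {c..e} V"
    unfolding abs_cont_on_iff
  proof (intro allI impI)
    fix \<epsilon> :: real assume "\<epsilon> > 0"
    then have "\<epsilon> / 2 > 0" by simp
    from abs_cont_onE[OF ac this]
    obtain \<delta> where \<delta>: "\<delta> > 0" "osc_small {c..e} F \<delta> (\<epsilon> / 2)" .
    have "osc_small {c..e} V \<delta> \<epsilon>"
      unfolding osc_small_def
    proof (intro allI impI)
      fix D S assume "D division_of S" "S \<subseteq> {c..e}" "(\<Sum>k\<in>D. measure lborel k) < \<delta>"
      then have D: "D division_of S \<and> S \<subseteq> {c..e} \<and> (\<Sum>k\<in>D. measure lborel k) < \<delta>" by blast
      have fin: "finite D" using D by auto
      \<comment> \<open>An equal share of half of \<epsilon> for each member of \<open>D\<close>;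
        the added 1 keeps the total strictly below \<epsilon> / 2 and covers an empty
        \<open>D\<close>.\<close>
      define \<eta> where "\<eta> = \<epsilon> / (2 * (real (card D) + 1))"
      have \<eta>: "\<eta> > 0" "real (card D) * \<eta> < \<epsilon> / 2" using \<open>\<epsilon> > 0\<close> by (auto simp: \<eta>_def field_simps)
      have kk: "k = {Inf k..Sup k}" "c \<le> Inf k" "Inf k \<le> Sup k" "Sup k \<le> e" "k \<subseteq> S" if "k \<in> D" for k
      proof -
        note * = division_of_real_interval[OF conjunct1[OF D] that]
        show "k = {Inf k..Sup k}" "Inf k \<le> Sup k" using * by auto
        have "{Inf k..Sup k} \<subseteq> {c..e}" using *(3) D by blast
        then show "c \<le> Inf k" "Sup k \<le> e" using *(2) by auto
        show "k \<subseteq> S" using *(1,3) by simp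
      qed
      \<comment> \<open>On each \<open>k\<close> the variation is nearly attained by a division
        inside \<open>k\<close>. Together these form one division of no larger total length, so the
        \<delta> of \<open>F\<close> also serves for \<open>V\<close>.\<close>
      have "\<forall>k\<in>D. \<exists>d T. d division_of T \<and> T \<subseteq> k \<and> variation F (Inf k) (Sup k) - \<eta> < osc F d"
        using approx[OF \<eta>(1)] kk by metis
      then obtain d T where dT: "\<And>k. k \<in> D \<Longrightarrow> d k division_of T k" "\<And>k. k \<in> D \<Longrightarrow> T k \<subseteq> k"
        "\<And>k. k \<in> D \<Longrightarrow> variation F (Inf k) (Sup k) - \<eta> < osc F (d k)" by metis
      have disj: "interior (T i) \<inter> interior (T j) = {}" if "i \<in> D" "j \<in> D" "i \<noteq> j" for i j
        using division_ofD(5)[OF conjunct1[OF D] that] interior_mono[OF dT(2)[OF that(1)]]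
          interior_mono[OF dT(2)[OF that(2)]] by blast
      note U = division_Union[where T=T and d=d and F=F, OF fin dT(1) disj]
      have sub': "(\<Union>i\<in>D. T i) \<subseteq> S" using dT(2) kk(5) by blast
      have "(\<Sum>k\<in>(\<Union>i\<in>D. d i). measure lborel k) = measure lborel (\<Union>i\<in>D. T i)"
        using division_measure(1) U by blast
      also have "\<dots> \<le> measure lborel S"
        using sub' division_measure[OF conjunct1[OF U]] division_measure[OF conjunct1[OF D]]
        by (intro measure_mono_fmeasurable) (auto simp: fmeasurable_def top.not_eq_extremum)
      also have "\<dots> = (\<Sum>k\<in>D. measure lborel k)" using division_measure(1)[OF conjunct1[OF D]] by simp
      also have "\<dots> < \<delta>" using D by blast
      finally have "osc F (\<Union>i\<in>D. d i) < \<epsilon> / 2"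
        using U sub' D by (intro osc_smallD[OF \<delta>(2), of _ "\<Union>i\<in>D. T i"]) auto
      then have "(\<Sum>i\<in>D. osc F (d i)) < \<epsilon> / 2" using U by simp
      have "osc V D \<le> (\<Sum>k\<in>D. osc F (d k) + \<eta>)"
        unfolding osc_def[of V]
      proof (rule sum_mono)
        fix k assume k: "k \<in> D"
        have "V (Sup k) - V (Inf k) \<le> variation F (Inf k) (Sup k)"
          using sub[of c "Inf k" "Sup k"] kk[OF k] by (simp add: V_def)
        moreover have "V (Inf k) \<le> V (Sup k)" using Vmono[of "Inf k" "Sup k"] kk[OF k] by auto
        ultimately show "\<bar>V (Sup k) - V (Inf k)\<bar> \<le> osc F (d k) + \<eta>" using dT(3)[OF k] by auto
      qed
      also have "\<dots> < \<epsilon>" using \<open>(\<Sum>i\<in>D. osc F (d i)) < \<epsilon> / 2\<close> \<eta>(2) by (simp add: sum.distrib)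
      finally show "osc V D < \<epsilon>" .
    qed
    then show "\<exists>\<delta>>0. osc_small {c..e} V \<delta> \<epsilon>" using \<delta>(1) by blast
  qed
  have "V x \<le> V y" if "c \<le> x" "x \<le> y" "y \<le> e" for x y using Vmono[OF that] by linarith
  from mono_abs_cont_imp_density[OF ce this Vac]
  obtain g where g: "g \<in> borel_measurable borel" "set_integrable lborel {c..e} g"
    "\<And>x. x \<in> {c..e} \<Longrightarrow> (LINT y:{c..x}|lborel. g y) = V x - V c" by blast
  have Wac: "abs_cont_on {c..e} (\<lambda>x. V x - F x)" by (rule abs_cont_on_diff[OF Vac ac])
  have "V x - F x \<le> V y - F y" if "c \<le> x" "x \<le> y" "y \<le> e" for x y using Vmono[OF that] by linarith
  from mono_abs_cont_imp_density[OF ce this Wac]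
  obtain h where h: "h \<in> borel_measurable borel" "set_integrable lborel {c..e} h"
    "\<And>x. x \<in> {c..e} \<Longrightarrow> (LINT y:{c..x}|lborel. h y) = (V x - F x) - (V c - F c)" by blast
  show ?thesis
  proof (rule that[of "\<lambda>x. g x - h x"])
    show "(\<lambda>x. g x - h x) \<in> borel_measurable borel" using g(1) h(1) by measurable
    show "set_integrable lborel {c..e} (\<lambda>x. g x - h x)" using g(2) h(2)
      by (rule set_integral_diff(1))
    fix x assume x: "x \<in> {c..e}"
    then have "set_integrable lborel {c..x} g" "set_integrable lborel {c..x} h"
      using g(2) h(2) by (auto intro: set_integrable_subset)
    then show "(LINT y:{c..x}|lborel. g y - h y) = F x - F c"
      using g(3)[OF x] h(3)[OF x] by (subst set_integral_diff(2)) auto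
  qed
qed

section \<open>Lebesgue differentiation\<close>

lemma AE_lborel_reflect:
  fixes P :: "real \<Rightarrow> bool"
  assumes "AE x in lborel. P x"
  shows "AE x in lborel. P (- x)"
proof -
  have "AE x in distr lborel borel uminus. P x" using assms by (simp only: lborel_distr_uminus)
  then show ?thesis by (rule AE_distrD[rotated]) simp
qed

lemma AE_right_derivative_integral:
  fixes h :: "real \<Rightarrow> real"
  assumes "integrable lborel h"
  shows "AE x in lborel. \<forall>\<epsilon>>0. \<exists>d>0. \<forall>k. 0 < k \<and> k < d \<longrightarrow> \<bar>integral {x..x + k} h / k - h x\<bar> < \<epsilon>"
proof -
  have "h integrable_on cbox a b" for a b
    using integrable_on_lborel[OF assms] integrable_on_subcbox by blast
  from integrable_ccontinuous_explicit[OF this]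
  obtain N where N: "negligible N" "\<And>x e. \<lbrakk>x \<notin> N; 0 < e\<rbrakk> \<Longrightarrow>
               \<exists>d>0. \<forall>k. 0 < k \<and> k < d \<longrightarrow>
                         norm (integral (cbox x (x + k *\<^sub>R One)) h /\<^sub>R k ^ DIM(real) - h x) < e"
    by metis
  have "AE x in lebesgue. x \<notin> N" using N(1) by (simp add: negligible_iff_null_sets AE_not_in)
  then have "AE x in lborel. x \<notin> N" by (simp add: AE_completion_iff)
  then show ?thesis
    by eventually_elim (use N(2) in \<open>simp add: divide_inverse_commute\<close>)
qed

text \<open>Lebesgue differentiation yields the limits of the right difference quotients; the left
  ones are right ones of the reflected function. Cutting \<open>g\<close> off outside
  \<open>{c..e}\<close> makes it integrable on the whole line, as both instances require.\<close>

lemma AE_has_derivative_integral: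
  fixes g :: "real \<Rightarrow> real"
  assumes g: "set_integrable lborel {c..e} g"
  shows "AE x\<in>{c<..<e} in lborel. ((\<lambda>t. LINT y:{c..t}|lborel. g y) has_real_derivative g x) (at x)"
proof -
  define h where "h = (\<lambda>y. indicator {c..e} y *\<^sub>R g y)"
  have h: "integrable lborel h" using g by (simp add: set_integrable_def h_def)
  have h': "integrable lborel (\<lambda>y. h (- y))"
    using lborel_integrable_real_affine[OF h, of "-1" 0] by simp
  have int: "h integrable_on {a..b}" for a b
    using integrable_on_lborel[OF h] integrable_on_subcbox
      by (metis cbox_interval top_greatest integrable_on_subinterval)
  have eq: "(LINT y:{c..t}|lborel. g y) = integral {c..t} h" if "t \<le> e" for t
  proof -
    have "set_integrable lborel {c..t} g" by (rule set_integrable_subset[OF g]) (use that in auto)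
    then have "(LINT y:{c..t}|lborel. g y) = integral {c..t} g"
      by (rule set_borel_integral_eq_integral)
    also have "\<dots> = integral {c..t} h" using that
      by (intro Henstock_Kurzweil_Integration.integral_cong) (auto simp: h_def)
    finally show ?thesis .
  qed
  from AE_right_derivative_integral[OF h] AE_lborel_reflect[OF AE_right_derivative_integral[OF h']]
  show ?thesis
  proof eventually_elim
    case (elim x)
    show ?case
    proof
      assume x: "x \<in> {c<..<e}"
      show "((\<lambda>t. LINT y:{c..t}|lborel. g y) has_real_derivative g x) (at x)"
        unfolding DERIV_def LIM_def
      proof (intro allI impI)
        fix \<epsilon> :: real assume "\<epsilon> > 0"
        obtain d1 where d1: "d1 > 0" "\<And>k. 0 < k \<Longrightarrow> k < d1 \<Longrightarrow> \<bar>integral {x..x + k} h / k - h x\<bar> < \<epsilon>"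
          using elim(1)[rule_format, OF \<open>\<epsilon> > 0\<close>] by blast
        obtain d2 where d2: "d2 > 0" "\<And>k. 0 < k \<Longrightarrow> k < d2 \<Longrightarrow> \<bar>integral {-x..-x + k} (\<lambda>y. h (- y)) / k - h (- (- x))\<bar> < \<epsilon>"
          using elim(2)[rule_format, OF \<open>\<epsilon> > 0\<close>] by blast
        define d where "d = min (min d1 d2) (min (x - c) (e - x))"
        have hx: "h x = g x" using x by (simp add: h_def)
        show "\<exists>d>0. \<forall>k. k \<noteq> 0 \<and> dist k 0 < d \<longrightarrow>
           dist (((LINT y:{c..x + k}|lborel. g y) - (LINT y:{c..x}|lborel. g y)) / k) (g x) < \<epsilon>"
        proof (rule exI[of _ d], intro conjI allI impI)
          show "d > 0" using d1 d2 x by (simp add: d_def)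
          fix k :: real assume k: "k \<noteq> 0 \<and> dist k 0 < d"
          have eqs: "(LINT y:{c..x + k}|lborel. g y) = integral {c..x + k} h"
             "(LINT y:{c..x}|lborel. g y) = integral {c..x} h"
            using k x by (auto simp: d_def dist_real_def intro!: eq)
          show "dist (((LINT y:{c..x + k}|lborel. g y) - (LINT y:{c..x}|lborel. g y)) / k) (g x) < \<epsilon>"
          proof (cases "k > 0")
            case True
            have "integral {c..x} h + integral {x..x + k} h = integral {c..x + k} h"
              using x True by (intro Henstock_Kurzweil_Integration.integral_combine int) auto
            then have "integral {c..x + k} h - integral {c..x} h = integral {x..x + k} h"
              by linarith
            then show ?thesis
              using d1(2)[of k] True k unfolding eqs by (simp add: d_def dist_real_def hx)
          next
            case False
            then have k': "k < 0" "- k < d" using k by (auto simp: dist_real_def)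
            have "integral {c..x + k} h + integral {x + k..x} h = integral {c..x} h"
              using x k' by (intro Henstock_Kurzweil_Integration.integral_combine int) (auto simp: d_def)
            then have "integral {c..x + k} h - integral {c..x} h = - integral {x + k..x} h"
              by linarith
            then have "(integral {c..x + k} h - integral {c..x} h) / k = integral {x + k..x} h / (- k)"
              by simp
            also have "integral {x + k..x} h = integral {-x..-x + - k} (\<lambda>y. h (- y))"
              using Henstock_Kurzweil_Integration.integral_reflect_real[of x "x + k" h] by simp
            finally show ?thesis
              using d2(2)[of "- k"] k' unfolding eqs by (simp add: d_def dist_real_def hx)
          qed
        qed
      qed
    qed
  qed
qed

lemma AE_has_derivative_of_integral:
  fixes F g :: "real \<Rightarrow> real"
  assumes g: "set_integrable lborel {s..c} g"
    and F: "\<And>t. t \<in> {s..c} \<Longrightarrow> F t = d + (LINT y:{s..t}|lborel. g y)"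
  shows "AE t\<in>{s..c} in lborel. (F has_real_derivative g t) (at t)"
proof -
  have "AE t in lborel. t \<noteq> s" "AE t in lborel. t \<noteq> c" by (rule AE_lborel_singleton)+
  with AE_has_derivative_integral[OF g] show ?thesis
  proof eventually_elim
    case (elim t)
    show ?case
    proof
      assume "t \<in> {s..c}"
      then have t: "t \<in> {s<..<c}" using elim by auto
      then have "((\<lambda>t. d + (LINT y:{s..t}|lborel. g y)) has_real_derivative 0 + g t) (at t)"
        using elim by (intro derivative_intros) auto
      moreover have "\<forall>\<^sub>F x in nhds t. F x = d + (LINT y:{s..x}|lborel. g y)"
        using eventually_nhds_in_open[of "{s<..<c}" t] t by (auto elim!: eventually_mono intro: F)
      ultimately show "(F has_real_derivative g t) (at t)"
        by (subst DERIV_cong_ev[OF refl _ refl]) auto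
    qed
  qed
qed

text \<open>Truncation at a level \<open>n\<close>: the part of \<open>h\<close> above the level has
  integral below \<epsilon> / 2 by dominated convergence, and the rest contributes at most
  \<open>n\<close> times the measure of the set.\<close>

lemma integral_small_on_small_sets:
  fixes h :: "'a \<Rightarrow> real"
  assumes h: "integrable M h" and nn: "\<And>x. 0 \<le> h x" and "\<epsilon> > 0"
  obtains \<delta> where "\<delta> > 0" "\<And>T. T \<in> fmeasurable M \<Longrightarrow> measure M T < \<delta> \<Longrightarrow> (LINT x:T|M. h x) < \<epsilon>"
proof -
  have [measurable]: "h \<in> borel_measurable M" using h by auto
  have "(\<lambda>n. integral\<^sup>L M (\<lambda>x. h x - min (h x) (real n))) \<longlonglongrightarrow> integral\<^sup>L M (\<lambda>x. 0)"
  proof (rule integral_dominated_convergence[where w=h])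
    show "AE x in M. (\<lambda>n. h x - min (h x) (real n)) \<longlonglongrightarrow> 0"
    proof (rule AE_I2)
      fix x
      obtain N where "h x \<le> real N" using real_arch_simple by blast
      then have "\<forall>\<^sub>F n in sequentially. h x - min (h x) (real n) = 0"
        by (intro eventually_sequentiallyI[of N]) (simp add: min_def)
      then show "(\<lambda>n. h x - min (h x) (real n)) \<longlonglongrightarrow> 0" by (rule tendsto_eventually)
    qed
  qed (use h nn in \<open>auto simp: min_def\<close>)
  then have "\<forall>\<^sub>F n in sequentially. integral\<^sup>L M (\<lambda>x. h x - min (h x) (real n)) < \<epsilon> / 2"
    using \<open>\<epsilon> > 0\<close> by (intro order_tendstoD) auto
  then obtain n where n: "integral\<^sup>L M (\<lambda>x. h x - min (h x) (real n)) < \<epsilon> / 2"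
    by (auto simp: eventually_sequentially)
  show ?thesis
  proof
    show "\<epsilon> / (2 * (real n + 1)) > 0" using \<open>\<epsilon> > 0\<close> by simp
    fix T assume T: "T \<in> fmeasurable M" "measure M T < \<epsilon> / (2 * (real n + 1))"
    have [measurable]: "T \<in> sets M" using T by auto
    have i1: "integrable M (\<lambda>x. h x - min (h x) (real n))"
      by (rule Bochner_Integration.integrable_bound[OF h]) (use nn in \<open>auto simp: min_def\<close>)
    have i2: "integrable M (\<lambda>x. real n * indicator T x)" using T by (simp add: fmeasurable_def)
    have "(LINT x:T|M. h x) \<le> integral\<^sup>L M (\<lambda>x. (h x - min (h x) (real n)) + real n * indicator T x)"
      unfolding set_lebesgue_integral_def
      using i1 i2 integrable_mult_indicator[OF \<open>T \<in> sets M\<close> h] nn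
      by (intro integral_mono) (auto simp: min_def split: split_indicator)
    also have "\<dots> = integral\<^sup>L M (\<lambda>x. h x - min (h x) (real n)) + real n * measure M T"
      using i1 i2 T by (subst Bochner_Integration.integral_add) auto
    also have "\<dots> < \<epsilon>"
    proof -
      have "real n * measure M T \<le> (real n + 1) * measure M T" by (intro mult_right_mono) auto
      also have "\<dots> < \<epsilon> / 2" using T(2) by (simp add: field_simps)
      finally show ?thesis using n by simp
    qed
    finally show "(LINT x:T|M. h x) < \<epsilon>" .
  qed
qed

lemma abs_cont_on_integral:
  fixes g :: "real \<Rightarrow> real"
  assumes g: "set_integrable lborel {c..e} g"
    and F: "\<And>x. x \<in> {c..e} \<Longrightarrow> F x = d + (LINT y:{c..x}|lborel. g y)"
  shows "abs_cont_on {c..e} F"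
  unfolding abs_cont_on_iff
proof (intro allI impI)
  fix \<epsilon> :: real assume "\<epsilon> > 0"
  define h where "h = (\<lambda>y. indicator {c..e} y * \<bar>g y\<bar>)"
  have h: "integrable lborel h" using set_integrable_abs[OF g]
    by (simp add: h_def set_integrable_def)
  have nn: "0 \<le> h y" for y by (simp add: h_def)
  obtain \<delta> where \<delta>: "\<delta> > 0" "\<And>T. T \<in> fmeasurable lborel \<Longrightarrow> measure lborel T < \<delta> \<Longrightarrow> (LINT x:T|lborel. h x) < \<epsilon>"
    by (rule integral_small_on_small_sets[OF h nn \<open>\<epsilon> > 0\<close>]) blast
  have "osc_small {c..e} F \<delta> \<epsilon>"
    unfolding osc_small_def
  proof (intro allI impI)
    fix D T assume D: "D division_of T" "T \<subseteq> {c..e}" "(\<Sum>k\<in>D. measure lborel k) < \<delta>"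
    note dm = division_measure[OF D(1)]
    have gi: "set_integrable lborel {a..b} g" if "{a..b} \<subseteq> {c..e}" for a b
      by (rule set_integrable_subset[OF g]) (use that in auto)
    have hi: "set_integrable lborel S h" if "S \<in> sets borel" for S
      using h that integrable_mult_indicator[of S lborel h] by (simp add: set_integrable_def)
    have le: "\<bar>F (Sup k) - F (Inf k)\<bar> \<le> integral k h" if k: "k \<in> D" for k
    proof -
      note kk = division_of_real_interval[OF D(1) k]
      have sub: "{Inf k..Sup k} \<subseteq> {c..e}" using kk(3) D by blast
      then have io: "c \<le> Inf k" "Sup k \<le> e" using kk(2) by auto
      have eq: "(LINT y:{c..x}|lborel. g y) = integral {c..x} g" if "x \<le> e" for x
        by (rule set_borel_integral_eq_integral(2)[OF gi]) (use that in auto)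
      have "integral {c..Inf k} g + integral {Inf k..Sup k} g = integral {c..Sup k} g"
        using io kk(2) by (intro Henstock_Kurzweil_Integration.integral_combine set_borel_integral_eq_integral(1) gi) auto
      then have "F (Sup k) - F (Inf k) = integral {Inf k..Sup k} g"
        using F[of "Sup k"] F[of "Inf k"] io kk(2) eq[of "Inf k"] eq[of "Sup k"] by simp
      also have "norm \<dots> \<le> integral {Inf k..Sup k} h"
        using sub by (intro integral_norm_bound_integral set_borel_integral_eq_integral(1) gi hi) (auto simp: h_def)
      finally show ?thesis using kk(1) by simp
    qed
    have "osc F D \<le> (\<Sum>k\<in>D. integral k h)"
      unfolding osc_def by (intro sum_mono le)
    also have "\<dots> = integral T h"
      using D set_borel_integral_eq_integral(1)[OF hi[OF dm(2)]]
        by (intro integral_combine_division_topdown[symmetric]) auto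
    also have "\<dots> = (LINT x:T|lborel. h x)"
      by (rule set_borel_integral_eq_integral(2)[OF hi[OF dm(2)], symmetric])
    also have "\<dots> < \<epsilon>"
      using dm D by (intro \<delta>(2)) (auto simp: fmeasurable_def top.not_eq_extremum)
    finally show "osc F D < \<epsilon>" .
  qed
  then show "\<exists>\<delta>>0. osc_small {c..e} F \<delta> \<epsilon>" using \<delta>(1) by blast
qed

lemma continuous_AE_zero:
  fixes F :: "real \<Rightarrow> real"
  assumes "c < e" and cont: "continuous_on {c..e} F"
    and 0: "AE x\<in>{c..e} in lborel. F x = 0" and x: "x \<in> {c..e}"
  shows "F x = 0"
proof -
  have F0: "F x = 0" if "x \<in> {c<..<e}" for x
  proof (rule ccontr)
    assume "F x \<noteq> 0"
    have "continuous_on {c<..<e} F" using cont by (rule continuous_on_subset) auto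
    then have op: "open ({c<..<e} \<inter> F -` (- {0}))" by (intro continuous_open_preimage) auto
    have "x \<in> {c<..<e} \<inter> F -` (- {0})" using that \<open>F x \<noteq> 0\<close> by auto
    then have "\<not> negligible ({c<..<e} \<inter> F -` (- {0}))" using op open_not_negligible by blast
    moreover have "negligible ({c<..<e} \<inter> F -` (- {0}))"
    proof -
      have "AE x in lborel. x \<notin> {c<..<e} \<inter> F -` (- {0})"
        using 0 by eventually_elim auto
      then have "{c<..<e} \<inter> F -` (- {0}) \<in> null_sets lborel"
        using op by (subst AE_iff_null_sets) auto
      then show ?thesis by (simp add: negligible_iff_null_sets null_sets_completionI)
    qed
    ultimately show False by blast
  qed
  have "closure {c<..<e} = {c..e}" using \<open>c < e\<close> by simp
  then show ?thesis
    using continuous_constant_on_closure[of "{c<..<e}" F 0 x] cont F0 x by simp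
qed

text \<open>The primitive is continuous, hence zero at every point and not just almost everywhere,
  so that it may be differentiated; its derivative is \<open>h\<close> almost everywhere.\<close>

lemma AE_eq_zero_of_integral_zero:
  fixes h :: "real \<Rightarrow> real"
  assumes h: "set_integrable lborel {c..e} h"
    and 0: "AE x\<in>{c..e} in lborel. (LINT y:{c..x}|lborel. h y) = 0"
  shows "AE x\<in>{c..e} in lborel. h x = 0"
proof (cases "c < e")
  case True
  define F where "F = (\<lambda>x. LINT y:{c..x}|lborel. h y)"
  have "continuous_on {c..e} F"
    by (rule abs_cont_on_imp_continuous_on[OF abs_cont_on_integral[OF h, of _ 0]]) (simp add: F_def)
  moreover have "AE x\<in>{c..e} in lborel. F x = 0" using 0 by (simp add: F_def)
  ultimately have F0: "F x = 0" if "x \<in> {c..e}" for x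
    using that by (rule continuous_AE_zero[OF True])
  have "AE x in lborel. x \<noteq> c" "AE x in lborel. x \<noteq> e" by (rule AE_lborel_singleton)+
  with AE_has_derivative_integral[OF h] show ?thesis
  proof eventually_elim
    case (elim x)
    show ?case
    proof
      assume "x \<in> {c..e}"
      then have x: "x \<in> {c<..<e}" using elim by auto
      then have "(F has_real_derivative h x) (at x)" using elim by (simp add: F_def)
      moreover have "(F has_real_derivative 0) (at x)"
        by (rule DERIV_cong_ev[OF refl _ refl, THEN iffD2, of _ "\<lambda>_. 0"])
           (use F0 x in \<open>auto intro!: eventually_nhds_in_open[THEN eventually_mono, of "{c<..<e}"]\<close>)
      ultimately show "h x = 0" by (rule DERIV_unique)
    qed
  qed
next
  case False
  have "AE x in lborel. x \<noteq> c" by (rule AE_lborel_singleton)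
  then show ?thesis by eventually_elim (use False in auto)
qed

section \<open>Integral kernels on a sigma-finite measure space\<close>

text \<open>The bound is uniform over the columns \<open>X(\<cdot>, y)\<close>; this class is closed under composition and
  acts on integrable functions.\<close>

definition kernel :: "'a measure \<Rightarrow> ('a \<Rightarrow> 'a \<Rightarrow> real) \<Rightarrow> bool" where
  "kernel M X \<longleftrightarrow> (\<lambda>(x, y). X x y) \<in> borel_measurable (M \<Otimes>\<^sub>M M) \<and>
     (\<exists>C. \<forall>y\<in>space M. (\<integral>\<^sup>+x. ennreal \<bar>X x y\<bar> \<partial>M) \<le> ennreal C)"

text \<open>The integral takes the value 0 where the product is not integrable, so linearity and
  associativity hold only for almost every \<open>x\<close>.\<close>

definition kop :: "'a measure \<Rightarrow> ('a \<Rightarrow> 'a \<Rightarrow> real) \<Rightarrow> ('a \<Rightarrow> real) \<Rightarrow> 'a \<Rightarrow> real" where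
  "kop M X f x = (\<integral>y. X x y * f y \<partial>M)"

lemma kernel_measurable[measurable_dest]: "kernel M X \<Longrightarrow> case_prod X \<in> borel_measurable (M \<Otimes>\<^sub>M M)"
  by (simp add: kernel_def)

lemma ennreal_abs_integral_le:
  fixes g :: "'a \<Rightarrow> real"
  shows "ennreal \<bar>\<integral>x. g x \<partial>M\<bar> \<le> (\<integral>\<^sup>+x. ennreal \<bar>g x\<bar> \<partial>M)"
proof (cases "integrable M g")
  case True
  then show ?thesis using integral_norm_bound_ennreal[OF True] by simp
qed (simp add: not_integrable_integral_eq)

context sigma_finite_measure
begin

lemma pair_self: "pair_sigma_finite M M"
  by (intro pair_sigma_finite.intro sigma_finite_measure_axioms)

text \<open>Tonelli turns a bound on weighted columns into an operator bound in weighted L1.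
  Constant \<open>w\<close> and \<open>v\<close> give boundedness of the operator; \<open>v\<close>
  equal to half of \<open>w\<close> gives the contraction.\<close>

lemma kernel_nn_integral:
  assumes X[measurable]: "case_prod X \<in> borel_measurable (M \<Otimes>\<^sub>M M)"
    and [measurable]: "g \<in> borel_measurable M" "w \<in> borel_measurable M"
    and le: "\<And>y. y \<in> space M \<Longrightarrow> (\<integral>\<^sup>+x. w x * ennreal \<bar>X x y\<bar> \<partial>M) \<le> v y"
  shows "(\<integral>\<^sup>+x. w x * (\<integral>\<^sup>+y. ennreal \<bar>X x y\<bar> * g y \<partial>M) \<partial>M) \<le> (\<integral>\<^sup>+y. v y * g y \<partial>M)"
proof -
  interpret P: pair_sigma_finite M M by (rule pair_self)
  have "(\<integral>\<^sup>+x. w x * (\<integral>\<^sup>+y. ennreal \<bar>X x y\<bar> * g y \<partial>M) \<partial>M)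
     = (\<integral>\<^sup>+x. (\<integral>\<^sup>+y. w x * ennreal \<bar>X x y\<bar> * g y \<partial>M) \<partial>M)"
    by (intro nn_integral_cong) (simp add: nn_integral_cmult mult.assoc)
  also have "\<dots> = (\<integral>\<^sup>+y. (\<integral>\<^sup>+x. w x * ennreal \<bar>X x y\<bar> * g y \<partial>M) \<partial>M)"
    by (rule P.Fubini'[symmetric]) measurable
  also have "\<dots> = (\<integral>\<^sup>+y. (\<integral>\<^sup>+x. w x * ennreal \<bar>X x y\<bar> \<partial>M) * g y \<partial>M)"
    by (intro nn_integral_cong nn_integral_multc) measurable
  also have "\<dots> \<le> (\<integral>\<^sup>+y. v y * g y \<partial>M)"
    by (intro nn_integral_mono mult_right_mono le) auto
  finally show ?thesis .
qed

lemma kernel_pair_integrable: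
  assumes X: "kernel M X" and f: "integrable M f"
  shows "integrable (M \<Otimes>\<^sub>M M) (\<lambda>(x, y). X x y * f y)"
proof -
  note [measurable] = kernel_measurable[OF X] borel_measurable_integrable[OF f]
  obtain C where C: "\<And>y. y \<in> space M \<Longrightarrow> (\<integral>\<^sup>+x. 1 * ennreal \<bar>X x y\<bar> \<partial>M) \<le> ennreal C"
    using X unfolding kernel_def by auto
  have "(\<integral>\<^sup>+p. ennreal (norm (case p of (x, y) \<Rightarrow> X x y * f y)) \<partial>(M \<Otimes>\<^sub>M M)) =
    (\<integral>\<^sup>+x. (\<integral>\<^sup>+y. ennreal \<bar>X x y\<bar> * ennreal \<bar>f y\<bar> \<partial>M) \<partial>M)"
    by (subst nn_integral_fst[symmetric]) (auto simp: abs_mult ennreal_mult)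
  also have "\<dots> = (\<integral>\<^sup>+x. 1 * (\<integral>\<^sup>+y. ennreal \<bar>X x y\<bar> * ennreal \<bar>f y\<bar> \<partial>M) \<partial>M)" by simp
  also have "\<dots> \<le> (\<integral>\<^sup>+y. ennreal C * ennreal \<bar>f y\<bar> \<partial>M)"
    by (rule kernel_nn_integral[OF _ _ _ C]) measurable
  also have "\<dots> = ennreal C * (\<integral>\<^sup>+y. ennreal \<bar>f y\<bar> \<partial>M)" by (rule nn_integral_cmult) measurable
  also have "\<dots> < \<infinity>"
    using f by (simp add: integrable_iff_bounded ennreal_mult_less_top)
  finally show ?thesis by (intro integrableI_bounded) auto
qed

lemma AE_kernel_integrable:
  assumes "kernel M X" "integrable M f"
  shows "AE x in M. integrable M (\<lambda>y. X x y * f y)"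
  using pair_sigma_finite.AE_integrable_fst'[OF pair_self kernel_pair_integrable[OF assms]] by simp

lemma integrable_kop:
  assumes "kernel M X" "integrable M f"
  shows "integrable M (kop M X f)"
proof -
  have "kop M X f = (\<lambda>x. \<integral>y. X x y * f y \<partial>M)" by (auto simp: kop_def)
  then show ?thesis using pair_sigma_finite.integrable_fst'[OF pair_self kernel_pair_integrable[OF assms]] by simp
qed

lemma kernel_comp:
  assumes X: "kernel M X" and Y: "kernel M Y"
  shows "kernel M (\<lambda>x z. kop M X (\<lambda>y. Y y z) x)"
proof -
  note [measurable] = kernel_measurable[OF X] kernel_measurable[OF Y]
  obtain C where C: "\<And>y. y \<in> space M \<Longrightarrow> (\<integral>\<^sup>+x. 1 * ennreal \<bar>X x y\<bar> \<partial>M) \<le> ennreal C"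
    using X unfolding kernel_def by auto
  obtain C' where C': "\<And>y. y \<in> space M \<Longrightarrow> (\<integral>\<^sup>+x. ennreal \<bar>Y x y\<bar> \<partial>M) \<le> ennreal C'"
    using Y unfolding kernel_def by auto
  \<comment> \<open>\<open>ennreal\<close> sends negative reals to 0, so the column bounds
    \<open>C\<close> and \<open>C'\<close> may be negative; only their positive parts may be
    multiplied.\<close>
  have "(\<integral>\<^sup>+x. ennreal \<bar>kop M X (\<lambda>y. Y y z) x\<bar> \<partial>M) \<le> ennreal (max 0 C * max 0 C')"
    if z: "z \<in> space M" for z
  proof -
    have [measurable]: "(\<lambda>x. Y x z) \<in> borel_measurable M" using z by measurable
    have "(\<integral>\<^sup>+x. ennreal \<bar>kop M X (\<lambda>y. Y y z) x\<bar> \<partial>M) \<le> (\<integral>\<^sup>+x. 1 * (\<integral>\<^sup>+y. ennreal \<bar>X x y\<bar> * ennreal \<bar>Y y z\<bar> \<partial>M) \<partial>M)"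
    proof (intro nn_integral_mono)
      fix x
      have "ennreal \<bar>kop M X (\<lambda>y. Y y z) x\<bar> \<le> (\<integral>\<^sup>+y. ennreal \<bar>X x y * Y y z\<bar> \<partial>M)"
        unfolding kop_def by (rule ennreal_abs_integral_le)
      also have "\<dots> = 1 * (\<integral>\<^sup>+y. ennreal \<bar>X x y\<bar> * ennreal \<bar>Y y z\<bar> \<partial>M)"
        by (simp add: abs_mult ennreal_mult)
      finally show "ennreal \<bar>kop M X (\<lambda>y. Y y z) x\<bar> \<le> 1 * (\<integral>\<^sup>+y. ennreal \<bar>X x y\<bar> * ennreal \<bar>Y y z\<bar> \<partial>M)" .
    qed
    also have "\<dots> \<le> (\<integral>\<^sup>+y. ennreal C * ennreal \<bar>Y y z\<bar> \<partial>M)"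
      by (rule kernel_nn_integral[OF _ _ _ C]) measurable
    also have "\<dots> = ennreal C * (\<integral>\<^sup>+y. ennreal \<bar>Y y z\<bar> \<partial>M)" by (rule nn_integral_cmult) measurable
    also have "\<dots> \<le> ennreal (max 0 C) * ennreal (max 0 C')"
      by (intro mult_mono order_trans[OF C'[OF z]] ennreal_leI) auto
    also have "\<dots> = ennreal (max 0 C * max 0 C')" by (simp add: ennreal_mult)
    finally show ?thesis .
  qed
  moreover have "(\<lambda>(x, z). kop M X (\<lambda>y. Y y z) x) \<in> borel_measurable (M \<Otimes>\<^sub>M M)"
    unfolding kop_def by measurable
  ultimately show ?thesis unfolding kernel_def by blast
qed

text \<open>Fubini in the two inner variables with \<open>x\<close> fixed. It applies for almost
  every \<open>x\<close>, because the absolute triple product, integrated over all variables, is at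
  most the product of the two column bounds and the L1 norm of \<open>f\<close>.\<close>

lemma kop_kop:
  assumes X: "kernel M X" and Y: "kernel M Y" and f: "integrable M f"
  shows "AE x in M. kop M X (kop M Y f) x = kop M (\<lambda>x z. kop M X (\<lambda>y. Y y z) x) f x"
proof -
  interpret P: pair_sigma_finite M M by (rule pair_self)
  note [measurable] = kernel_measurable[OF X] kernel_measurable[OF Y] borel_measurable_integrable[OF f]
  obtain C where C: "\<And>y. y \<in> space M \<Longrightarrow> (\<integral>\<^sup>+x. 1 * ennreal \<bar>X x y\<bar> \<partial>M) \<le> ennreal C"
    using X unfolding kernel_def by auto
  obtain C' where C': "\<And>y. y \<in> space M \<Longrightarrow> (\<integral>\<^sup>+x. 1 * ennreal \<bar>Y x y\<bar> \<partial>M) \<le> ennreal C'"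
    using Y unfolding kernel_def by auto
  define g where "g y = (\<integral>\<^sup>+z. ennreal \<bar>Y y z\<bar> * ennreal \<bar>f z\<bar> \<partial>M)" for y
  have [measurable]: "g \<in> borel_measurable M" unfolding g_def by measurable
  have "(\<integral>\<^sup>+x. 1 * (\<integral>\<^sup>+y. ennreal \<bar>X x y\<bar> * g y \<partial>M) \<partial>M) \<le> (\<integral>\<^sup>+y. ennreal C * g y \<partial>M)"
    by (rule kernel_nn_integral[OF _ _ _ C]) measurable
  also have "\<dots> = ennreal C * (\<integral>\<^sup>+y. 1 * g y \<partial>M)" by (simp add: nn_integral_cmult)
  also have "\<dots> \<le> ennreal C * (\<integral>\<^sup>+z. ennreal C' * ennreal \<bar>f z\<bar> \<partial>M)"
    unfolding g_def by (intro mult_left_mono kernel_nn_integral[OF _ _ _ C']) auto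
  also have "\<dots> = ennreal C * (ennreal C' * (\<integral>\<^sup>+z. ennreal \<bar>f z\<bar> \<partial>M))"
    by (subst nn_integral_cmult) auto
  also have "\<dots> < \<infinity>"
    using f by (simp add: integrable_iff_bounded ennreal_mult_less_top)
  finally have "AE x in M. (\<integral>\<^sup>+y. ennreal \<bar>X x y\<bar> * g y \<partial>M) \<noteq> \<infinity>"
    by (intro nn_integral_noteq_infinite) auto
  then show ?thesis
    using AE_space
  proof eventually_elim
    case (elim x)
    note [measurable] = elim(2)
    have "integrable (M \<Otimes>\<^sub>M M) (\<lambda>(y, z). X x y * (Y y z * f z))"
    proof (rule integrableI_bounded)
      have "(\<integral>\<^sup>+p. ennreal (norm (case p of (y, z) \<Rightarrow> X x y * (Y y z * f z))) \<partial>(M \<Otimes>\<^sub>M M)) =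
        (\<integral>\<^sup>+y. (\<integral>\<^sup>+z. ennreal \<bar>X x y\<bar> * (ennreal \<bar>Y y z\<bar> * ennreal \<bar>f z\<bar>) \<partial>M) \<partial>M)"
        by (subst nn_integral_fst[symmetric]) (auto simp: abs_mult ennreal_mult)
      also have "\<dots> = (\<integral>\<^sup>+y. ennreal \<bar>X x y\<bar> * g y \<partial>M)"
        unfolding g_def by (intro nn_integral_cong nn_integral_cmult) measurable
      finally show "(\<integral>\<^sup>+p. ennreal (norm (case p of (y, z) \<Rightarrow> X x y * (Y y z * f z))) \<partial>(M \<Otimes>\<^sub>M M)) < \<infinity>"
        using elim(1) by (simp add: top.not_eq_extremum)
    qed measurable
    then have "(\<integral>z. (\<integral>y. X x y * (Y y z * f z) \<partial>M) \<partial>M) = (\<integral>y. (\<integral>z. X x y * (Y y z * f z) \<partial>M) \<partial>M)"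
      by (rule P.Fubini_integral)
    moreover have "(\<integral>y. X x y * (Y y z * f z) \<partial>M) = (\<integral>y. X x y * Y y z \<partial>M) * f z" for z
      by (simp add: mult.assoc[symmetric])
    ultimately show ?case unfolding kop_def by simp
  qed
qed

lemma AE_kop_diff:
  assumes "kernel M X" "integrable M f" "integrable M g"
  shows "AE x in M. kop M X (\<lambda>y. f y - g y) x = kop M X f x - kop M X g x"
  using AE_kernel_integrable[OF assms(1,2)] AE_kernel_integrable[OF assms(1,3)]
  by eventually_elim (simp add: kop_def right_diff_distrib)

lemma AE_kop_add:
  assumes "kernel M X" "integrable M f" "integrable M g"
  shows "AE x in M. kop M X (\<lambda>y. f y + g y) x = kop M X f x + kop M X g x"
  using AE_kernel_integrable[OF assms(1,2)] AE_kernel_integrable[OF assms(1,3)]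
  by eventually_elim (simp add: kop_def distrib_left)

text \<open>In the norm of L1 weighted by \<open>w\<close> the operator halves, so the norm of
  \<open>z\<close> is at most that of \<open>f\<close> plus half of itself. The last term can be
  absorbed because \<open>w\<close> is at most 1 and the norm of \<open>z\<close> is therefore
  finite.\<close>

lemma kernel_a_priori_bound:
  assumes P: "kernel M P" and [measurable]: "w \<in> borel_measurable M" "f \<in> borel_measurable M"
    and w: "\<And>x. w x \<le> 1"
    and le: "\<And>y. y \<in> space M \<Longrightarrow> (\<integral>\<^sup>+x. w x * ennreal \<bar>P x y\<bar> \<partial>M) \<le> ennreal (1 / 2) * w y"
    and z: "integrable M z" and eq: "AE x in M. z x = f x + kop M P z x"
  shows "(\<integral>\<^sup>+x. w x * ennreal \<bar>z x\<bar> \<partial>M) \<le> 2 * (\<integral>\<^sup>+x. w x * ennreal \<bar>f x\<bar> \<partial>M)"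
proof -
  note [measurable] = kernel_measurable[OF P] borel_measurable_integrable[OF z]
  define I where "I = (\<integral>\<^sup>+x. w x * ennreal \<bar>z x\<bar> \<partial>M)"
  define F where "F = (\<integral>\<^sup>+x. w x * ennreal \<bar>f x\<bar> \<partial>M)"
  have "I \<le> (\<integral>\<^sup>+x. 1 * ennreal \<bar>z x\<bar> \<partial>M)"
    unfolding I_def by (intro nn_integral_mono mult_right_mono w) auto
  also have "\<dots> < \<infinity>" using z by (simp add: integrable_iff_bounded)
  finally have fin: "I < \<infinity>" .
  have "I \<le> (\<integral>\<^sup>+x. w x * ennreal \<bar>f x\<bar> + w x * (\<integral>\<^sup>+y. ennreal \<bar>P x y\<bar> * ennreal \<bar>z y\<bar> \<partial>M) \<partial>M)"
    unfolding I_def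
  proof (rule nn_integral_mono_AE, use eq in eventually_elim)
    fix x assume x: "z x = f x + kop M P z x"
    have "ennreal \<bar>kop M P z x\<bar> \<le> (\<integral>\<^sup>+y. ennreal \<bar>P x y * z y\<bar> \<partial>M)"
      unfolding kop_def by (rule ennreal_abs_integral_le)
    also have "\<dots> = (\<integral>\<^sup>+y. ennreal \<bar>P x y\<bar> * ennreal \<bar>z y\<bar> \<partial>M)" by (simp add: abs_mult ennreal_mult)
    finally have 1: "ennreal \<bar>kop M P z x\<bar> \<le> (\<integral>\<^sup>+y. ennreal \<bar>P x y\<bar> * ennreal \<bar>z y\<bar> \<partial>M)" .
    have "ennreal \<bar>z x\<bar> \<le> ennreal (\<bar>f x\<bar> + \<bar>kop M P z x\<bar>)" unfolding x by (intro ennreal_leI) auto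
    also have "\<dots> = ennreal \<bar>f x\<bar> + ennreal \<bar>kop M P z x\<bar>" by simp
    also have "\<dots> \<le> ennreal \<bar>f x\<bar> + (\<integral>\<^sup>+y. ennreal \<bar>P x y\<bar> * ennreal \<bar>z y\<bar> \<partial>M)" using 1
      by (rule add_left_mono)
    finally show "w x * ennreal \<bar>z x\<bar> \<le> w x * ennreal \<bar>f x\<bar> + w x * (\<integral>\<^sup>+y. ennreal \<bar>P x y\<bar> * ennreal \<bar>z y\<bar> \<partial>M)"
      unfolding distrib_left[symmetric] by (rule mult_left_mono) auto
  qed
  also have "\<dots> = F + (\<integral>\<^sup>+x. w x * (\<integral>\<^sup>+y. ennreal \<bar>P x y\<bar> * ennreal \<bar>z y\<bar> \<partial>M) \<partial>M)"
    unfolding F_def by (rule nn_integral_add) measurable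
  also have "\<dots> \<le> F + (\<integral>\<^sup>+y. ennreal (1 / 2) * w y * ennreal \<bar>z y\<bar> \<partial>M)"
    by (intro add_left_mono kernel_nn_integral le) auto
  also have "\<dots> = F + ennreal (1 / 2) * I"
    unfolding I_def by (subst nn_integral_cmult[symmetric]) (auto simp: mult.assoc)
  finally have *: "I \<le> F + ennreal (1 / 2) * I" .
  have "I \<le> 2 * F"
  proof (cases F)
    case (real r)
    obtain i where i: "I = ennreal i" "i \<ge> 0" using fin by (cases I) auto
    have "ennreal r + ennreal (1 / 2) * ennreal i = ennreal (r + 1 / 2 * i)"
      using i real by (subst ennreal_mult[symmetric], simp, simp, subst ennreal_plus[symmetric]) auto
    with * have "ennreal i \<le> ennreal (r + 1 / 2 * i)" unfolding i(1) real(2) by (simp only:)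
    then have "i \<le> 2 * r" using i real by (subst (asm) ennreal_le_iff) auto
    then have "ennreal i \<le> ennreal (2 * r)" by (rule ennreal_leI)
    then show ?thesis using i real by (simp add: ennreal_mult)
  qed (simp add: ennreal_mult_top)
  then show ?thesis by (simp add: I_def F_def)
qed

lemma kernel_unique:
  assumes P: "kernel M P" and [measurable]: "w \<in> borel_measurable M"
    and w: "\<And>x. w x \<le> 1" "\<And>x. 0 < w x"
    and le: "\<And>y. y \<in> space M \<Longrightarrow> (\<integral>\<^sup>+x. w x * ennreal \<bar>P x y\<bar> \<partial>M) \<le> ennreal (1 / 2) * w y"
    and z: "integrable M z" and eq: "AE x in M. z x = kop M P z x"
  shows "AE x in M. z x = 0"
proof -
  note [measurable] = borel_measurable_integrable[OF z]
  have "(\<integral>\<^sup>+x. w x * ennreal \<bar>z x\<bar> \<partial>M) \<le> 2 * (\<integral>\<^sup>+x. w x * ennreal \<bar>0\<bar> \<partial>M)"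
    by (rule kernel_a_priori_bound[OF P _ _ w(1) le z]) (use eq in auto)
  then have "(\<integral>\<^sup>+x. w x * ennreal \<bar>z x\<bar> \<partial>M) = 0" by simp
  then have "AE x in M. w x * ennreal \<bar>z x\<bar> = 0"
    by (subst (asm) nn_integral_0_iff_AE) auto
  then show ?thesis
    by eventually_elim (use w(2) in \<open>force simp: less_le\<close>)
qed

text \<open>\<open>Q\<close> is the resolvent of \<open>P\<close>: since \<open>P\<close> composed
  with \<open>Q\<close> is \<open>Q - P\<close>, the function \<open>W = z - Q f - f\<close>
  satisfies \<open>W = P W\<close>, and uniqueness makes it vanish.\<close>

lemma kernel_resolvent:
  assumes P: "kernel M P" and Q: "kernel M Q" and [measurable]: "w \<in> borel_measurable M"
    and w: "\<And>x. w x \<le> 1" "\<And>x. 0 < w x"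
    and le: "\<And>y. y \<in> space M \<Longrightarrow> (\<integral>\<^sup>+x. w x * ennreal \<bar>P x y\<bar> \<partial>M) \<le> ennreal (1 / 2) * w y"
    and PQ: "AE y in M. AE x in M. Q x y = P x y + kop M P (\<lambda>z. Q z y) x"
    and z: "integrable M z" and f: "integrable M f" and eq: "AE x in M. z x = f x + kop M P z x"
  shows "AE x in M. z x = f x + kop M Q f x"
proof -
  interpret P: pair_sigma_finite M M by (rule pair_self)
  define R where "R = (\<lambda>x y. kop M P (\<lambda>z. Q z y) x)"
  have R: "kernel M R" unfolding R_def by (rule kernel_comp[OF P Q])
  note [measurable] = kernel_measurable[OF P] kernel_measurable[OF Q] kernel_measurable[OF R]
    borel_measurable_integrable[OF z] borel_measurable_integrable[OF f]
  \<comment> \<open>The assumption concerns almost every column, whereas applying a kernel to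
    \<open>f\<close> integrates along a row. The two almost-everywhere quantifiers are exchanged
    first.\<close>
  have "AE x in M. AE y in M. R x y = Q x y - P x y"
  proof (subst P.AE_commute)
    show "{x \<in> space (M \<Otimes>\<^sub>M M). R (fst x) (snd x) = Q (fst x) (snd x) - P (fst x) (snd x)} \<in> sets (M \<Otimes>\<^sub>M M)"
      by measurable
    show "AE y in M. AE x in M. R x y = Q x y - P x y"
      using PQ by eventually_elim (auto simp: R_def elim!: eventually_mono)
  qed
  then have Rf: "AE x in M. kop M R f x = kop M Q f x - kop M P f x"
    using AE_kernel_integrable[OF P f] AE_kernel_integrable[OF Q f] AE_space
  proof eventually_elim
    case (elim x)
    note [measurable] = elim(4)
    have "kop M R f x = (\<integral>y. (Q x y - P x y) * f y \<partial>M)"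
      unfolding kop_def using elim(1) by (intro integral_cong_AE) (auto elim!: eventually_mono)
    then show ?case using elim(2,3) by (simp add: kop_def left_diff_distrib)
  qed
  define W where "W = (\<lambda>x. z x - kop M Q f x - f x)"
  have iQ: "integrable M (kop M Q f)" by (rule integrable_kop[OF Q f])
  have iW: "integrable M W" unfolding W_def using z f iQ by auto
  have izQ: "integrable M (\<lambda>x. z x - kop M Q f x)" using z iQ by auto
  have "AE x in M. W x = kop M P W x"
    using Rf kop_kop[OF P Q f] AE_kop_diff[OF P izQ f] AE_kop_diff[OF P z iQ] eq
  proof eventually_elim
    case (elim x)
    have "kop M P W x = kop M P z x - kop M R f x - kop M P f x"
      using elim unfolding W_def R_def by simp
    then show ?case using elim(1,5) by (simp add: W_def)
  qed
  from kernel_unique[OF P _ w le iW this] have "AE x in M. W x = 0" by simp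
  then show ?thesis by eventually_elim (simp add: W_def)
qed

end

section \<open>Fractional integral kernels\<close>

text \<open>The Riemann-Liouville kernel of order \<beta>. Its value 0 on the left half-line turns
  the Volterra integral into a convolution over the whole line.\<close>

definition frac_kernel :: "real \<Rightarrow> real \<Rightarrow> real" where
  "frac_kernel \<beta> x = (if x > 0 then 1 / Gamma \<beta> * x powr (\<beta> - 1) else 0)"

text \<open>The cut-off outside \<open>s \<le> \<tau> < t \<le> c\<close> makes the columns integrable over the whole line.\<close>

definition frac_op_kernel :: "real \<Rightarrow> real \<Rightarrow> real \<Rightarrow> real \<Rightarrow> real \<Rightarrow> real" where
  "frac_op_kernel \<beta> s c t \<tau> = (if s \<le> \<tau> \<and> t \<le> c then frac_kernel \<beta> (t - \<tau>) else 0)"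

lemma frac_kernel_measurable[measurable]: "frac_kernel \<beta> \<in> borel_measurable borel"
  unfolding frac_kernel_def by measurable

lemma frac_kernel_nonneg: "\<beta> > 0 \<Longrightarrow> 0 \<le> frac_kernel \<beta> x"
  by (auto simp: frac_kernel_def intro!: mult_nonneg_nonneg divide_nonneg_nonneg less_imp_le[OF Gamma_real_pos])

lemma frac_kernel_1: "frac_kernel 1 x = (if x > 0 then 1 else 0)"
  by (simp add: frac_kernel_def)

text \<open>The Gamma integral after the substitution of \<open>\<mu> * x\<close>. As \<mu> grows
  the value tends to 0, and this is the source of the contraction.\<close>

lemma frac_kernel_laplace:
  assumes "\<beta> > 0" "\<mu> > 0"
  shows "(\<integral>\<^sup>+x. ennreal (exp (- \<mu> * x)) * ennreal (frac_kernel \<beta> x) \<partial>lborel) = ennreal (\<mu> powr (- \<beta>))"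
proof -
  have G: "Gamma \<beta> > 0" using assms by (intro Gamma_real_pos)
  then have G0: "Gamma \<beta> \<noteq> 0" by simp
  have "ennreal (Gamma \<beta>) = (\<integral>\<^sup>+t. ennreal (indicator {0..} t * t powr (\<beta> - 1) / exp t) \<partial>lborel)"
    by (rule Gamma_conv_nn_integral_real[OF assms(1)])
  also have "\<dots> = ennreal \<bar>\<mu>\<bar> * (\<integral>\<^sup>+x. ennreal (indicator {0..} (0 + \<mu> * x) * (0 + \<mu> * x) powr (\<beta> - 1) / exp (0 + \<mu> * x)) \<partial>lborel)"
    using assms by (intro nn_integral_real_affine) auto
  also have "\<dots> = ennreal \<mu> * (\<integral>\<^sup>+x. ennreal (\<mu> powr (\<beta> - 1) * Gamma \<beta>) * (ennreal (exp (- \<mu> * x)) * ennreal (frac_kernel \<beta> x)) \<partial>lborel)"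
  proof -
    have "indicator {0..} (0 + \<mu> * x) * (0 + \<mu> * x) powr (\<beta> - 1) / exp (0 + \<mu> * x) =
       (\<mu> powr (\<beta> - 1) * Gamma \<beta>) * (exp (- \<mu> * x) * frac_kernel \<beta> x)" for x
      using assms less_imp_neq[OF G] by (auto simp: frac_kernel_def indicator_def powr_mult exp_minus field_simps zero_le_mult_iff)
    then show ?thesis
      using assms G frac_kernel_nonneg[OF assms(1)] by (simp add: ennreal_mult)
  qed
  also have "\<dots> = ennreal \<mu> * (ennreal (\<mu> powr (\<beta> - 1) * Gamma \<beta>) * (\<integral>\<^sup>+x. ennreal (exp (- \<mu> * x)) * ennreal (frac_kernel \<beta> x) \<partial>lborel))"
    by (subst nn_integral_cmult) auto
  also have "\<dots> = ennreal (\<mu> powr \<beta> * Gamma \<beta>) * (\<integral>\<^sup>+x. ennreal (exp (- \<mu> * x)) * ennreal (frac_kernel \<beta> x) \<partial>lborel)"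
  proof -
    have "\<mu> powr \<beta> * Gamma \<beta> = \<mu> * (\<mu> powr (\<beta> - 1) * Gamma \<beta>)"
      using assms by (simp add: powr_diff)
    then show ?thesis using assms G by (simp add: ennreal_mult mult.assoc)
  qed
  finally have *: "ennreal (Gamma \<beta>) = ennreal (\<mu> powr \<beta> * Gamma \<beta>) * (\<integral>\<^sup>+x. ennreal (exp (- \<mu> * x)) * ennreal (frac_kernel \<beta> x) \<partial>lborel)" .
  have "ennreal (\<mu> powr (- \<beta>)) = ennreal (1 / (\<mu> powr \<beta> * Gamma \<beta>)) * ennreal (Gamma \<beta>)"
    using assms G G0 by (subst ennreal_mult[symmetric]) (auto simp: powr_minus field_simps)
  also have "\<dots> = ennreal (1 / (\<mu> powr \<beta> * Gamma \<beta>)) * ennreal (\<mu> powr \<beta> * Gamma \<beta>) * (\<integral>\<^sup>+x. ennreal (exp (- \<mu> * x)) * ennreal (frac_kernel \<beta> x) \<partial>lborel)"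
    by (subst *) (simp add: mult.assoc)
  also have "ennreal (1 / (\<mu> powr \<beta> * Gamma \<beta>)) * ennreal (\<mu> powr \<beta> * Gamma \<beta>) = 1"
    using assms G G0 by (subst ennreal_mult[symmetric]) auto
  finally show ?thesis by simp
qed

lemma frac_kernel_laplace_shift:
  assumes "\<beta> > 0" "\<mu> > 0"
  shows "(\<integral>\<^sup>+t. ennreal (exp (- \<mu> * (t - \<tau>))) * ennreal (frac_kernel \<beta> (t - \<tau>)) \<partial>lborel) = ennreal (\<mu> powr (- \<beta>))"
  using nn_integral_real_affine[of "\<lambda>x. ennreal (exp (- \<mu> * x)) * ennreal (frac_kernel \<beta> x)" 1 "- \<tau>"]
    frac_kernel_laplace[OF assms] by (simp add: algebra_simps)

text \<open>On the support \<open>t - \<tau>\<close> is at most \<open>c - s\<close>, so the factor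
  \<open>exp (c - s) * exp (- (t - \<tau>))\<close> is at least 1 and may be inserted. What remains
  is the Laplace transform at \<mu> = 1, which equals 1.\<close>

lemma frac_op_kernel_kernel:
  assumes "\<beta> > 0"
  shows "kernel lborel (frac_op_kernel \<beta> s c)"
  unfolding kernel_def
proof (intro conjI exI[of _ "exp (c - s)"] ballI)
  show "case_prod (frac_op_kernel \<beta> s c) \<in> borel_measurable (lborel \<Otimes>\<^sub>M lborel)"
    unfolding frac_op_kernel_def by measurable
  fix \<tau> :: real
  have "(\<integral>\<^sup>+t. ennreal \<bar>frac_op_kernel \<beta> s c t \<tau>\<bar> \<partial>lborel) \<le>
    (\<integral>\<^sup>+t. ennreal (exp (c - s)) * (ennreal (exp (- 1 * (t - \<tau>))) * ennreal (frac_kernel \<beta> (t - \<tau>))) \<partial>lborel)"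
  proof (rule nn_integral_mono)
    fix t
    have "\<bar>frac_op_kernel \<beta> s c t \<tau>\<bar> \<le> exp (c - s) * (exp (- 1 * (t - \<tau>)) * frac_kernel \<beta> (t - \<tau>))"
    proof (cases "s \<le> \<tau> \<and> t \<le> c")
      case True
      have "1 * frac_kernel \<beta> (t - \<tau>) \<le> (exp (c - s) * exp (- 1 * (t - \<tau>))) * frac_kernel \<beta> (t - \<tau>)"
        using True frac_kernel_nonneg[OF assms]
          by (intro mult_right_mono) (auto simp: exp_add[symmetric])
      then show ?thesis using True frac_kernel_nonneg[OF assms]
        by (simp add: frac_op_kernel_def mult.assoc)
    next
      case False
      then have "frac_op_kernel \<beta> s c t \<tau> = 0" by (auto simp: frac_op_kernel_def)
      then show ?thesis using frac_kernel_nonneg[OF assms] by simp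
    qed
    then have "ennreal \<bar>frac_op_kernel \<beta> s c t \<tau>\<bar> \<le> ennreal (exp (c - s) * (exp (- 1 * (t - \<tau>)) * frac_kernel \<beta> (t - \<tau>)))"
      by (rule ennreal_leI)
    also have "\<dots> = ennreal (exp (c - s)) * (ennreal (exp (- 1 * (t - \<tau>))) * ennreal (frac_kernel \<beta> (t - \<tau>)))"
      using frac_kernel_nonneg[OF assms] by (simp add: ennreal_mult)
    finally show "ennreal \<bar>frac_op_kernel \<beta> s c t \<tau>\<bar> \<le> ennreal (exp (c - s)) * (ennreal (exp (- 1 * (t - \<tau>))) * ennreal (frac_kernel \<beta> (t - \<tau>)))" .
  qed
  also have "\<dots> = ennreal (exp (c - s)) * (\<integral>\<^sup>+t. ennreal (exp (- 1 * (t - \<tau>))) * ennreal (frac_kernel \<beta> (t - \<tau>)) \<partial>lborel)"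
    by (rule nn_integral_cmult) measurable
  also have "\<dots> = ennreal (exp (c - s))"
    using frac_kernel_laplace_shift[OF assms, of 1 \<tau>] by simp
  finally show "(\<integral>\<^sup>+t. ennreal \<bar>frac_op_kernel \<beta> s c t \<tau>\<bar> \<partial>lborel) \<le> ennreal (exp (c - s))" .
qed

text \<open>The semigroup law of fractional integrals on the level of kernels: rescaling to the unit
  interval leaves the Beta integral, and \<open>Beta \<alpha> (1 - \<alpha>)\<close> cancels the two
  Gamma factors because \<open>Gamma 1 = 1\<close>.\<close>

lemma frac_kernel_convolution:
  assumes \<alpha>: "0 < \<alpha>" "\<alpha> < 1" and "\<sigma> < t"
  shows "(\<integral>\<tau>. frac_kernel (1 - \<alpha>) (t - \<tau>) * frac_kernel \<alpha> (\<tau> - \<sigma>) \<partial>lborel) = 1"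
proof -
  define l where "l = t - \<sigma>"
  have l: "l > 0" using assms by (simp add: l_def)
  have G: "Gamma \<alpha> > 0" "Gamma (1 - \<alpha>) > 0" using \<alpha> by (auto intro: Gamma_real_pos)
  have "(\<integral>\<tau>. frac_kernel (1 - \<alpha>) (t - \<tau>) * frac_kernel \<alpha> (\<tau> - \<sigma>) \<partial>lborel) =
     \<bar>l\<bar> *\<^sub>R (\<integral>u. frac_kernel (1 - \<alpha>) (t - (\<sigma> + l * u)) * frac_kernel \<alpha> ((\<sigma> + l * u) - \<sigma>) \<partial>lborel)"
    using l by (intro lborel_integral_real_affine) auto
  also have "(\<integral>u. frac_kernel (1 - \<alpha>) (t - (\<sigma> + l * u)) * frac_kernel \<alpha> ((\<sigma> + l * u) - \<sigma>) \<partial>lborel) =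
     (\<integral>u. (1 / (l * (Gamma \<alpha> * Gamma (1 - \<alpha>)))) * (indicator {0..1} u *\<^sub>R (u powr (\<alpha> - 1) * (1 - u) powr ((1 - \<alpha>) - 1))) \<partial>lborel)"
  proof (rule Bochner_Integration.integral_cong)
    fix u :: real
    have e: "t - (\<sigma> + l * u) = l * (1 - u)" by (simp add: l_def algebra_simps)
    consider "u \<le> 0" | "u \<ge> 1" | "0 < u" "u < 1" by linarith
    then show "frac_kernel (1 - \<alpha>) (t - (\<sigma> + l * u)) * frac_kernel \<alpha> ((\<sigma> + l * u) - \<sigma>) =
       (1 / (l * (Gamma \<alpha> * Gamma (1 - \<alpha>)))) * (indicator {0..1} u *\<^sub>R (u powr (\<alpha> - 1) * (1 - u) powr ((1 - \<alpha>) - 1)))"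
    proof cases
      case 3
      have "l powr (\<alpha> - 1) * l powr (- \<alpha>) = 1 / l"
        unfolding powr_add[symmetric] using l by (simp add: powr_minus_divide)
      moreover have "(1 / Gamma (1 - \<alpha>) * (l powr (- \<alpha>) * (1 - u) powr (- \<alpha>))) * (1 / Gamma \<alpha> * (l powr (\<alpha> - 1) * u powr (\<alpha> - 1)))
        = (l powr (\<alpha> - 1) * l powr (- \<alpha>)) * ((1 / (Gamma \<alpha> * Gamma (1 - \<alpha>))) * (u powr (\<alpha> - 1) * (1 - u) powr (- \<alpha>)))"
        by (simp add: mult_ac)
      ultimately have "(1 / Gamma (1 - \<alpha>) * (l powr (- \<alpha>) * (1 - u) powr (- \<alpha>))) * (1 / Gamma \<alpha> * (l powr (\<alpha> - 1) * u powr (\<alpha> - 1)))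
        = 1 / l * ((1 / (Gamma \<alpha> * Gamma (1 - \<alpha>))) * (u powr (\<alpha> - 1) * (1 - u) powr (- \<alpha>)))" by (simp only:)
      then show ?thesis using 3 l unfolding e frac_kernel_def
        by (simp add: powr_mult mult_ac)
    qed (use l in \<open>auto simp: e frac_kernel_def indicator_def zero_less_mult_iff\<close>)
  qed simp
  also have "\<dots> = (1 / (l * (Gamma \<alpha> * Gamma (1 - \<alpha>)))) * (LINT u:{0..1}|lborel. u powr (\<alpha> - 1) * (1 - u) powr ((1 - \<alpha>) - 1))"
    by (simp add: set_lebesgue_integral_def)
  also have "(LINT u:{0..1}|lborel. u powr (\<alpha> - 1) * (1 - u) powr ((1 - \<alpha>) - 1)) = Beta \<alpha> (1 - \<alpha>)"
    using set_borel_integral_eq_integral(2)[OF integrable_Beta[of \<alpha> "1 - \<alpha>"]] has_integral_Beta_real[of \<alpha> "1 - \<alpha>"] \<alpha>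
    by (simp add: integral_unique)
  also have "Beta \<alpha> (1 - \<alpha>) = Gamma \<alpha> * Gamma (1 - \<alpha>)" by (simp add: Beta_def)
  finally show ?thesis using l G by simp
qed

lemma frac_op_kernel_comp:
  assumes \<alpha>: "0 < \<alpha>" "\<alpha> < 1"
  shows "kop lborel (frac_op_kernel (1 - \<alpha>) s c) (\<lambda>\<tau>. frac_op_kernel \<alpha> s c \<tau> \<sigma>) t = frac_op_kernel 1 s c t \<sigma>"
proof (cases "s \<le> \<sigma> \<and> t \<le> c \<and> \<sigma> < t")
  case True
  have "kop lborel (frac_op_kernel (1 - \<alpha>) s c) (\<lambda>\<tau>. frac_op_kernel \<alpha> s c \<tau> \<sigma>) t =
    (\<integral>\<tau>. frac_kernel (1 - \<alpha>) (t - \<tau>) * frac_kernel \<alpha> (\<tau> - \<sigma>) \<partial>lborel)"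
    unfolding kop_def using True
    by (intro Bochner_Integration.integral_cong) (auto simp: frac_op_kernel_def frac_kernel_def)
  then show ?thesis using True frac_kernel_convolution[OF \<alpha>, of \<sigma> t]
    by (simp add: frac_op_kernel_def frac_kernel_1)
next
  case False
  then have "frac_op_kernel (1 - \<alpha>) s c t \<tau> * frac_op_kernel \<alpha> s c \<tau> \<sigma> = 0" for \<tau>
    by (auto simp: frac_op_kernel_def frac_kernel_def)
  then have "kop lborel (frac_op_kernel (1 - \<alpha>) s c) (\<lambda>\<tau>. frac_op_kernel \<alpha> s c \<tau> \<sigma>) t = 0"
    by (simp only: kop_def Bochner_Integration.integral_zero)
  moreover have "frac_op_kernel 1 s c t \<sigma> = 0" using False
    by (auto simp: frac_op_kernel_def frac_kernel_1)
  ultimately show ?thesis by simp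
qed

lemma kop_frac_1:
  assumes "t \<in> {s..c}" and [measurable]: "h \<in> borel_measurable borel"
  shows "kop lborel (frac_op_kernel 1 s c) h t = (LINT y:{s..t}|lborel. h y)"
  unfolding kop_def set_lebesgue_integral_def
proof (rule integral_cong_AE)
  have "AE y in lborel. y \<noteq> t" by (rule AE_lborel_singleton)
  then show "AE y in lborel. frac_op_kernel 1 s c t y * h y = indicator {s..t} y *\<^sub>R h y"
    by eventually_elim (use assms in \<open>auto simp: frac_op_kernel_def frac_kernel_1\<close>)
qed (unfold frac_op_kernel_def, measurable)

lemma kop_cong_on:
  assumes "\<And>t \<tau>. \<tau> \<notin> S \<Longrightarrow> X t \<tau> = 0" and "\<And>t. (\<lambda>\<tau>. X t \<tau>) \<in> borel_measurable M"
    and "f \<in> borel_measurable M" "g \<in> borel_measurable M" and "AE \<tau> in M. \<tau> \<in> S \<longrightarrow> f \<tau> = g \<tau>"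
  shows "kop M X f t = kop M X g t"
  unfolding kop_def
proof (rule integral_cong_AE)
  show "AE \<tau> in M. X t \<tau> * f \<tau> = X t \<tau> * g \<tau>"
    using assms(5) by eventually_elim (use assms(1) in force)
qed (use assms in measurable)

lemma frac_op_cong:
  assumes "f \<in> borel_measurable borel" "g \<in> borel_measurable borel"
    and "AE \<tau> in lborel. \<tau> \<in> {s..c} \<longrightarrow> f \<tau> = g \<tau>"
  shows "kop lborel (frac_op_kernel \<beta> s c) f t = kop lborel (frac_op_kernel \<beta> s c) g t"
proof (rule kop_cong_on[of "{s..c}"])
  show "frac_op_kernel \<beta> s c t \<tau> = 0" if "\<tau> \<notin> {s..c}" for t \<tau>
    using that by (auto simp: frac_op_kernel_def frac_kernel_def)
  show "(\<lambda>\<tau>. frac_op_kernel \<beta> s c t \<tau>) \<in> borel_measurable lborel" for t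
    unfolding frac_op_kernel_def by measurable
qed (use assms in auto)

lemma integrable_frac_op_kernel:
  assumes "\<beta> > 0"
  shows "integrable lborel (\<lambda>t. frac_op_kernel \<beta> s c t \<sigma>)"
proof (rule integrableI_bounded)
  show "(\<lambda>t. frac_op_kernel \<beta> s c t \<sigma>) \<in> borel_measurable lborel"
    unfolding frac_op_kernel_def by measurable
  obtain C where "(\<integral>\<^sup>+t. ennreal \<bar>frac_op_kernel \<beta> s c t \<sigma>\<bar> \<partial>lborel) \<le> ennreal C"
    using frac_op_kernel_kernel[OF assms, of s c] unfolding kernel_def by auto
  also have "ennreal C < \<infinity>" by simp
  finally show "(\<integral>\<^sup>+t. ennreal (norm (frac_op_kernel \<beta> s c t \<sigma>)) \<partial>lborel) < \<infinity>" by simp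
qed

text \<open>By the semigroup law, the integral of order \<open>1 - \<alpha>\<close> maps the defect
  \<open>h\<close> of the second equation to the defect of the first. It is injective: a further
  integral of order \<alpha> produces the primitive of \<open>h\<close>, which determines
  \<open>h\<close>. The case \<alpha> = 1 stands apart because the integral of order 0 is the
  identity and has no kernel.\<close>

lemma frac_integral_equation_iff:
  assumes \<alpha>: "0 < \<alpha>" "\<alpha> \<le> 1" and q: "integrable lborel q" and g: "integrable lborel g"
  shows "(AE t\<in>{s..c} in lborel. (if \<alpha> = 1 then q t else kop lborel (frac_op_kernel (1 - \<alpha>) s c) q t) =
       d + kop lborel (frac_op_kernel 1 s c) g t)
     \<longleftrightarrow> (AE t\<in>{s..c} in lborel. q t = d * frac_op_kernel \<alpha> s c t s + kop lborel (frac_op_kernel \<alpha> s c) g t)"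
    (is "?L \<longleftrightarrow> ?R")
proof -
  have ns: "AE t in lborel. t \<noteq> s" by (rule AE_lborel_singleton)
  show ?thesis
  proof (cases "\<alpha> = 1")
    case True
    have "AE t\<in>{s..c} in lborel. frac_op_kernel 1 s c t s = 1"
      using ns by eventually_elim (auto simp: frac_op_kernel_def frac_kernel_1)
    then have "AE t in lborel. (t \<in> {s..c} \<longrightarrow> q t = d + kop lborel (frac_op_kernel 1 s c) g t) \<longleftrightarrow>
       (t \<in> {s..c} \<longrightarrow> q t = d * frac_op_kernel \<alpha> s c t s + kop lborel (frac_op_kernel \<alpha> s c) g t)"
      by eventually_elim (use True in auto)
    from eventually_subst[OF this] show ?thesis using True by simp
  next
    case False
    then have \<alpha>1: "\<alpha> < 1" "1 - \<alpha> > 0" using \<alpha> by auto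
    note K = frac_op_kernel_kernel[OF \<alpha>(1), of s c] frac_op_kernel_kernel[OF \<alpha>1(2), of s c]
    note T = lborel.kop_kop[OF K(2) K(1)] lborel.kop_kop[OF K(1) K(2)]
    define k where "k = (\<lambda>t. d * frac_op_kernel \<alpha> s c t s)"
    define r where "r = kop lborel (frac_op_kernel \<alpha> s c) g"
    define h where "h = (\<lambda>t. q t - (k t + r t))"
    have ik: "integrable lborel k" unfolding k_def
      by (intro integrable_mult_right integrable_frac_op_kernel \<alpha>)
    have ir: "integrable lborel r" unfolding r_def by (intro lborel.integrable_kop K g)
    have ikr: "integrable lborel (\<lambda>t. k t + r t)" using ik ir by auto
    have ih: "integrable lborel h" unfolding h_def using q ikr by auto
    have [measurable]: "h \<in> borel_measurable borel" using ih by auto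
    let ?I = "kop lborel (frac_op_kernel (1 - \<alpha>) s c)"
    have kk: "?I k t = d * frac_op_kernel 1 s c t s" for t
    proof -
      have "?I k t = d * ?I (\<lambda>\<tau>. frac_op_kernel \<alpha> s c \<tau> s) t"
        unfolding kop_def k_def by (simp add: mult.left_commute)
      then show ?thesis using frac_op_kernel_comp[OF \<alpha>(1) \<alpha>1(1), of s c s t] by simp
    qed
    have Ih: "AE t\<in>{s..c} in lborel. ?I h t = ?I q t - (d + kop lborel (frac_op_kernel 1 s c) g t)"
      using lborel.AE_kop_diff[OF K(2) q ikr] lborel.AE_kop_add[OF K(2) ik ir] T(1)[OF g] ns
      by eventually_elim (auto simp: h_def[symmetric] kk r_def[symmetric] frac_op_kernel_comp[OF \<alpha>(1) \<alpha>1(1)]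
         frac_op_kernel_def[of 1 s c _ s] frac_kernel_1)
    have R: "?R \<longleftrightarrow> (AE t\<in>{s..c} in lborel. h t = 0)"
      by (simp add: h_def k_def r_def)
    have L: "?L \<longleftrightarrow> (AE t\<in>{s..c} in lborel. ?I h t = 0)"
      using Ih False by (intro eventually_subst) (auto elim!: eventually_mono)
    show ?thesis
      unfolding L R
    proof
      assume "AE t\<in>{s..c} in lborel. h t = 0"
      then have "?I h t = ?I (\<lambda>_. 0) t" for t by (intro frac_op_cong) auto
      then show "AE t\<in>{s..c} in lborel. ?I h t = 0" by (simp add: kop_def)
    next
      assume *: "AE t\<in>{s..c} in lborel. ?I h t = 0"
      have "?I h \<in> borel_measurable borel" using lborel.integrable_kop[OF K(2) ih] by auto
      then have 0: "kop lborel (frac_op_kernel \<alpha> s c) (?I h) t = kop lborel (frac_op_kernel \<alpha> s c) (\<lambda>_. 0) t" for t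
        using * by (intro frac_op_cong) auto
      have "AE t in lborel. kop lborel (frac_op_kernel 1 s c) h t = 0"
        using T(2)[OF ih] unfolding 0
        using frac_op_kernel_comp[of "1 - \<alpha>" s c] \<alpha> \<alpha>1 by (simp add: kop_def)
      then have 1: "AE t\<in>{s..c} in lborel. (LINT y:{s..t}|lborel. h y) = 0"
      proof eventually_elim
        case (elim t)
        then show ?case using kop_frac_1[of t s c h] by simp
      qed
      have "set_integrable lborel {s..c} h"
        using integrable_mult_indicator[OF _ ih, of "{s..c}"] by (simp add: set_integrable_def)
      from AE_eq_zero_of_integral_zero[OF this 1] show "AE t\<in>{s..c} in lborel. h t = 0" .
    qed
  qed
qed

section \<open>Riemann-Liouville derivatives as integral equations\<close>

lemma AE_lebesgue_on_iff:
  assumes "S \<in> sets lebesgue"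
  shows "(AE x in lebesgue_on S. P x) \<longleftrightarrow> (AE x in lborel. x \<in> S \<longrightarrow> P x)"
  using assms by (simp add: AE_restrict_space_iff AE_completion_iff)

text \<open>Kernels live on the product of Borel sigma-algebras, while the given functions are only
  Lebesgue measurable. Each is replaced by a Borel function on the whole line that vanishes off the
  interval.\<close>

lemma absolutely_integrable_borel_version:
  fixes q :: "real \<Rightarrow> real"
  assumes "q absolutely_integrable_on {s..c}"
  obtains q' where "integrable lborel q'" "\<And>x. x \<notin> {s..c} \<Longrightarrow> q' x = 0"
    "AE x\<in>{s..c} in lborel. q' x = q x"
proof -
  define r where "r = (\<lambda>x. indicator {s..c} x *\<^sub>R q x)"
  have r: "integrable lebesgue r" using assms by (simp add: set_integrable_def r_def)
  then have "r \<in> borel_measurable lebesgue" by auto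
  from completion_ex_borel_measurable_real[OF this]
  obtain r' where r': "r' \<in> borel_measurable lborel" "AE x in lborel. r x = r' x" by auto
  then have "AE x in lebesgue. r x = r' x" by (simp add: AE_completion_iff)
  then have "integrable lebesgue r'"
    using r r'(1) by (subst integrable_cong_AE[of r' _ r]) (auto elim!: eventually_mono intro: measurable_completion)
  then have i: "integrable lborel r'" using r'(1) by (simp add: integrable_completion)
  show ?thesis
  proof
    show "integrable lborel (\<lambda>x. indicator {s..c} x * r' x)"
      using integrable_mult_indicator[OF _ i, of "{s..c}"] by simp
    show "AE x\<in>{s..c} in lborel. indicator {s..c} x * r' x = q x"
      using r'(2) by eventually_elim (auto simp: r_def)
  qed auto
qed

lemma absolutely_integrable_of_borel_version:
  fixes q :: "real \<Rightarrow> real"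
  assumes q': "set_integrable lborel {s..c} q'" and eq: "AE x\<in>{s..c} in lborel. q' x = q x"
  shows "q absolutely_integrable_on {s..c}"
proof -
  have 1: "q' absolutely_integrable_on {s..c}"
    using q' by (auto simp: set_integrable_def integrable_completion borel_measurable_integrable)
  from AE_E3[OF eq]
  obtain N where N: "\<And>x. x \<in> space lborel - N \<Longrightarrow> x \<in> {s..c} \<longrightarrow> q' x = q x" "N \<in> null_sets lborel"
    by metis
  have 2: "negligible N" using N(2) by (simp add: negligible_iff_null_sets null_sets_completionI)
  show ?thesis by (rule absolutely_integrable_spike[OF 1 2]) (use N(1) in simp)
qed

definition frac_int :: "real \<Rightarrow> real \<Rightarrow> (real \<Rightarrow> real) \<Rightarrow> real \<Rightarrow> real" where
  "frac_int \<beta> s q t = (LINT \<tau>:{s..t}|lebesgue. 1 / Gamma \<beta> * (t - \<tau>) powr (\<beta> - 1) * q \<tau>)"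

lemma frac_int_eq_kop:
  assumes q: "q absolutely_integrable_on {s..c}" and q': "integrable lborel q'"
    and eq: "AE x\<in>{s..c} in lborel. q' x = q x" and t: "t \<in> {s..c}"
  shows "frac_int \<beta> s q t = kop lborel (frac_op_kernel \<beta> s c) q' t"
proof -
  define r where "r = (\<lambda>x. indicator {s..c} x *\<^sub>R q x)"
  have "integrable lebesgue r" using q by (simp add: set_integrable_def r_def)
  then have [measurable]: "r \<in> borel_measurable lebesgue" by auto
  have [measurable]: "q' \<in> borel_measurable borel" using q' by auto
  have m[measurable]: "(\<lambda>\<tau>. frac_op_kernel \<beta> s c t \<tau>) \<in> borel_measurable borel"
    unfolding frac_op_kernel_def by measurable
  have m'[measurable]: "(\<lambda>\<tau>. frac_op_kernel \<beta> s c t \<tau>) \<in> borel_measurable lebesgue"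
    using m by (intro measurable_completion) simp
  have m2: "(\<lambda>\<tau>. frac_op_kernel \<beta> s c t \<tau> * q' \<tau>) \<in> borel_measurable lborel" by measurable
  \<comment> \<open>At \<tau> = t both integrands are 0, the left one because
    \<open>0 powr (\<beta> - 1) = 0\<close> for every \<beta>.\<close>
  have "frac_int \<beta> s q t = (\<integral>\<tau>. frac_op_kernel \<beta> s c t \<tau> * r \<tau> \<partial>lebesgue)"
    unfolding frac_int_def set_lebesgue_integral_def
    by (intro Bochner_Integration.integral_cong)
       (use t in \<open>auto simp: r_def frac_op_kernel_def frac_kernel_def indicator_def\<close>)
  also have "\<dots> = (\<integral>\<tau>. frac_op_kernel \<beta> s c t \<tau> * q' \<tau> \<partial>lebesgue)"
  proof (rule integral_cong_AE)
    have "AE x in lebesgue. x \<in> {s..c} \<longrightarrow> q' x = q x" using eq by (simp add: AE_completion_iff)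
    then show "AE \<tau> in lebesgue. frac_op_kernel \<beta> s c t \<tau> * r \<tau> = frac_op_kernel \<beta> s c t \<tau> * q' \<tau>"
      by eventually_elim (auto simp: r_def frac_op_kernel_def frac_kernel_def)
  qed (use measurable_completion[OF m2] in measurable)
  also have "\<dots> = (\<integral>\<tau>. frac_op_kernel \<beta> s c t \<tau> * q' \<tau> \<partial>lborel)"
    by (rule integral_completion[OF m2])
  finally show ?thesis by (simp add: kop_def)
qed

lemma frac_int_equation_iff:
  assumes \<alpha>: "0 < \<alpha>" "\<alpha> \<le> 1" and q: "q absolutely_integrable_on {s..c}"
    and g: "set_integrable lborel {s..c} g'" "AE t\<in>{s..c} in lborel. g' t = g t"
  shows "(AE t\<in>{s..c} in lborel. (if 1 - \<alpha> = 0 then q else frac_int (1 - \<alpha>) s q) t = d + (LINT y:{s..t}|lborel. g' y))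
    \<longleftrightarrow> (AE t\<in>{s..c} in lborel. q t = d * frac_kernel \<alpha> (t - s) + frac_int \<alpha> s g t)"
proof -
  have ga: "g absolutely_integrable_on {s..c}"
    by (rule absolutely_integrable_of_borel_version[OF g])
  obtain q0 where q0: "integrable lborel q0" "\<And>x. x \<notin> {s..c} \<Longrightarrow> q0 x = 0"
    "AE x\<in>{s..c} in lborel. q0 x = q x" using absolutely_integrable_borel_version[OF q] by blast
  define g0 where "g0 = (\<lambda>x. indicator {s..c} x *\<^sub>R g' x)"
  have g0: "integrable lborel g0" using g(1) by (simp add: set_integrable_def g0_def)
  have g0e: "AE x\<in>{s..c} in lborel. g0 x = g x" using g(2) by eventually_elim (simp add: g0_def)
  have 1: "kop lborel (frac_op_kernel 1 s c) g0 t = (LINT y:{s..t}|lborel. g' y)" if "t \<in> {s..c}"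
    for t
  proof -
    have "kop lborel (frac_op_kernel 1 s c) g0 t = (LINT y:{s..t}|lborel. g0 y)"
      using that g0 by (intro kop_frac_1) auto
    also have "\<dots> = (LINT y:{s..t}|lborel. g' y)"
      using that by (intro set_lebesgue_integral_cong) (auto simp: g0_def)
    finally show ?thesis .
  qed
  have 2: "frac_int \<alpha> s g t = kop lborel (frac_op_kernel \<alpha> s c) g0 t" if "t \<in> {s..c}" for t
    by (rule frac_int_eq_kop[OF ga g0 g0e that])
  have 3: "frac_int (1 - \<alpha>) s q t = kop lborel (frac_op_kernel (1 - \<alpha>) s c) q0 t" if "t \<in> {s..c}"
    for t
    by (rule frac_int_eq_kop[OF q q0(1,3) that])
  have 4: "frac_kernel \<alpha> (t - s) = frac_op_kernel \<alpha> s c t s" if "t \<in> {s..c}" for t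
    using that by (simp add: frac_op_kernel_def)
  have "(AE t\<in>{s..c} in lborel. (if 1 - \<alpha> = 0 then q else frac_int (1 - \<alpha>) s q) t = d + (LINT y:{s..t}|lborel. g' y))
    \<longleftrightarrow> (AE t\<in>{s..c} in lborel. (if \<alpha> = 1 then q0 t else kop lborel (frac_op_kernel (1 - \<alpha>) s c) q0 t) =
       d + kop lborel (frac_op_kernel 1 s c) g0 t)"
    using q0(3) by (intro eventually_subst) (auto simp: 1 3 elim!: eventually_mono)
  also have "\<dots> \<longleftrightarrow> (AE t\<in>{s..c} in lborel. q0 t = d * frac_op_kernel \<alpha> s c t s + kop lborel (frac_op_kernel \<alpha> s c) g0 t)"
    by (rule frac_integral_equation_iff[OF \<alpha> q0(1) g0])
  also have "\<dots> \<longleftrightarrow> (AE t\<in>{s..c} in lborel. q t = d * frac_kernel \<alpha> (t - s) + frac_int \<alpha> s g t)"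
    using q0(3) by (intro eventually_subst) (auto simp: 2 4 elim!: eventually_mono)
  finally show ?thesis .
qed

lemma continuous_version_AE:
  "AE t in lebesgue_on J. continuous_version J g t = g t"
proof (cases "\<exists>F. continuous_on J F \<and> (AE t in lebesgue_on J. F t = g t)")
  case True
  from someI_ex[OF True] show ?thesis using True by (simp add: continuous_version_def)
next
  case False
  then have "continuous_version J g = g" unfolding continuous_version_def by (rule if_not_P)
  then show ?thesis by simp
qed

text \<open>Continuous functions that agree almost everywhere on a nondegenerate interval agree
  everywhere, so \<open>SOME\<close> has no freedom. This is what pins down initial values.\<close>

lemma continuous_version_eq:
  assumes "s < c" and H: "continuous_on {s..c} H" "AE t\<in>{s..c} in lborel. H t = g t"
    and t: "t \<in> {s..c}"
  shows "continuous_version {s..c} g t = H t"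
proof -
  have ex: "\<exists>F. continuous_on {s..c} F \<and> (AE t in lebesgue_on {s..c}. F t = g t)"
    using H by (auto simp: AE_lebesgue_on_iff)
  define V where "V = continuous_version {s..c} g"
  have V: "continuous_on {s..c} V" "AE t\<in>{s..c} in lborel. V t = g t"
    using someI_ex[OF ex] ex unfolding V_def continuous_version_def
      by (auto simp: AE_lebesgue_on_iff)
  have "V t - H t = 0"
  proof (rule continuous_AE_zero[OF \<open>s < c\<close> _ _ t])
    show "continuous_on {s..c} (\<lambda>t. V t - H t)" using V H by (intro continuous_intros)
    show "AE t\<in>{s..c} in lborel. V t - H t = 0"
      using V(2) H(2) by eventually_elim auto
  qed
  then show ?thesis by (simp add: V_def)
qed

lemma AE_deriv_of_integral:
  fixes F g :: "real \<Rightarrow> real"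
  assumes "set_integrable lborel {s..c} g" "\<And>t. t \<in> {s..c} \<Longrightarrow> F t = d + (LINT y:{s..t}|lborel. g y)"
  shows "AE t\<in>{s..c} in lborel. deriv F t = g t"
proof -
  have "AE t\<in>{s..c} in lborel. (F has_real_derivative g t) (at t)"
    by (rule AE_has_derivative_of_integral[OF assms])
  then show ?thesis by eventually_elim (simp add: DERIV_imp_deriv)
qed

lemma L1_loc_Icc: "L1_loc {s..c} q \<longleftrightarrow> q absolutely_integrable_on {s..c}"
  unfolding L1_loc_def by (auto intro: set_integrable_subset)

lemma left_RL_integral_alt:
  "left_RL_integral \<beta> s J q = continuous_version J (if \<beta> = 0 then q else frac_int \<beta> s q)"
  by (simp add: left_RL_integral_def frac_int_def[abs_def])

text \<open>The absolutely continuous fractional integral has a density \<open>g'\<close>, and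
  differentiation identifies \<open>g'\<close> with \<open>g\<close> almost everywhere.
  \<open>J\<close> may exceed \<open>{s..c}\<close>, since the left problems are posed on intervals
  that may be noncompact.\<close>

lemma left_RL_integral_equation:
  assumes \<alpha>: "0 < \<alpha>" "\<alpha> \<le> 1" and J: "J \<in> sets lebesgue" "{s..c} \<subseteq> J" "s \<le> c"
    and AC: "left_AC \<alpha> s J q" and D: "AE t in lebesgue_on J. left_RL_deriv \<alpha> s J q t = g t"
    and d: "left_RL_integral (1 - \<alpha>) s J q s = d"
  shows "q absolutely_integrable_on {s..c}" "g absolutely_integrable_on {s..c}"
    "AE t\<in>{s..c} in lborel. q t = d * frac_kernel \<alpha> (t - s) + frac_int \<alpha> s g t"
proof -
  define G where "G = left_RL_integral (1 - \<alpha>) s J q"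
  show q: "q absolutely_integrable_on {s..c}" using AC J by (simp add: left_AC_def L1_loc_def)
  have "abs_cont_on {s..c} G" using AC J by (simp add: left_AC_def AC_loc_def G_def)
  from abs_cont_imp_density[OF J(3) this]
  obtain g' where g': "set_integrable lborel {s..c} g'" "\<And>x. x \<in> {s..c} \<Longrightarrow> (LINT y:{s..x}|lborel. g' y) = G x - G s"
    by blast
  have G: "G t = d + (LINT y:{s..t}|lborel. g' y)" if "t \<in> {s..c}" for t
    using g'(2)[OF that] d by (simp add: G_def)
  have "AE t\<in>{s..c} in lborel. deriv G t = g' t" by (rule AE_deriv_of_integral[OF g'(1) G])
  then have eq: "AE t\<in>{s..c} in lborel. g' t = g t"
    using D[unfolded AE_lebesgue_on_iff[OF J(1)]]
    by eventually_elim (use J(2) in \<open>auto simp: left_RL_deriv_def G_def\<close>)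
  show "g absolutely_integrable_on {s..c}"
    by (rule absolutely_integrable_of_borel_version[OF g'(1) eq])
  have "AE t\<in>{s..c} in lborel. (if 1 - \<alpha> = 0 then q else frac_int (1 - \<alpha>) s q) t = d + (LINT y:{s..t}|lborel. g' y)"
    using continuous_version_AE[of J "if 1 - \<alpha> = 0 then q else frac_int (1 - \<alpha>) s q", unfolded AE_lebesgue_on_iff[OF J(1)]]
    by eventually_elim (use J(2) G in \<open>auto simp: G_def left_RL_integral_alt\<close>)
  then show "AE t\<in>{s..c} in lborel. q t = d * frac_kernel \<alpha> (t - s) + frac_int \<alpha> s g t"
    by (subst (asm) frac_int_equation_iff[OF \<alpha> q g'(1) eq])
qed

text \<open>The primitive \<open>H\<close> is continuous and agrees almost everywhere with the
  fractional integral. For \<open>s < c\<close> it therefore is the continuous version, and absolute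
  continuity, derivative and initial value are read off from it.\<close>

lemma left_RL_of_integral_equation:
  assumes \<alpha>: "0 < \<alpha>" "\<alpha> \<le> 1" and "s < c"
    and q: "q absolutely_integrable_on {s..c}" and g: "g absolutely_integrable_on {s..c}"
    and eq: "AE t\<in>{s..c} in lborel. q t = d * frac_kernel \<alpha> (t - s) + frac_int \<alpha> s g t"
  shows "left_AC \<alpha> s {s..c} q" "AE t in lebesgue_on {s..c}. left_RL_deriv \<alpha> s {s..c} q t = g t"
    "left_RL_integral (1 - \<alpha>) s {s..c} q s = d"
proof -
  obtain g' where g0: "integrable lborel g'" "AE x\<in>{s..c} in lborel. g' x = g x"
    using absolutely_integrable_borel_version[OF g] by blast
  have g': "set_integrable lborel {s..c} g'"
    using integrable_mult_indicator[OF _ g0(1), of "{s..c}"] by (simp add: set_integrable_def)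
  define H where "H = (\<lambda>t. d + (LINT y:{s..t}|lborel. g' y))"
  define G where "G = left_RL_integral (1 - \<alpha>) s {s..c} q"
  have ae: "AE t\<in>{s..c} in lborel. H t = (if 1 - \<alpha> = 0 then q else frac_int (1 - \<alpha>) s q) t"
    using eq by (subst (asm) frac_int_equation_iff[OF \<alpha> q g' g0(2), symmetric]) (auto simp: H_def elim!: eventually_mono)
  have acH: "abs_cont_on {s..c} H" by (rule abs_cont_on_integral[OF g', of _ d]) (simp add: H_def)
  have GH: "G t = d + (LINT y:{s..t}|lborel. g' y)" if "t \<in> {s..c}" for t
    unfolding G_def left_RL_integral_alt
    using continuous_version_eq[OF \<open>s < c\<close> abs_cont_on_imp_continuous_on[OF acH] ae that]
      by (simp add: H_def)
  have acG: "abs_cont_on {s..c} G" by (rule abs_cont_on_integral[OF g' GH])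
  show "left_AC \<alpha> s {s..c} q"
    unfolding left_AC_def L1_loc_Icc AC_loc_def G_def[symmetric] using q acG abs_cont_on_subset
      by blast
  show "AE t in lebesgue_on {s..c}. left_RL_deriv \<alpha> s {s..c} q t = g t"
  proof (subst AE_lebesgue_on_iff)
    have "AE t\<in>{s..c} in lborel. deriv G t = g' t" by (rule AE_deriv_of_integral[OF g' GH])
    then show "AE t\<in>{s..c} in lborel. left_RL_deriv \<alpha> s {s..c} q t = g t"
      using g0(2) by eventually_elim (simp add: left_RL_deriv_def G_def)
  qed simp
  have "(LINT y:{s..s}|lborel. g' y) = (LINT y:{}|lborel. g' y)"
    unfolding set_lebesgue_integral_def
  proof (rule integral_cong_AE)
    have "AE y in lborel. y \<noteq> s" by (rule AE_lborel_singleton)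
    then show "AE y in lborel. indicator {s..s} y *\<^sub>R g' y = indicator {} y *\<^sub>R g' y"
      by eventually_elim auto
  qed (use borel_measurable_integrable[OF g0(1)] in measurable)
  then show "left_RL_integral (1 - \<alpha>) s {s..c} q s = d"
    using GH[of s] \<open>s < c\<close> by (simp add: G_def set_lebesgue_integral_def)
qed

section \<open>Reflection of the time axis\<close>

lemma abs_cont_on_reflect:
  assumes ac: "abs_cont_on {c..e} F"
  shows "abs_cont_on {-e..-c} (\<lambda>x. F (- x))"
  unfolding abs_cont_on_iff
proof (intro allI impI)
  fix \<epsilon> :: real assume "\<epsilon> > 0"
  from abs_cont_onE[OF ac this] obtain \<delta> where \<delta>: "\<delta> > 0" "osc_small {c..e} F \<delta> \<epsilon>" .
  have "osc_small {-e..-c} (\<lambda>x. F (- x)) \<delta> \<epsilon>"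
    unfolding osc_small_def
  proof (intro allI impI)
    fix d T assume dT: "d division_of T" and d: "T \<subseteq> {-e..-c}" "(\<Sum>k\<in>d. measure lborel k) < \<delta>"
    define d' where "d' = (\<lambda>k. uminus ` k) ` d"
    have k: "uminus ` k = {- Sup k..- Inf k}" "Inf k \<le> Sup k" "measure lborel k = Sup k - Inf k"
      if "k \<in> d" for k
    proof -
      note kk = division_of_real_interval[OF dT that]
      have "uminus ` k = uminus ` {Inf k..Sup k}" using kk(1) by simp
      then show "uminus ` k = {- Sup k..- Inf k}" by simp
    qed (use division_of_real_interval[OF dT that] in auto)
    have inj: "inj_on (\<lambda>k. uminus ` k) d"
      by (intro inj_onI) (simp add: inj_image_eq_iff)
    have "d' division_of (uminus ` T)"
    proof (rule division_ofI)
      show "K \<subseteq> uminus ` T" "K \<noteq> {}" "\<exists>a b. K = cbox a b" if K: "K \<in> d'" for K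
      proof -
        obtain k' where k': "k' \<in> d" "K = uminus ` k'" using K unfolding d'_def by blast
        show "K \<subseteq> uminus ` T" unfolding k'(2) by (rule image_mono[OF division_ofD(2)[OF dT k'(1)]])
        show "K \<noteq> {}" using division_ofD(3)[OF dT k'(1)] k'(2) by simp
        show "\<exists>a b. K = cbox a b" unfolding k'(2) k(1)[OF k'(1)] by (metis cbox_interval)
      qed
      show "interior K1 \<inter> interior K2 = {}" if K: "K1 \<in> d'" "K2 \<in> d'" "K1 \<noteq> K2" for K1 K2
      proof -
        obtain k1 k2 where kk: "k1 \<in> d" "k2 \<in> d" "K1 = uminus ` k1" "K2 = uminus ` k2"
          using K unfolding d'_def by blast
        then have "k1 \<noteq> k2" using K by auto
        then have "interior k1 \<inter> interior k2 = {}" using division_ofD(5)[OF dT] kk by auto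
        then show ?thesis unfolding kk interior_negations by auto
      qed
      show "\<Union>d' = uminus ` T" using division_ofD(6)[OF dT] unfolding d'_def by auto
    qed (use dT in \<open>auto simp: d'_def\<close>)
    moreover have "uminus ` T \<subseteq> {c..e}" using d by force
    moreover have "(\<Sum>k\<in>d'. measure lborel k) = (\<Sum>k\<in>d. measure lborel k)"
      unfolding d'_def by (subst sum.reindex[OF inj]) (auto intro!: sum.cong simp: k)
    ultimately have "osc F d' < \<epsilon>" using d by (intro osc_smallD[OF \<delta>(2)]) auto
    moreover have "osc F d' = osc (\<lambda>x. F (- x)) d"
      unfolding d'_def osc_def by (subst sum.reindex[OF inj]) (auto intro!: sum.cong simp: k abs_minus_commute)
    ultimately show "osc (\<lambda>x. F (- x)) d < \<epsilon>" by simp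
  qed
  then show "\<exists>\<delta>>0. osc_small {-e..-c} (\<lambda>x. F (- x)) \<delta> \<epsilon>" using \<delta>(1) by blast
qed

lemma AC_loc_Icc: "AC_loc {c..e} F \<longleftrightarrow> abs_cont_on {c..e} F"
  unfolding AC_loc_def using abs_cont_on_subset by blast

lemma abs_cont_AE_has_derivative:
  assumes "c < e" and ac: "abs_cont_on {c..e} F"
  shows "AE t\<in>{c..e} in lborel. (F has_real_derivative deriv F t) (at t)"
proof -
  obtain g where g: "set_integrable lborel {c..e} g"
    "\<And>x. x \<in> {c..e} \<Longrightarrow> (LINT y:{c..x}|lborel. g y) = F x - F c"
    using abs_cont_imp_density[OF less_imp_le[OF assms(1)] ac] by metis
  have "AE t\<in>{c..e} in lborel. (F has_real_derivative g t) (at t)"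
    by (rule AE_has_derivative_of_integral[OF g(1), of _ "F c"]) (simp add: g(2))
  then show ?thesis by eventually_elim (auto simp: DERIV_imp_deriv)
qed

lemma integral_lebesgue_reflect:
  fixes f :: "real \<Rightarrow> real"
  shows "(\<integral>x. f (- x) \<partial>lebesgue) = (\<integral>x. f x \<partial>lebesgue)"
proof -
  have *: "has_bochner_integral lebesgue f I \<longleftrightarrow> has_bochner_integral lebesgue (\<lambda>x. f (- x)) I" for I
    using has_bochner_integral_lebesgue_real_affine_iff[of "-1" f I 0] by simp
  show ?thesis
  proof (cases "integrable lebesgue f")
    case True
    then have "has_bochner_integral lebesgue f (\<integral>x. f x \<partial>lebesgue)"
      by (rule has_bochner_integral_integrable)
    then show ?thesis using * has_bochner_integral_integral_eq by blast
  next
    case False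
    then have "\<not> integrable lebesgue (\<lambda>x. f (- x))" using * by (auto simp: integrable.simps)
    then show ?thesis using False by (simp add: not_integrable_integral_eq)
  qed
qed

text \<open>A choice by \<open>SOME\<close> need not commute with reflection. Here it does: either a
  continuous version exists and is unique on the interval, or none exists on either side and both
  functions are kept unchanged.\<close>

lemma continuous_version_reflect:
  assumes "c < e" and x: "x \<in> {c..e}" and g: "\<And>x. g' x = g (- x)"
  shows "continuous_version {-e..-c} g' (- x) = continuous_version {c..e} g x"
proof (cases "\<exists>F. continuous_on {c..e} F \<and> (AE t\<in>{c..e} in lborel. F t = g t)")
  case True
  then obtain F where F: "continuous_on {c..e} F" "AE t\<in>{c..e} in lborel. F t = g t" by blast
  have "continuous_version {c..e} g x = F x" by (rule continuous_version_eq[OF assms(1) F x])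
  moreover have "continuous_version {-e..-c} g' (- x) = F (- (- x))"
  proof (rule continuous_version_eq)
    show "continuous_on {-e..-c} (\<lambda>x. F (- x))"
      by (rule continuous_on_compose2[OF F(1)]) (auto intro!: continuous_intros)
    show "AE t\<in>{-e..-c} in lborel. F (- t) = g' t"
      using AE_lborel_reflect[OF F(2)] by eventually_elim (auto simp: g)
  qed (use assms in auto)
  ultimately show ?thesis by simp
next
  case False
  have "\<not> (\<exists>F. continuous_on {-e..-c} F \<and> (AE t\<in>{-e..-c} in lborel. F t = g' t))"
  proof
    assume "\<exists>F. continuous_on {-e..-c} F \<and> (AE t\<in>{-e..-c} in lborel. F t = g' t)"
    then obtain F where F: "continuous_on {-e..-c} F" "AE t\<in>{-e..-c} in lborel. F t = g' t" by blast
    have "continuous_on {c..e} (\<lambda>x. F (- x))"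
      by (rule continuous_on_compose2[OF F(1)]) (auto intro!: continuous_intros)
    moreover have "AE t\<in>{c..e} in lborel. F (- t) = g t"
      using AE_lborel_reflect[OF F(2)] by eventually_elim (auto simp: g)
    ultimately show False using False by blast
  qed
  then have "continuous_version {-e..-c} g' = g'"
    unfolding continuous_version_def by (subst if_not_P) (auto simp: AE_lebesgue_on_iff)
  moreover have "continuous_version {c..e} g = g"
    using False unfolding continuous_version_def by (subst if_not_P) (auto simp: AE_lebesgue_on_iff)
  ultimately show ?thesis by (simp add: g)
qed

lemma right_RL_integral_reflect:
  assumes "a < t" "x \<in> {a..t}"
  shows "left_RL_integral \<beta> (- t) {-t..-a} (\<lambda>x. q (- x)) (- x) = right_RL_integral \<beta> t {a..t} q x"
  unfolding left_RL_integral_def right_RL_integral_def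
proof (rule continuous_version_reflect[OF assms])
  fix x :: real
  have "(LINT \<tau>:{-t..x}|lebesgue. 1 / Gamma \<beta> * (x - \<tau>) powr (\<beta> - 1) * q (- \<tau>)) =
     (\<integral>\<tau>. (\<lambda>\<tau>. indicator {- x..t} \<tau> *\<^sub>R (1 / Gamma \<beta> * (\<tau> - - x) powr (\<beta> - 1) * q \<tau>)) (- \<tau>) \<partial>lebesgue)"
    unfolding set_lebesgue_integral_def
    by (intro Bochner_Integration.integral_cong) (auto simp: indicator_def)
  also have "\<dots> = (LINT \<tau>:{- x..t}|lebesgue. 1 / Gamma \<beta> * (\<tau> - - x) powr (\<beta> - 1) * q \<tau>)"
    unfolding set_lebesgue_integral_def by (rule integral_lebesgue_reflect)
  finally show "(if \<beta> = 0 then \<lambda>x. q (- x)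
         else (\<lambda>x. LINT \<tau>:{-t..x}|lebesgue. 1 / Gamma \<beta> * (x - \<tau>) powr (\<beta> - 1) * q (- \<tau>))) x =
        (if \<beta> = 0 then q else (\<lambda>x. LINT \<tau>:{x..t}|lebesgue. 1 / Gamma \<beta> * (\<tau> - x) powr (\<beta> - 1) * q \<tau>)) (- x)"
    by simp
qed

lemma abs_cont_on_cong:
  assumes "\<And>x. x \<in> {c..e} \<Longrightarrow> F x = G x"
  shows "abs_cont_on {c..e} F \<longleftrightarrow> abs_cont_on {c..e} G"
proof -
  have "osc F d = osc G d" if d: "d division_of T" "T \<subseteq> {c..e}" for d T
    unfolding osc_def
  proof (rule sum.cong)
    fix k assume "k \<in> d"
    note k = division_of_real_interval[OF d(1) this]
    have "{Inf k..Sup k} \<subseteq> {c..e}" using k(3) d(2) by blast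
    then have "Sup k \<in> {c..e}" "Inf k \<in> {c..e}" using k(2) by auto
    then show "\<bar>F (Sup k) - F (Inf k)\<bar> = \<bar>G (Sup k) - G (Inf k)\<bar>" by (simp add: assms)
  qed simp
  then have "osc_small {c..e} F \<delta> \<epsilon> = osc_small {c..e} G \<delta> \<epsilon>" for \<delta> \<epsilon>
    unfolding osc_small_def by metis
  then show ?thesis unfolding abs_cont_on_iff by simp
qed

lemma absolutely_integrable_reflect_iff:
  fixes q :: "real \<Rightarrow> real"
  shows "(\<lambda>x. q (- x)) absolutely_integrable_on {-t..-a} \<longleftrightarrow> q absolutely_integrable_on {a..t}"
proof -
  have "(\<lambda>x. q (- x)) absolutely_integrable_on {-t..-a}" if "q absolutely_integrable_on {a..t}"
    for a t and q :: "real \<Rightarrow> real"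
  proof -
    from absolutely_integrable_borel_version[OF that] obtain q' where q': "integrable lborel q'"
      "AE x\<in>{a..t} in lborel. q' x = q x" by blast
    have "integrable lborel (\<lambda>x. q' (- x))"
      using lborel_integrable_real_affine[OF q'(1), of "-1" 0] by simp
    then have "set_integrable lborel {-t..-a} (\<lambda>x. q' (- x))"
      unfolding set_integrable_def by (intro integrable_mult_indicator) auto
    then show ?thesis
      by (rule absolutely_integrable_of_borel_version)
         (use AE_lborel_reflect[OF q'(2)] in \<open>auto elim!: eventually_mono\<close>)
  qed
  from this[where q=q and a=a and t=t] this[where q="\<lambda>x. q (- x)" and a="- t"
    and t="- a"] show ?thesis by auto
qed

lemma right_AC_reflect:
  assumes "a < t"
  shows "right_AC \<alpha> t {a..t} q \<longleftrightarrow> left_AC \<alpha> (- t) {-t..-a} (\<lambda>x. q (- x))"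
proof -
  let ?R = "right_RL_integral (1 - \<alpha>) t {a..t} q"
  let ?L = "left_RL_integral (1 - \<alpha>) (- t) {-t..-a} (\<lambda>x. q (- x))"
  have 1: "?L x = ?R (- x)" if "x \<in> {-t..-a}" for x
    using right_RL_integral_reflect[OF assms, of "- x"] that by simp
  have 2: "?R x = ?L (- x)" if "x \<in> {a..t}" for x
    using right_RL_integral_reflect[OF assms that] by simp
  have "abs_cont_on {-t..-a} ?L \<longleftrightarrow> abs_cont_on {-t..-a} (\<lambda>x. ?R (- x))"
    by (rule abs_cont_on_cong[OF 1])
  moreover have "abs_cont_on {a..t} ?R \<longleftrightarrow> abs_cont_on {a..t} (\<lambda>x. ?L (- x))"
    by (rule abs_cont_on_cong[OF 2])
  ultimately have "abs_cont_on {-t..-a} ?L \<longleftrightarrow> abs_cont_on {a..t} ?R"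
    using abs_cont_on_reflect[of a t ?R] abs_cont_on_reflect[of "-t" "-a" ?L] by auto
  then show ?thesis
    unfolding right_AC_def left_AC_def AC_loc_Icc L1_loc_Icc absolutely_integrable_reflect_iff
      by blast
qed

text \<open>\<open>deriv\<close> is unspecified where no derivative exists, so absolute continuity
  is needed to have one almost everywhere. The endpoints are discarded because the two integrals are
  known to correspond only inside the interval, and a derivative sees a neighbourhood.\<close>

lemma right_RL_deriv_reflect:
  assumes "a < t" and AC: "left_AC \<alpha> (- t) {-t..-a} (\<lambda>x. q (- x))"
  shows "AE x in lborel. x \<in> {a..t} \<longrightarrow>
    right_RL_deriv \<alpha> t {a..t} q x = left_RL_deriv \<alpha> (- t) {-t..-a} (\<lambda>x. q (- x)) (- x)"
proof -
  let ?R = "right_RL_integral (1 - \<alpha>) t {a..t} q"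
  let ?L = "left_RL_integral (1 - \<alpha>) (- t) {-t..-a} (\<lambda>x. q (- x))"
  have ac: "abs_cont_on {-t..-a} ?L" using AC by (simp add: left_AC_def AC_loc_Icc)
  have ta: "-t < -a" using assms by simp
  have "AE x in lborel. x \<noteq> a" "AE x in lborel. x \<noteq> t" by (rule AE_lborel_singleton)+
  with AE_lborel_reflect[OF abs_cont_AE_has_derivative[OF ta ac]] show ?thesis
  proof eventually_elim
    case (elim x)
    show ?case
    proof
      assume "x \<in> {a..t}"
      then have x: "x \<in> {a<..<t}" using elim by auto
      have "(?L has_real_derivative deriv ?L (- x)) (at (- x))" using elim x by auto
      then have "((\<lambda>x. ?L (- x)) has_real_derivative - deriv ?L (- x)) (at x)"
        by (simp add: DERIV_mirror)
      moreover have "\<forall>\<^sub>F y in nhds x. ?R y = ?L (- y)"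
        using eventually_nhds_in_open[of "{a<..<t}" x] x
        by (auto elim!: eventually_mono simp: right_RL_integral_reflect[OF assms(1)])
      ultimately have "(?R has_real_derivative - deriv ?L (- x)) (at x)"
        by (subst DERIV_cong_ev[OF refl _ refl]) auto
      then show "right_RL_deriv \<alpha> t {a..t} q x = left_RL_deriv \<alpha> (- t) {-t..-a} (\<lambda>x. q (- x)) (- x)"
        by (simp add: right_RL_deriv_def left_RL_deriv_def DERIV_imp_deriv)
    qed
  qed
qed

text \<open>Transposition turns multiplication by \<open>A\<close> from the right into
  multiplication by its transpose from the left, and column constant orders into row constant ones;
  reflection exchanges the two base points.\<close>

lemma right_solution_reflect:
  fixes Y :: "real \<Rightarrow> real ^ 'm ^ 'm"
  assumes "a < t"
  shows "right_solution A (column_constant \<alpha>) t {a..t} Y \<longleftrightarrow>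
    left_solution (\<lambda>x. transpose (A (- x))) (row_constant \<alpha>) (- t) {-t..-a} (\<lambda>x. transpose (Y (- x)))"
    (is "?R \<longleftrightarrow> ?L")
proof -
  let ?A = "\<forall>i j. left_AC (\<alpha> $ i) (- t) {-t..-a} (\<lambda>x. Y (- x) $ j $ i)"
  have 1: "(\<forall>i j. right_AC (column_constant \<alpha> $ i $ j) t {a..t} (\<lambda>s. Y s $ i $ j)) \<longleftrightarrow> ?A"
    by (auto simp: right_AC_reflect[OF assms] column_constant_def row_constant_def transpose_def)
  have 2: "(AE s in lebesgue_on {a..t}. (\<chi> i j. right_RL_deriv (column_constant \<alpha> $ i $ j) t {a..t} (\<lambda>s. Y s $ i $ j) s) = Y s ** A s)
     \<longleftrightarrow> (AE x in lebesgue_on {-t..-a}. (\<chi> i j. left_RL_deriv (row_constant \<alpha> $ i $ j) (- t) {-t..-a} (\<lambda>x. transpose (Y (- x)) $ i $ j) x)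
         = transpose (A (- x)) ** transpose (Y (- x)))" (is "?DR \<longleftrightarrow> ?DL") if ?A
  proof -
    have "\<forall>i j. AE s\<in>{a..t} in lborel. right_RL_deriv (\<alpha> $ j) t {a..t} (\<lambda>s. Y s $ i $ j) s =
        left_RL_deriv (\<alpha> $ j) (- t) {-t..-a} (\<lambda>x. Y (- x) $ i $ j) (- s)"
      by (intro allI right_RL_deriv_reflect[OF assms]) (use that in blast)
    then have ae: "AE s in lborel. \<forall>i j. s \<in> {a..t} \<longrightarrow> right_RL_deriv (\<alpha> $ j) t {a..t} (\<lambda>s. Y s $ i $ j) s =
        left_RL_deriv (\<alpha> $ j) (- t) {-t..-a} (\<lambda>x. Y (- x) $ i $ j) (- s)"
      by (simp only: AE_all_countable) simp
    define D where "D = (\<lambda>x. (\<chi> i j. left_RL_deriv (\<alpha> $ i) (- t) {-t..-a} (\<lambda>x. Y (- x) $ j $ i) x) = transpose (Y (- x) ** A (- x)))"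
    have "?DR \<longleftrightarrow> (AE s\<in>{a..t} in lborel. (\<chi> i j. right_RL_deriv (\<alpha> $ j) t {a..t} (\<lambda>s. Y s $ i $ j) s) = Y s ** A s)"
      by (subst AE_lebesgue_on_iff) (auto simp: column_constant_def row_constant_def transpose_def)
    also have "\<dots> \<longleftrightarrow> (AE s\<in>{a..t} in lborel. D (- s))"
      by (rule eventually_subst, use ae in eventually_elim) (auto simp: D_def vec_eq_iff transpose_def)
    also have "\<dots> \<longleftrightarrow> (AE x\<in>{-t..-a} in lborel. D x)"
    proof
      assume "AE s\<in>{a..t} in lborel. D (- s)"
      from AE_lborel_reflect[OF this] show "AE x\<in>{-t..-a} in lborel. D x"
        by eventually_elim auto
    next
      assume "AE x\<in>{-t..-a} in lborel. D x"
      from AE_lborel_reflect[OF this] show "AE s\<in>{a..t} in lborel. D (- s)"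
        by eventually_elim auto
    qed
    also have "\<dots> \<longleftrightarrow> ?DL"
      by (subst AE_lebesgue_on_iff) (auto simp: D_def row_constant_def transpose_def[of "Y _"] matrix_transpose_mul)
    finally show ?thesis .
  qed
  have 3: "(\<chi> i j. right_RL_integral (1 - column_constant \<alpha> $ i $ j) t {a..t} (\<lambda>s. Y s $ i $ j) t) = mat 1 \<longleftrightarrow>
     (\<chi> i j. left_RL_integral (1 - row_constant \<alpha> $ i $ j) (- t) {-t..-a} (\<lambda>x. transpose (Y (- x)) $ i $ j) (- t)) = mat 1"
  proof -
    have "right_RL_integral (1 - \<alpha> $ j) t {a..t} (\<lambda>s. Y s $ i $ j) t =
        left_RL_integral (1 - \<alpha> $ j) (- t) {-t..-a} (\<lambda>x. Y (- x) $ i $ j) (- t)" for i j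
      using right_RL_integral_reflect[OF assms, where x=t and q="\<lambda>s. Y s $ i $ j"
        and \<beta>="1 - \<alpha> $ j"] assms by simp
    then show ?thesis
      by (auto simp: vec_eq_iff column_constant_def row_constant_def transpose_def mat_def)
  qed
  show ?thesis
  \<comment> \<open>The derivatives correspond only for functions in \<open>left_AC\<close>. If that
    condition fails, neither side is a solution and nothing has to be compared.\<close>
  proof (cases ?A)
    case True
    then show ?thesis
      unfolding right_solution_def left_solution_def 1 2[OF True] 3
      by (auto simp: row_constant_def transpose_def)
  next
    case False
    then show ?thesis
      unfolding right_solution_def left_solution_def 1
      by (auto simp: row_constant_def transpose_def)
  qed
qed

section \<open>Systems of Volterra equations\<close>

lemma kernel_column_integrable:
  assumes "kernel M X" "y \<in> space M"
  shows "integrable M (\<lambda>x. X x y)"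
proof (rule integrableI_bounded)
  note [measurable] = kernel_measurable[OF assms(1)] assms(2)
  show "(\<lambda>x. X x y) \<in> borel_measurable M" by measurable
  obtain C where "(\<integral>\<^sup>+x. ennreal \<bar>X x y\<bar> \<partial>M) \<le> ennreal C" using assms unfolding kernel_def by auto
  also have "ennreal C < \<infinity>" by simp
  finally show "(\<integral>\<^sup>+x. ennreal (norm (X x y)) \<partial>M) < \<infinity>" by simp
qed

lemma kernel_mult_bounded:
  assumes X: "kernel M X" and [measurable]: "b \<in> borel_measurable M" and b: "\<And>y. \<bar>b y\<bar> \<le> C"
  shows "kernel M (\<lambda>x y. X x y * b y)"
proof -
  note [measurable] = kernel_measurable[OF X]
  obtain D where D: "\<And>y. y \<in> space M \<Longrightarrow> (\<integral>\<^sup>+x. ennreal \<bar>X x y\<bar> \<partial>M) \<le> ennreal D"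
    using X unfolding kernel_def by auto
  have C: "C \<ge> 0" using b[of undefined] by linarith
  have "(\<integral>\<^sup>+x. ennreal \<bar>X x y * b y\<bar> \<partial>M) \<le> ennreal (max 0 D * C)" if y: "y \<in> space M" for y
  proof -
    note [measurable] = y
    have "(\<integral>\<^sup>+x. ennreal \<bar>X x y * b y\<bar> \<partial>M) = (\<integral>\<^sup>+x. ennreal \<bar>X x y\<bar> * ennreal \<bar>b y\<bar> \<partial>M)"
      by (simp add: abs_mult ennreal_mult)
    also have "\<dots> = (\<integral>\<^sup>+x. ennreal \<bar>X x y\<bar> \<partial>M) * ennreal \<bar>b y\<bar>"
      by (rule nn_integral_multc) measurable
    also have "\<dots> \<le> ennreal (max 0 D) * ennreal C"
      using order_trans[OF D[OF y] ennreal_leI[of D "max 0 D"]] b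
        by (intro mult_mono ennreal_leI) auto
    finally show ?thesis using C by (simp add: ennreal_mult)
  qed
  then show ?thesis unfolding kernel_def by (auto intro!: exI[of _ "max 0 D * C"])
qed

lemma kernel_sum:
  assumes X: "\<And>p. p \<in> S \<Longrightarrow> kernel M (X p)" and "finite S"
  shows "kernel M (\<lambda>x y. \<Sum>p\<in>S. X p x y)"
proof -
  have m: "(\<lambda>(x, y). X p x y) \<in> borel_measurable (M \<Otimes>\<^sub>M M)" if "p \<in> S" for p
    using kernel_measurable[OF X[OF that]] .
  have "\<forall>p\<in>S. \<exists>C. \<forall>y\<in>space M. (\<integral>\<^sup>+x. ennreal \<bar>X p x y\<bar> \<partial>M) \<le> ennreal C"
    using X unfolding kernel_def by blast
  then obtain D where D: "\<And>p y. p \<in> S \<Longrightarrow> y \<in> space M \<Longrightarrow> (\<integral>\<^sup>+x. ennreal \<bar>X p x y\<bar> \<partial>M) \<le> ennreal (D p)"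
    by metis
  have "(\<integral>\<^sup>+x. ennreal \<bar>\<Sum>p\<in>S. X p x y\<bar> \<partial>M) \<le> ennreal (\<Sum>p\<in>S. max 0 (D p))" if y: "y \<in> space M" for y
  proof -
    note [measurable] = y
    have mm: "(\<lambda>x. X p x y) \<in> borel_measurable M" if "p \<in> S" for p using m[OF that] by measurable
    have "(\<integral>\<^sup>+x. ennreal \<bar>\<Sum>p\<in>S. X p x y\<bar> \<partial>M) \<le> (\<integral>\<^sup>+x. (\<Sum>p\<in>S. ennreal \<bar>X p x y\<bar>) \<partial>M)"
      by (intro nn_integral_mono) (simp add: ennreal_leI sum_abs)
    also have "\<dots> = (\<Sum>p\<in>S. \<integral>\<^sup>+x. ennreal \<bar>X p x y\<bar> \<partial>M)"
      using mm by (intro nn_integral_sum) auto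
    also have "\<dots> \<le> (\<Sum>p\<in>S. ennreal (max 0 (D p)))"
      using D[OF _ y] by (intro sum_mono order_trans[OF D[OF _ y] ennreal_leI]) auto
    finally show ?thesis by simp
  qed
  moreover have "(\<lambda>(x, y). \<Sum>p\<in>S. X p x y) \<in> borel_measurable (M \<Otimes>\<^sub>M M)"
    using m by (auto simp: case_prod_beta' intro!: borel_measurable_sum)
  ultimately show ?thesis unfolding kernel_def by auto
qed

lemma (in sigma_finite_measure) AE_kop_sum:
  assumes X: "kernel M X" and "finite S" and f: "\<And>p. p \<in> S \<Longrightarrow> integrable M (f p)"
  shows "AE x in M. kop M X (\<lambda>y. \<Sum>p\<in>S. f p y) x = (\<Sum>p\<in>S. kop M X (f p) x)"
proof -
  have "AE x in M. \<forall>p\<in>S. integrable M (\<lambda>y. X x y * f p y)"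
    using AE_kernel_integrable[OF X f] \<open>finite S\<close> by (simp add: AE_finite_all)
  then show ?thesis
    by eventually_elim (simp add: kop_def sum_distrib_left)
qed

text \<open>With the vector index as part of the measure space, composition of matrix kernels
  becomes composition of scalar kernels.\<close>

definition idx_lborel :: "('m::finite \<times> real) measure" where
  "idx_lborel = count_space UNIV \<Otimes>\<^sub>M lborel"

lemma sigma_finite_idx: "sigma_finite_measure (idx_lborel :: ('m::finite \<times> real) measure)"
proof -
  interpret pair_sigma_finite "count_space UNIV :: 'm measure" "lborel :: real measure"
    by (intro pair_sigma_finite.intro sigma_finite_measure_count_space_finite sigma_finite_lborel) simp
  show ?thesis unfolding idx_lborel_def by (rule sigma_finite_measure_axioms)
qed

lemma measurable_idx:
  "(\<And>i. (\<lambda>t. f (i, t)) \<in> measurable lborel N) \<Longrightarrow> f \<in> measurable (idx_lborel :: ('m::finite \<times> real) measure) N"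
  unfolding idx_lborel_def by (rule measurable_pair_measure_countable1) auto

lemma measurable_idx_section:
  "f \<in> measurable (idx_lborel :: ('m::finite \<times> real) measure) N \<Longrightarrow> (\<lambda>t. f (i, t)) \<in> measurable lborel N"
  unfolding idx_lborel_def by (rule measurable_compose[OF measurable_Pair1']) simp_all

lemma nn_integral_idx:
  assumes "f \<in> borel_measurable (idx_lborel :: ('m::finite \<times> real) measure)"
  shows "(\<integral>\<^sup>+x. f x \<partial>idx_lborel) = (\<Sum>i\<in>UNIV. \<integral>\<^sup>+t. f (i, t) \<partial>lborel)"
  using lborel.nn_integral_fst[of f "count_space UNIV", symmetric] assms
  by (simp add: idx_lborel_def nn_integral_count_space_finite)

lemma AE_idx_iff:
  "(AE x in (idx_lborel :: ('m::finite \<times> real) measure). P x) \<longleftrightarrow> (\<forall>i. AE t in lborel. P (i, t))"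
proof
  assume "AE x in (idx_lborel :: ('m::finite \<times> real) measure). P x"
  from AE_E3[OF this] obtain N where N: "\<And>x. x \<in> space idx_lborel - N \<Longrightarrow> P x" "N \<in> null_sets (idx_lborel :: ('m \<times> real) measure)"
    by metis
  show "\<forall>i. AE t in lborel. P (i, t)"
  proof
    fix i
    have m: "(\<lambda>x. indicator N x :: ennreal) \<in> borel_measurable idx_lborel" using N(2) by auto
    have "(\<Sum>i\<in>UNIV. \<integral>\<^sup>+t. indicator N (i, t) \<partial>lborel) = 0"
      using N(2) nn_integral_idx[OF m] by (simp add: null_sets_def)
    then have "(\<integral>\<^sup>+t. indicator N (i, t) \<partial>lborel) = 0" by (simp add: sum_eq_0_iff)
    then have "AE t in lborel. indicator N (i, t) = (0 :: ennreal)"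
      by (subst (asm) nn_integral_0_iff_AE) (rule measurable_idx_section[OF m])
    then show "AE t in lborel. P (i, t)"
      by eventually_elim (use N(1) in \<open>auto simp: idx_lborel_def space_pair_measure indicator_def split: if_splits\<close>)
  qed
next
  assume *: "\<forall>i. AE t in lborel. P (i, t)"
  have "\<forall>i. \<exists>N. N \<in> null_sets lborel \<and> (\<forall>t. t \<notin> N \<longrightarrow> P (i, t))"
  proof
    fix i
    from AE_E3[OF *[rule_format, of i]] show "\<exists>N. N \<in> null_sets lborel \<and> (\<forall>t. t \<notin> N \<longrightarrow> P (i, t))"
      by (metis DiffI UNIV_I space_borel space_lborel)
  qed
  then obtain N where N: "\<And>i. N i \<in> null_sets lborel" "\<And>i t. t \<notin> N i \<Longrightarrow> P (i, t)" by metis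
  have "(\<Union>i. {i} \<times> N i) \<in> null_sets (idx_lborel :: ('m \<times> real) measure)"
  proof (intro null_sets_UN)
    fix i :: 'm
    have "N i \<in> sets lborel" "emeasure lborel (N i) = 0" using N(1)[of i]
      by (simp_all add: null_sets_def)
    then show "{i} \<times> N i \<in> null_sets idx_lborel"
      unfolding idx_lborel_def null_sets_def by (simp add: lborel.emeasure_pair_measure_Times)
  qed
  then show "AE x in (idx_lborel :: ('m::finite \<times> real) measure). P x"
    by (rule AE_I') (use N(2) in \<open>auto\<close>)
qed

lemma integrable_idx_iff:
  fixes f :: "'m::finite \<times> real \<Rightarrow> real"
  shows "integrable idx_lborel f \<longleftrightarrow> (\<forall>i. integrable lborel (\<lambda>t. f (i, t)))"
proof
  assume f: "integrable idx_lborel f"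
  then have m: "f \<in> borel_measurable idx_lborel" by auto
  have "(\<Sum>i\<in>UNIV. \<integral>\<^sup>+t. ennreal (norm (f (i, t))) \<partial>lborel) < \<infinity>"
    using f m by (subst nn_integral_idx[symmetric]) (auto simp: integrable_iff_bounded)
  then show "\<forall>i. integrable lborel (\<lambda>t. f (i, t))"
    using measurable_idx_section[OF m] by (auto simp: integrable_iff_bounded)
next
  assume f: "\<forall>i. integrable lborel (\<lambda>t. f (i, t))"
  then have m: "f \<in> borel_measurable idx_lborel"
    by (intro measurable_idx borel_measurable_integrable) blast
  then have "(\<integral>\<^sup>+x. ennreal (norm (f x)) \<partial>idx_lborel) = (\<Sum>i\<in>UNIV. \<integral>\<^sup>+t. ennreal (norm (f (i, t))) \<partial>lborel)"
    by (intro nn_integral_idx) auto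
  also have "\<dots> < \<infinity>" using f by (auto simp: integrable_iff_bounded)
  finally show "integrable idx_lborel f" using m by (intro integrableI_bounded)
qed

lemma integral_idx:
  fixes f :: "'m::finite \<times> real \<Rightarrow> real"
  assumes f: "integrable idx_lborel f"
  shows "(\<integral>x. f x \<partial>idx_lborel) = (\<Sum>i\<in>UNIV. \<integral>t. f (i, t) \<partial>lborel)"
proof -
  interpret pair_sigma_finite "count_space UNIV :: 'm measure" "lborel :: real measure"
    by (intro pair_sigma_finite.intro sigma_finite_measure_count_space_finite sigma_finite_lborel) simp
  show ?thesis
    using integral_fst'[of f] f by (simp add: idx_lborel_def lebesgue_integral_count_space_finite)
qed

lemma kernel_idx:
  fixes X :: "'m::finite \<Rightarrow> 'm \<Rightarrow> real \<Rightarrow> real \<Rightarrow> real"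
  assumes X: "\<And>i l. kernel lborel (X i l)"
  shows "kernel idx_lborel (\<lambda>x y. X (fst x) (fst y) (snd x) (snd y))"
proof -
  have [measurable]: "case_prod (X i l) \<in> borel_measurable (lborel \<Otimes>\<^sub>M lborel)" for i l
    by (rule kernel_measurable[OF X])
  have [measurable]: "fst \<in> measurable (idx_lborel :: ('m \<times> real) measure) (count_space UNIV)"
    "snd \<in> measurable (idx_lborel :: ('m \<times> real) measure) lborel"
    unfolding idx_lborel_def by measurable
  \<comment> \<open>A kernel chosen by the indices of its arguments is measurable as a finite sum of
    scalar kernels, each cut off to one pair of indices.\<close>
  have "(\<lambda>p. \<Sum>i\<in>UNIV. \<Sum>l\<in>UNIV. if i = fst (fst p) \<and> l = fst (snd p) then X i l (snd (fst p)) (snd (snd p)) else 0)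
    \<in> borel_measurable (idx_lborel \<Otimes>\<^sub>M idx_lborel :: (('m \<times> real) \<times> ('m \<times> real)) measure)"
    by measurable
  also have "(\<lambda>p :: ('m \<times> real) \<times> ('m \<times> real). \<Sum>i\<in>UNIV. \<Sum>l\<in>UNIV. if i = fst (fst p) \<and> l = fst (snd p) then X i l (snd (fst p)) (snd (snd p)) else 0)
      = (\<lambda>(x, y). X (fst x) (fst y) (snd x) (snd y))"
  proof
    fix p :: "('m \<times> real) \<times> ('m \<times> real)"
    have "(\<Sum>l\<in>UNIV. if i = fst (fst p) \<and> l = fst (snd p) then X i l (snd (fst p)) (snd (snd p)) else 0)
        = (if i = fst (fst p) then X i (fst (snd p)) (snd (fst p)) (snd (snd p)) else 0)" for i
      by (cases "i = fst (fst p)") simp_all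
    then show "(\<Sum>i\<in>UNIV. \<Sum>l\<in>UNIV. if i = fst (fst p) \<and> l = fst (snd p) then X i l (snd (fst p)) (snd (snd p)) else 0)
      = (case p of (x, y) \<Rightarrow> X (fst x) (fst y) (snd x) (snd y))" by (simp add: case_prod_beta)
  qed
  finally have m: "(\<lambda>(x, y). X (fst x) (fst y) (snd x) (snd y)) \<in> borel_measurable (idx_lborel \<Otimes>\<^sub>M idx_lborel)" .
  have "\<forall>i l. \<exists>C. \<forall>\<tau>. (\<integral>\<^sup>+t. ennreal \<bar>X i l t \<tau>\<bar> \<partial>lborel) \<le> ennreal C"
    using X unfolding kernel_def by auto
  then obtain D where D: "\<And>i l \<tau>. (\<integral>\<^sup>+t. ennreal \<bar>X i l t \<tau>\<bar> \<partial>lborel) \<le> ennreal (D i l)"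
    by metis
  have "(\<integral>\<^sup>+x. ennreal \<bar>X (fst x) (fst y) (snd x) (snd y)\<bar> \<partial>idx_lborel) \<le> ennreal (\<Sum>l\<in>UNIV. \<Sum>i\<in>UNIV. max 0 (D i l))" for y
  proof -
    obtain l \<tau> where y: "y = (l, \<tau>)" by (cases y)
    have "(\<lambda>x. X (fst x) l (snd x) \<tau>) \<in> borel_measurable idx_lborel"
      by (rule measurable_idx) simp
    then have "(\<integral>\<^sup>+x. ennreal \<bar>X (fst x) l (snd x) \<tau>\<bar> \<partial>idx_lborel) = (\<Sum>i\<in>UNIV. \<integral>\<^sup>+t. ennreal \<bar>X i l t \<tau>\<bar> \<partial>lborel)"
      by (subst nn_integral_idx) auto
    also have "\<dots> \<le> (\<Sum>i\<in>UNIV. ennreal (max 0 (D i l)))"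
      by (intro sum_mono order_trans[OF D ennreal_leI]) auto
    also have "\<dots> = ennreal (\<Sum>i\<in>UNIV. max 0 (D i l))" by simp
    also have "\<dots> \<le> ennreal (\<Sum>l\<in>UNIV. \<Sum>i\<in>UNIV. max 0 (D i l))"
      by (intro ennreal_leI member_le_sum[of l UNIV "\<lambda>l. \<Sum>i\<in>UNIV. max 0 (D i l)"]) (auto intro: sum_nonneg)
    finally show ?thesis by (simp add: y)
  qed
  then show ?thesis using m unfolding kernel_def by blast
qed

lemma AE_kop_idx:
  fixes X :: "'m::finite \<Rightarrow> 'm \<Rightarrow> real \<Rightarrow> real \<Rightarrow> real"
  assumes X: "\<And>i l. kernel lborel (X i l)" and z: "\<And>l. integrable lborel (z l)"
  shows "AE x in idx_lborel. kop idx_lborel (\<lambda>x y. X (fst x) (fst y) (snd x) (snd y)) (\<lambda>y. z (fst y) (snd y)) x =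
     (\<Sum>l\<in>UNIV. kop lborel (X (fst x) l) (z l) (snd x))"
proof -
  have "integrable idx_lborel (\<lambda>y. z (fst y) (snd y))" using z by (simp add: integrable_idx_iff)
  from sigma_finite_measure.AE_kernel_integrable[OF sigma_finite_idx kernel_idx[where X=X, OF X] this]
  show ?thesis
    by eventually_elim (simp add: kop_def integral_idx)
qed

section \<open>Volterra systems with bounded coefficients\<close>

locale volterra_system =
  fixes \<alpha> :: "'m::finite \<Rightarrow> real" and B :: "'m \<Rightarrow> 'm \<Rightarrow> real \<Rightarrow> real" and a c C :: real
  assumes \<alpha>_pos: "\<And>i. 0 < \<alpha> i"
    and B_measurable[measurable]: "\<And>i l. B i l \<in> borel_measurable borel"
    and B_bound: "\<And>i l t. \<bar>B i l t\<bar> \<le> C"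
begin

text \<open>The entries of the matrix kernel \<open>K A\<close>, cut off to the triangle between
  \<open>a\<close> and \<open>c\<close>.\<close>

definition gen :: "'m \<Rightarrow> 'm \<Rightarrow> real \<Rightarrow> real \<Rightarrow> real" where
  "gen i l t \<tau> = frac_op_kernel (\<alpha> i) a c t \<tau> * B i l \<tau>"

abbreviation "Gen \<equiv> (\<lambda>x y. gen (fst x) (fst y) (snd x) (snd y))"

abbreviation volt :: "('m \<Rightarrow> real \<Rightarrow> real) \<Rightarrow> 'm \<Rightarrow> real \<Rightarrow> real" where
  "volt z i t \<equiv> kop lborel (frac_op_kernel (\<alpha> i) a c) (\<lambda>\<tau>. \<Sum>l\<in>UNIV. B i l \<tau> * z l \<tau>) t"

definition volterra_solution :: "('m \<Rightarrow> real \<Rightarrow> real) \<Rightarrow> ('m \<Rightarrow> real \<Rightarrow> real) \<Rightarrow> bool" where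
  "volterra_solution f z \<longleftrightarrow> (\<forall>i. integrable lborel (f i)) \<and> (\<forall>i. integrable lborel (z i)) \<and>
     (\<forall>i. AE t in lborel. z i t = f i t + volt z i t)"

lemma kernel_gen: "kernel lborel (gen i l)"
  unfolding gen_def[abs_def]
  by (rule kernel_mult_bounded[OF frac_op_kernel_kernel[OF \<alpha>_pos]]) (use B_bound in auto)

lemma integrable_B_mult:
  assumes "integrable lborel z"
  shows "integrable lborel (\<lambda>\<tau>. B i l \<tau> * z \<tau>)"
proof (rule Bochner_Integration.integrable_bound)
  show "integrable lborel (\<lambda>\<tau>. C * z \<tau>)" using assms by simp
  show "(\<lambda>\<tau>. B i l \<tau> * z \<tau>) \<in> borel_measurable lborel" using assms by measurable
  have "0 \<le> C" using B_bound[of i l 0] by linarith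
  then show "AE \<tau> in lborel. norm (B i l \<tau> * z \<tau>) \<le> norm (C * z \<tau>)"
    using B_bound by (intro AE_I2) (auto simp: abs_mult intro!: mult_right_mono)
qed

lemma AE_kop_Gen:
  assumes z: "\<And>l. integrable lborel (z l)"
  shows "AE x in idx_lborel. kop idx_lborel Gen (\<lambda>y. z (fst y) (snd y)) x = volt z (fst x) (snd x)"
proof -
  have "\<forall>i. AE t in lborel. volt z i t = (\<Sum>l\<in>UNIV. kop lborel (gen i l) (z l) t)"
  proof
    fix i
    have "kop lborel (gen i l) (z l) t = kop lborel (frac_op_kernel (\<alpha> i) a c) (\<lambda>\<tau>. B i l \<tau> * z l \<tau>) t" for l t
      by (simp add: kop_def gen_def mult.assoc)
    then show "AE t in lborel. volt z i t = (\<Sum>l\<in>UNIV. kop lborel (gen i l) (z l) t)"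
      using lborel.AE_kop_sum[OF frac_op_kernel_kernel[OF \<alpha>_pos, of i a c], of UNIV "\<lambda>l \<tau>. B i l \<tau> * z l \<tau>"]
        integrable_B_mult[OF z] by simp
  qed
  then have "AE x in idx_lborel. volt z (fst x) (snd x) = (\<Sum>l\<in>UNIV. kop lborel (gen (fst x) l) (z l) (snd x))"
    by (simp add: AE_idx_iff)
  with AE_kop_idx[where X=gen, OF kernel_gen z] show ?thesis
    by eventually_elim simp
qed

text \<open>Measuring time from \<open>a\<close> keeps the weight between
  \<open>exp (- \<mu> * (c - a))\<close> and 1 on \<open>{a..c}\<close>. Outside it is set to 1 so
  that it stays positive and at most 1; the columns of \<open>Gen\<close> with second variable
  outside \<open>{a..c}\<close> are zero.\<close>

definition weight :: "real \<Rightarrow> 'm \<times> real \<Rightarrow> ennreal" where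
  "weight \<mu> x = (if snd x \<in> {a..c} then ennreal (exp (- \<mu> * (snd x - a))) else 1)"

lemma weight_measurable[measurable]: "weight \<mu> \<in> borel_measurable idx_lborel"
  by (rule measurable_idx) (unfold weight_def snd_conv, measurable)

lemma weight_bounds:
  assumes "\<mu> > 0"
  shows "weight \<mu> x \<le> 1" "0 < weight \<mu> x" "a \<le> c \<Longrightarrow> ennreal (exp (- \<mu> * (c - a))) \<le> weight \<mu> x"
  using assms by (auto simp: weight_def ennreal_le_1 mult_nonneg_nonneg ennreal_leI)

text \<open>All orders are positive, so each power of \<mu> tends to 0. The sum over
  \<open>i\<close> appears because a single column of the matrix kernel has entries in every
  row.\<close>

lemma obtain_rate:
  obtains \<mu> where "\<mu> > 0" "(\<Sum>i\<in>UNIV. C * \<mu> powr (- \<alpha> i)) \<le> 1 / 2"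
proof -
  have "((\<lambda>\<mu>. \<Sum>i\<in>UNIV. C * \<mu> powr (- \<alpha> i)) \<longlongrightarrow> (\<Sum>i\<in>(UNIV :: 'm set). C * 0)) at_top"
    using \<alpha>_pos by (intro tendsto_sum tendsto_mult tendsto_const tendsto_neg_powr filterlim_ident) auto
  then have "\<forall>\<^sub>F \<mu> in at_top. (\<Sum>i\<in>UNIV. C * \<mu> powr (- \<alpha> i)) < 1 / 2"
    by (intro order_tendstoD) auto
  then have "\<forall>\<^sub>F \<mu> in at_top. \<mu> > 0 \<and> (\<Sum>i\<in>UNIV. C * \<mu> powr (- \<alpha> i)) < 1 / 2"
    using eventually_gt_at_top[of 0] by eventually_elim auto
  then obtain \<mu> where "\<mu> > 0 \<and> (\<Sum>i\<in>UNIV. C * \<mu> powr (- \<alpha> i)) < 1 / 2"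
    using eventually_happens'[OF trivial_limit_at_top_linorder] by blast
  then show ?thesis using that by auto
qed

text \<open>The weight at \<open>t\<close> splits into \<open>exp (- \<mu> * (t - \<tau>))\<close>
  and the weight at \<tau>. The first factor turns the integral over \<open>t\<close> into the
  Laplace transform of the fractional kernel, the second is the weight of \<open>y\<close>.\<close>

lemma weight_contraction:
  assumes \<mu>: "\<mu> > 0" "(\<Sum>i\<in>UNIV. C * \<mu> powr (- \<alpha> i)) \<le> 1 / 2"
  shows "(\<integral>\<^sup>+x. weight \<mu> x * ennreal \<bar>Gen x y\<bar> \<partial>idx_lborel) \<le> ennreal (1 / 2) * weight \<mu> y"
proof -
  obtain l \<tau> where y: "y = (l, \<tau>)" by (cases y)
  have C: "0 \<le> C" using B_bound[of undefined undefined 0] by linarith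
  have gm[measurable]: "(\<lambda>t. gen i l t \<tau>) \<in> borel_measurable borel" for i
    using kernel_measurable[OF kernel_gen[of i l]] by measurable
  have "(\<lambda>x. weight \<mu> x * ennreal \<bar>Gen x y\<bar>) \<in> borel_measurable idx_lborel"
    by (rule measurable_idx) (unfold weight_def y fst_conv snd_conv, measurable)
  then have "(\<integral>\<^sup>+x. weight \<mu> x * ennreal \<bar>Gen x y\<bar> \<partial>idx_lborel) =
     (\<Sum>i\<in>UNIV. \<integral>\<^sup>+t. weight \<mu> (i, t) * ennreal \<bar>gen i l t \<tau>\<bar> \<partial>lborel)"
    by (subst nn_integral_idx) (auto simp: y)
  also have "\<dots> \<le> (\<Sum>i\<in>UNIV. ennreal (C * \<mu> powr (- \<alpha> i)) * weight \<mu> y)"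
  proof (rule sum_mono)
    fix i
    show "(\<integral>\<^sup>+t. weight \<mu> (i, t) * ennreal \<bar>gen i l t \<tau>\<bar> \<partial>lborel) \<le> ennreal (C * \<mu> powr (- \<alpha> i)) * weight \<mu> y"
    proof (cases "\<tau> \<in> {a..c}")
      case True
      have "(\<integral>\<^sup>+t. weight \<mu> (i, t) * ennreal \<bar>gen i l t \<tau>\<bar> \<partial>lborel) \<le>
        (\<integral>\<^sup>+t. (ennreal C * weight \<mu> y) * (ennreal (exp (- \<mu> * (t - \<tau>))) * ennreal (frac_kernel (\<alpha> i) (t - \<tau>))) \<partial>lborel)"
      proof (rule nn_integral_mono)
        fix t
        show "weight \<mu> (i, t) * ennreal \<bar>gen i l t \<tau>\<bar> \<le>
           (ennreal C * weight \<mu> y) * (ennreal (exp (- \<mu> * (t - \<tau>))) * ennreal (frac_kernel (\<alpha> i) (t - \<tau>)))"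
        proof (cases "\<tau> < t \<and> t \<le> c")
          case t: True
          have e: "exp (- \<mu> * (t - a)) = exp (- \<mu> * (t - \<tau>)) * exp (- \<mu> * (\<tau> - a))"
            by (simp add: exp_add[symmetric] algebra_simps)
          have n: "0 \<le> frac_kernel (\<alpha> i) (t - \<tau>)" using frac_kernel_nonneg[OF \<alpha>_pos] .
          have "\<bar>gen i l t \<tau>\<bar> \<le> frac_kernel (\<alpha> i) (t - \<tau>) * C"
            using True t n B_bound[of i l \<tau>]
              by (simp add: gen_def frac_op_kernel_def abs_mult mult_left_mono)
          then have "exp (- \<mu> * (t - a)) * \<bar>gen i l t \<tau>\<bar> \<le> exp (- \<mu> * (t - a)) * (frac_kernel (\<alpha> i) (t - \<tau>) * C)"
            by (intro mult_left_mono) auto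
          also have "\<dots> = (C * exp (- \<mu> * (\<tau> - a))) * (exp (- \<mu> * (t - \<tau>)) * frac_kernel (\<alpha> i) (t - \<tau>))"
            unfolding e by (simp add: mult_ac)
          finally have "ennreal (exp (- \<mu> * (t - a)) * \<bar>gen i l t \<tau>\<bar>) \<le>
             ennreal ((C * exp (- \<mu> * (\<tau> - a))) * (exp (- \<mu> * (t - \<tau>)) * frac_kernel (\<alpha> i) (t - \<tau>)))"
            by (rule ennreal_leI)
          then show ?thesis
            using True t C n by (simp add: weight_def y ennreal_mult)
        next
          case False
          then have "gen i l t \<tau> = 0" by (auto simp: gen_def frac_op_kernel_def frac_kernel_def)
          then show ?thesis by simp
        qed
      qed
      also have "\<dots> = (ennreal C * weight \<mu> y) * ennreal (\<mu> powr (- \<alpha> i))"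
        unfolding frac_kernel_laplace_shift[OF \<alpha>_pos \<mu>(1), symmetric, where \<tau>=\<tau>]
        by (rule nn_integral_cmult) measurable
      also have "\<dots> = ennreal (C * \<mu> powr (- \<alpha> i)) * weight \<mu> y"
        using C by (simp add: ennreal_mult mult_ac)
      finally show ?thesis .
    next
      case False
      then have "gen i l t \<tau> = 0" for t by (auto simp: gen_def frac_op_kernel_def frac_kernel_def)
      then show ?thesis by simp
    qed
  qed
  also have "\<dots> = ennreal (\<Sum>i\<in>UNIV. C * \<mu> powr (- \<alpha> i)) * weight \<mu> y"
    using C by (simp add: sum_distrib_right[symmetric])
  also have "\<dots> \<le> ennreal (1 / 2) * weight \<mu> y"
    using \<mu>(2) by (intro mult_right_mono ennreal_leI) auto
  finally show ?thesis .
qed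

text \<open>The lower bound of the weight converts the weighted estimate into an unweighted one with
  constant \<open>2 * exp (\<mu> * (c - a))\<close>. The constant is chosen before \<open>f\<close>
  and \<open>z\<close>, so one \<open>K\<close> serves all columns of the transition matrix.\<close>

lemma volterra_bound:
  assumes "a \<le> c"
  obtains K where "\<And>z f. volterra_solution f z \<Longrightarrow>
    (\<Sum>i\<in>UNIV. \<integral>\<^sup>+t. ennreal \<bar>z i t\<bar> \<partial>lborel) \<le> ennreal K * (\<Sum>i\<in>UNIV. \<integral>\<^sup>+t. ennreal \<bar>f i t\<bar> \<partial>lborel)"
proof -
  obtain \<mu> where \<mu>: "\<mu> > 0" "(\<Sum>i\<in>UNIV. C * \<mu> powr (- \<alpha> i)) \<le> 1 / 2" by (rule obtain_rate)
  define e where "e = exp (\<mu> * (c - a))"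
  show ?thesis
  proof (rule that[of "e * 2"])
    fix z f
    assume "volterra_solution f z"
    then have z: "\<And>i. integrable lborel (z i)" and f: "\<And>i. integrable lborel (f i)"
      and eq: "\<And>i. AE t in lborel. z i t = f i t + volt z i t" by (auto simp: volterra_solution_def)
    define z' f' where "z' = (\<lambda>x. z (fst x) (snd x))" and "f' = (\<lambda>x. f (fst x) (snd x))"
    have z': "integrable idx_lborel z'" and f': "integrable idx_lborel f'"
      using z f by (simp_all add: integrable_idx_iff z'_def f'_def)
    have "AE x in idx_lborel. z' x = f' x + volt z (fst x) (snd x)"
      using eq by (simp add: AE_idx_iff z'_def f'_def)
    then have eq': "AE x in idx_lborel. z' x = f' x + kop idx_lborel Gen z' x"
      using AE_kop_Gen[of z, OF z] by eventually_elim (simp add: z'_def)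
    have le: "(\<integral>\<^sup>+x. weight \<mu> x * ennreal \<bar>z' x\<bar> \<partial>idx_lborel) \<le> 2 * (\<integral>\<^sup>+x. weight \<mu> x * ennreal \<bar>f' x\<bar> \<partial>idx_lborel)"
      by (rule sigma_finite_measure.kernel_a_priori_bound[OF sigma_finite_idx kernel_idx[where X=gen, OF kernel_gen] weight_measurable
             borel_measurable_integrable[OF f'] weight_bounds(1)[OF \<mu>(1)] weight_contraction[OF \<mu>] z' eq'])
    have [measurable]: "z' \<in> borel_measurable idx_lborel" "f' \<in> borel_measurable idx_lborel"
      using z' f' by auto
    have "(\<integral>\<^sup>+x. ennreal \<bar>z' x\<bar> \<partial>idx_lborel) \<le> (\<integral>\<^sup>+x. ennreal e * (weight \<mu> x * ennreal \<bar>z' x\<bar>) \<partial>idx_lborel)"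
    proof (rule nn_integral_mono)
      fix x
      have "1 = ennreal e * ennreal (exp (- \<mu> * (c - a)))"
        by (simp add: e_def ennreal_mult[symmetric] exp_add[symmetric])
      also have "\<dots> \<le> ennreal e * weight \<mu> x" using weight_bounds(3)[OF \<mu>(1) assms]
        by (rule mult_left_mono) simp
      finally have "1 * ennreal \<bar>z' x\<bar> \<le> ennreal e * weight \<mu> x * ennreal \<bar>z' x\<bar>"
        by (rule mult_right_mono) simp
      then show "ennreal \<bar>z' x\<bar> \<le> ennreal e * (weight \<mu> x * ennreal \<bar>z' x\<bar>)"
        by (simp add: mult.assoc)
    qed
    also have "\<dots> = ennreal e * (\<integral>\<^sup>+x. weight \<mu> x * ennreal \<bar>z' x\<bar> \<partial>idx_lborel)"
      by (rule nn_integral_cmult) measurable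
    also have "\<dots> \<le> ennreal e * (2 * (\<integral>\<^sup>+x. weight \<mu> x * ennreal \<bar>f' x\<bar> \<partial>idx_lborel))"
      by (rule mult_left_mono[OF le]) simp
    also have "\<dots> \<le> ennreal e * (2 * (\<integral>\<^sup>+x. 1 * ennreal \<bar>f' x\<bar> \<partial>idx_lborel))"
      using weight_bounds(1)[OF \<mu>(1)] by (intro mult_left_mono nn_integral_mono mult_right_mono) auto
    also have "\<dots> = ennreal (e * 2) * (\<integral>\<^sup>+x. ennreal \<bar>f' x\<bar> \<partial>idx_lborel)"
      by (simp add: e_def ennreal_mult mult.assoc)
    finally have "(\<integral>\<^sup>+x. ennreal \<bar>z' x\<bar> \<partial>idx_lborel) \<le> ennreal (e * 2) * (\<integral>\<^sup>+x. ennreal \<bar>f' x\<bar> \<partial>idx_lborel)" .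
    then show "(\<Sum>i\<in>UNIV. \<integral>\<^sup>+t. ennreal \<bar>z i t\<bar> \<partial>lborel) \<le> ennreal (e * 2) * (\<Sum>i\<in>UNIV. \<integral>\<^sup>+t. ennreal \<bar>f i t\<bar> \<partial>lborel)"
    proof -
      have "(\<integral>\<^sup>+x. ennreal \<bar>z' x\<bar> \<partial>idx_lborel) = (\<Sum>i\<in>UNIV. \<integral>\<^sup>+t. ennreal \<bar>z i t\<bar> \<partial>lborel)"
        "(\<integral>\<^sup>+x. ennreal \<bar>f' x\<bar> \<partial>idx_lborel) = (\<Sum>i\<in>UNIV. \<integral>\<^sup>+t. ennreal \<bar>f i t\<bar> \<partial>lborel)"
        by (subst nn_integral_idx, measurable, simp add: z'_def f'_def)+
      then show ?thesis
        using \<open>(\<integral>\<^sup>+x. ennreal \<bar>z' x\<bar> \<partial>idx_lborel) \<le> ennreal (e * 2) * (\<integral>\<^sup>+x. ennreal \<bar>f' x\<bar> \<partial>idx_lborel)\<close> by simp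
    qed
  qed
qed

lemma volterra_unique:
  assumes "a \<le> c" and z: "\<And>i. integrable lborel (z i)"
    and eq: "\<And>i. AE t in lborel. z i t = volt z i t"
  shows "AE t in lborel. z i t = 0"
proof -
  from volterra_bound[OF assms(1)] obtain K where K: "\<And>z f. volterra_solution f z \<Longrightarrow>
    (\<Sum>i\<in>UNIV. \<integral>\<^sup>+t. ennreal \<bar>z i t\<bar> \<partial>lborel) \<le> ennreal K * (\<Sum>i\<in>UNIV. \<integral>\<^sup>+t. ennreal \<bar>f i t\<bar> \<partial>lborel)"
    by blast
  have "(\<Sum>i\<in>UNIV. \<integral>\<^sup>+t. ennreal \<bar>z i t\<bar> \<partial>lborel) \<le> ennreal K * (\<Sum>i\<in>(UNIV :: 'm set). \<integral>\<^sup>+(t::real). ennreal \<bar>0\<bar> \<partial>lborel)"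
    by (rule K[of "\<lambda>_ _. 0" z]) (use z eq in \<open>simp add: volterra_solution_def\<close>)
  then have "(\<integral>\<^sup>+t. ennreal \<bar>z i t\<bar> \<partial>lborel) = 0" by (simp add: sum_eq_0_iff)
  then show ?thesis
    using z[of i] by (subst (asm) nn_integral_0_iff_AE) auto
qed

text \<open>Multiplying the equations of the columns by \<open>B\<close> from the right shows that
  \<open>Q = z B\<close> satisfies \<open>Q = Gen + Gen Q\<close>, so \<open>Q\<close> is the
  resolvent of \<open>Gen\<close>. Each column of \<open>z\<close> solves the equation of
  \<open>Gen\<close> with a column \<open>f\<close> of the diagonal kernel as source, and hence
  equals \<open>f + Q f\<close>.\<close>

lemma volterra_transposed:
  assumes z: "\<And>i j. kernel lborel (z i j)"
    and eq: "AE s in lborel. \<forall>i j. AE t in lborel. z i j t s =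
      (if i = j then frac_op_kernel (\<alpha> i) a c t s else 0) + volt (\<lambda>l \<tau>. z l j \<tau> s) i t"
  shows "AE s in lborel. \<forall>i j. AE t in lborel. z i j t s =
      (if i = j then frac_op_kernel (\<alpha> i) a c t s else 0)
       + kop lborel (\<lambda>t \<tau>. \<Sum>p\<in>UNIV. z i p t \<tau> * B p j \<tau>) (\<lambda>\<tau>. frac_op_kernel (\<alpha> j) a c \<tau> s) t"
proof -
  define Q where "Q i j t \<tau> = (\<Sum>p\<in>UNIV. z i p t \<tau> * B p j \<tau>)" for i j t \<tau>
  have kQ: "kernel lborel (Q i j)" for i j
    unfolding Q_def by (intro kernel_sum kernel_mult_bounded[OF z]) (use B_bound in auto)
  have iz: "integrable lborel (\<lambda>t. z i j t s)" for i j s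
    by (rule kernel_column_integrable[OF z]) simp
  have iQ: "integrable lborel (\<lambda>t. Q i j t s)" for i j s
    by (rule kernel_column_integrable[OF kQ]) simp
  note kf = frac_op_kernel_kernel[OF \<alpha>_pos]
  obtain \<mu> where \<mu>: "\<mu> > 0" "(\<Sum>i\<in>UNIV. C * \<mu> powr (- \<alpha> i)) \<le> 1 / 2" by (rule obtain_rate)
  have Qeq: "AE t in lborel. Q i l t \<tau> = gen i l t \<tau> + volt (\<lambda>q t. Q q l t \<tau>) i t"
    if \<tau>: "\<forall>i j. AE t in lborel. z i j t \<tau> =
      (if i = j then frac_op_kernel (\<alpha> i) a c t \<tau> else 0) + volt (\<lambda>l t. z l j t \<tau>) i t" for i l \<tau>
  proof -
    define g where "g p \<xi> = (\<Sum>q\<in>UNIV. B i q \<xi> * z q p \<xi> \<tau>)" for p \<xi>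
    have ig: "integrable lborel (g p)" for p
      unfolding g_def by (intro Bochner_Integration.integrable_sum integrable_B_mult iz)
    have "AE t in lborel. \<forall>p. z i p t \<tau> = (if i = p then frac_op_kernel (\<alpha> i) a c t \<tau> else 0) + kop lborel (frac_op_kernel (\<alpha> i) a c) (g p) t"
      using \<tau> unfolding g_def by (simp add: AE_all_countable)
    moreover have "AE t in lborel. kop lborel (frac_op_kernel (\<alpha> i) a c) (\<lambda>\<xi>. \<Sum>p\<in>UNIV. g p \<xi> * B p l \<tau>) t =
       (\<Sum>p\<in>UNIV. kop lborel (frac_op_kernel (\<alpha> i) a c) (\<lambda>\<xi>. g p \<xi> * B p l \<tau>) t)"
      by (rule lborel.AE_kop_sum[OF kf]) (use ig in auto)
    ultimately show ?thesis
    proof eventually_elim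
      case (elim t)
      \<comment> \<open>The right factor \<open>B p l \<tau>\<close> does not depend on the
        integration variable \<xi>, so right multiplication commutes with \<open>volt\<close>; the
        rest is an exchange of the sums over \<open>p\<close> and \<open>q\<close>.\<close>
      have "(\<Sum>p\<in>UNIV. g p \<xi> * B p l \<tau>) = (\<Sum>q\<in>UNIV. B i q \<xi> * Q q l \<xi> \<tau>)" for \<xi>
        unfolding g_def Q_def sum_distrib_left sum_distrib_right
        by (subst sum.swap) (simp add: mult_ac)
      then have v: "volt (\<lambda>q t. Q q l t \<tau>) i t = (\<Sum>p\<in>UNIV. kop lborel (frac_op_kernel (\<alpha> i) a c) (\<lambda>\<xi>. g p \<xi> * B p l \<tau>) t)"
        using elim(2) by simp
      have "Q i l t \<tau> = (\<Sum>p\<in>UNIV. (if i = p then frac_op_kernel (\<alpha> i) a c t \<tau> * B p l \<tau> else 0)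
          + kop lborel (frac_op_kernel (\<alpha> i) a c) (\<lambda>\<xi>. g p \<xi> * B p l \<tau>) t)"
        unfolding Q_def
      proof (rule sum.cong)
        fix p
        have "kop lborel (frac_op_kernel (\<alpha> i) a c) (\<lambda>\<xi>. g p \<xi> * B p l \<tau>) t = kop lborel (frac_op_kernel (\<alpha> i) a c) (g p) t * B p l \<tau>"
          by (simp add: kop_def mult.assoc[symmetric])
        then show "z i p t \<tau> * B p l \<tau> = (if i = p then frac_op_kernel (\<alpha> i) a c t \<tau> * B p l \<tau> else 0)
          + kop lborel (frac_op_kernel (\<alpha> i) a c) (\<lambda>\<xi>. g p \<xi> * B p l \<tau>) t"
          using elim(1)[rule_format, of p] by (simp add: distrib_right)
      qed simp
      then show ?case unfolding v by (simp add: sum.distrib gen_def)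
    qed
  qed
  have PQ: "AE y in idx_lborel. AE x in idx_lborel. Q (fst x) (fst y) (snd x) (snd y) =
     Gen x y + kop idx_lborel Gen (\<lambda>z. Q (fst z) (fst y) (snd z) (snd y)) x"
    unfolding AE_idx_iff[where P="\<lambda>y. AE x in idx_lborel. Q (fst x) (fst y) (snd x) (snd y) =
     Gen x y + kop idx_lborel Gen (\<lambda>z. Q (fst z) (fst y) (snd z) (snd y)) x"] fst_conv snd_conv
  proof
    fix l
    show "AE \<tau> in lborel. AE x in idx_lborel. Q (fst x) l (snd x) \<tau> =
       gen (fst x) l (snd x) \<tau> + kop idx_lborel Gen (\<lambda>z. Q (fst z) l (snd z) \<tau>) x"
      using eq
    proof eventually_elim
      case (elim \<tau>)
      have "AE x in idx_lborel. Q (fst x) l (snd x) \<tau> = gen (fst x) l (snd x) \<tau> + volt (\<lambda>q t. Q q l t \<tau>) (fst x) (snd x)"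
        unfolding AE_idx_iff fst_conv snd_conv using Qeq[OF elim] by blast
      with AE_kop_Gen[of "\<lambda>q t. Q q l t \<tau>", OF iQ] show ?case
        by eventually_elim simp
    qed
  qed
  show ?thesis
    using eq
  proof eventually_elim
    case (elim s)
    show ?case
    proof (intro allI)
      fix i j
      define f where "f l t = (if l = j then frac_op_kernel (\<alpha> l) a c t s else 0)" for l t
      have f: "integrable lborel (f l)" for l
        unfolding f_def[abs_def] by (cases "l = j") (simp_all add: integrable_frac_op_kernel \<alpha>_pos)
      have "AE x in idx_lborel. z (fst x) j (snd x) s = f (fst x) (snd x) + volt (\<lambda>l \<tau>. z l j \<tau> s) (fst x) (snd x)"
        unfolding AE_idx_iff fst_conv snd_conv f_def using elim by blast
      with AE_kop_Gen[of "\<lambda>l t. z l j t s", OF iz]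
      have zeq: "AE x in idx_lborel. z (fst x) j (snd x) s = f (fst x) (snd x) + kop idx_lborel Gen (\<lambda>y. z (fst y) j (snd y) s) x"
        by eventually_elim simp
      have "AE x in idx_lborel. z (fst x) j (snd x) s = f (fst x) (snd x) +
          kop idx_lborel (\<lambda>x y. Q (fst x) (fst y) (snd x) (snd y)) (\<lambda>y. f (fst y) (snd y)) x"
        by (rule sigma_finite_measure.kernel_resolvent[OF sigma_finite_idx kernel_idx[where X=gen, OF kernel_gen]
              kernel_idx[where X=Q, OF kQ] weight_measurable weight_bounds(1,2)[OF \<mu>(1)] weight_contraction[OF \<mu>] PQ _ _ zeq])
           (use iz f in \<open>simp_all add: integrable_idx_iff\<close>)
      with AE_kop_idx[where X=Q, OF kQ f]
      have "AE x in idx_lborel. z (fst x) j (snd x) s = f (fst x) (snd x) + (\<Sum>l\<in>UNIV. kop lborel (Q (fst x) l) (f l) (snd x))"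
        by eventually_elim simp
      then have "AE t in lborel. z i j t s = f i t + (\<Sum>l\<in>UNIV. kop lborel (Q i l) (f l) t)"
        by (simp add: AE_idx_iff)
      moreover have "(\<Sum>l\<in>UNIV. kop lborel (Q i l) (f l) t) = kop lborel (Q i j) (\<lambda>\<tau>. frac_op_kernel (\<alpha> j) a c \<tau> s) t" for t
      proof -
        have "kop lborel (Q i l) (f l) t = (if l = j then kop lborel (Q i j) (\<lambda>\<tau>. frac_op_kernel (\<alpha> j) a c \<tau> s) t else 0)" for l
          by (simp add: kop_def f_def)
        then show ?thesis by simp
      qed
      ultimately show "AE t in lborel. z i j t s = (if i = j then frac_op_kernel (\<alpha> i) a c t s else 0)
         + kop lborel (\<lambda>t \<tau>. \<Sum>p\<in>UNIV. z i p t \<tau> * B p j \<tau>) (\<lambda>\<tau>. frac_op_kernel (\<alpha> j) a c \<tau> s) t"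
        by (simp add: f_def Q_def[abs_def])
    qed
  qed
qed

end

section \<open>The state-transition matrix in its second variable\<close>

lemma left_solution_equation:
  fixes Y :: "real \<Rightarrow> real ^ 'm ^ 'm"
  assumes \<alpha>: "\<And>i. 0 < \<alpha> $ i \<and> \<alpha> $ i \<le> 1" and J: "J \<in> sets lebesgue" "{s..c} \<subseteq> J" "s \<le> c"
    and sol: "left_solution A (row_constant \<alpha>) s J Y"
  shows "(\<lambda>t. Y t $ i $ j) absolutely_integrable_on {s..c}"
    "AE t\<in>{s..c} in lborel. Y t $ i $ j =
       (if i = j then 1 else 0) * frac_kernel (\<alpha> $ i) (t - s) + frac_int (\<alpha> $ i) s (\<lambda>t. (A t ** Y t) $ i $ j) t"
proof -
  have AC: "left_AC (\<alpha> $ i) s J (\<lambda>t. Y t $ i $ j)"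
    using sol by (simp add: left_solution_def row_constant_def)
  have "AE t in lebesgue_on J. (\<chi> i j. left_RL_deriv (\<alpha> $ i) s J (\<lambda>t. Y t $ i $ j) t) = A t ** Y t"
    using sol by (simp add: left_solution_def row_constant_def)
  then have D: "AE t in lebesgue_on J. left_RL_deriv (\<alpha> $ i) s J (\<lambda>t. Y t $ i $ j) t = (A t ** Y t) $ i $ j"
  proof eventually_elim
    case (elim t)
    then have "(\<chi> i j. left_RL_deriv (\<alpha> $ i) s J (\<lambda>t. Y t $ i $ j) t) $ i $ j = (A t ** Y t) $ i $ j" by simp
    then show ?case by simp
  qed
  have "(\<chi> i j. left_RL_integral (1 - \<alpha> $ i) s J (\<lambda>t. Y t $ i $ j) s) = mat 1"
    using sol by (simp add: left_solution_def row_constant_def)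
  then have "(\<chi> i j. left_RL_integral (1 - \<alpha> $ i) s J (\<lambda>t. Y t $ i $ j) s) $ i $ j = mat 1 $ i $ j"
    by simp
  then have d: "left_RL_integral (1 - \<alpha> $ i) s J (\<lambda>t. Y t $ i $ j) s = (if i = j then 1 else 0)"
    by (simp add: mat_def)
  note L = left_RL_integral_equation[OF conjunct1[OF \<alpha>] conjunct2[OF \<alpha>] J AC D d]
  show "(\<lambda>t. Y t $ i $ j) absolutely_integrable_on {s..c}" by (rule L(1))
  show "AE t\<in>{s..c} in lborel. Y t $ i $ j =
       (if i = j then 1 else 0) * frac_kernel (\<alpha> $ i) (t - s) + frac_int (\<alpha> $ i) s (\<lambda>t. (A t ** Y t) $ i $ j) t"
    by (rule L(3))
qed

lemma left_solution_of_equation: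
  fixes Y :: "real \<Rightarrow> real ^ 'm ^ 'm"
  assumes \<alpha>: "\<And>i. 0 < \<alpha> $ i \<and> \<alpha> $ i \<le> 1" and "s < c"
    and Y: "\<And>i j. (\<lambda>t. Y t $ i $ j) absolutely_integrable_on {s..c}"
    and AY: "\<And>i j. (\<lambda>t. (A t ** Y t) $ i $ j) absolutely_integrable_on {s..c}"
    and eq: "\<And>i j. AE t\<in>{s..c} in lborel. Y t $ i $ j =
       (if i = j then 1 else 0) * frac_kernel (\<alpha> $ i) (t - s) + frac_int (\<alpha> $ i) s (\<lambda>t. (A t ** Y t) $ i $ j) t"
  shows "left_solution A (row_constant \<alpha>) s {s..c} Y"
proof -
  note L = left_RL_of_integral_equation[OF conjunct1[OF \<alpha>] conjunct2[OF \<alpha>] \<open>s < c\<close> Y AY eq]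
  have "AE t in lebesgue_on {s..c}. \<forall>i j. left_RL_deriv (\<alpha> $ i) s {s..c} (\<lambda>t. Y t $ i $ j) t = (A t ** Y t) $ i $ j"
    using L(2) by (simp only: AE_all_countable) simp
  then have "AE t in lebesgue_on {s..c}. (\<chi> i j. left_RL_deriv (\<alpha> $ i) s {s..c} (\<lambda>t. Y t $ i $ j) t) = A t ** Y t"
    by eventually_elim (simp add: vec_eq_iff)
  then show ?thesis
    unfolding left_solution_def row_constant_def using L(1,3) by (simp add: vec_eq_iff mat_def)
qed

context volterra_system
begin

text \<open>Moves the problem with base point \<open>s\<close> to the fixed interval
  \<open>{a..c}\<close>: as \<open>z\<close> vanishes before \<open>s\<close>, the cut-off at
  \<open>s\<close> may be replaced by the one at \<open>a\<close>. All columns then satisfy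
  equations with the same kernel and differ only in the source term.\<close>

lemma volterra_column:
  fixes Y A :: "real \<Rightarrow> real ^ 'm ^ 'm"
  assumes s: "s \<in> {a..c}"
    and BA: "\<And>i l. AE x\<in>{s..c} in lborel. B i l x = A x $ i $ l"
    and z: "\<And>i. integrable lborel (z i)" "\<And>i x. x \<notin> {s..c} \<Longrightarrow> z i x = 0"
      "\<And>i. AE x\<in>{s..c} in lborel. z i x = Y x $ i $ j"
  shows "(\<lambda>t. (A t ** Y t) $ i $ j) absolutely_integrable_on {s..c}"
    and "(AE t\<in>{s..c} in lborel. Y t $ i $ j = d * frac_kernel (\<alpha> i) (t - s) + frac_int (\<alpha> i) s (\<lambda>t. (A t ** Y t) $ i $ j) t)
      \<longleftrightarrow> (AE t in lborel. z i t = d * frac_op_kernel (\<alpha> i) a c t s + volt z i t)"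
proof -
  define g where "g t = (\<Sum>l\<in>UNIV. B i l t * z l t)" for t
  have g: "integrable lborel g" unfolding g_def[abs_def]
    by (intro Bochner_Integration.integrable_sum integrable_B_mult z)
  have "AE x in lborel. \<forall>l. x \<in> {s..c} \<longrightarrow> B i l x = A x $ i $ l" using BA
    by (simp only: AE_all_countable) simp
  moreover have "AE x in lborel. \<forall>l. x \<in> {s..c} \<longrightarrow> z l x = Y x $ l $ j" using z(3)
    by (simp only: AE_all_countable) simp
  ultimately have gA: "AE x\<in>{s..c} in lborel. g x = (A x ** Y x) $ i $ j"
    by eventually_elim (simp add: g_def matrix_matrix_mult_def)
  have "set_integrable lborel {s..c} g"
    unfolding set_integrable_def by (intro integrable_mult_indicator g) simp
  then show AY: "(\<lambda>t. (A t ** Y t) $ i $ j) absolutely_integrable_on {s..c}"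
    using gA by (rule absolutely_integrable_of_borel_version)
  have v: "frac_int (\<alpha> i) s (\<lambda>t. (A t ** Y t) $ i $ j) t = volt z i t" if t: "t \<in> {s..c}" for t
  proof -
    have "frac_int (\<alpha> i) s (\<lambda>t. (A t ** Y t) $ i $ j) t = kop lborel (frac_op_kernel (\<alpha> i) s c) g t"
      by (rule frac_int_eq_kop[OF AY g gA t])
    also have "\<dots> = volt z i t"
      unfolding kop_def using s z(2)
      by (intro Bochner_Integration.integral_cong) (auto simp: frac_op_kernel_def g_def)
    finally show ?thesis .
  qed
  have v0: "volt z i t = 0" if t: "t \<notin> {s..c}" for t
  proof -
    have "frac_op_kernel (\<alpha> i) a c t \<tau> * (\<Sum>l\<in>UNIV. B i l \<tau> * z l \<tau>) = 0" for \<tau>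
    proof (cases "\<tau> < s")
      case True
      then show ?thesis using z(2) by simp
    next
      case False
      then show ?thesis using t by (auto simp: frac_op_kernel_def frac_kernel_def)
    qed
    then show ?thesis by (simp only: kop_def Bochner_Integration.integral_zero)
  qed
  show "(AE t\<in>{s..c} in lborel. Y t $ i $ j = d * frac_kernel (\<alpha> i) (t - s) + frac_int (\<alpha> i) s (\<lambda>t. (A t ** Y t) $ i $ j) t)
      \<longleftrightarrow> (AE t in lborel. z i t = d * frac_op_kernel (\<alpha> i) a c t s + volt z i t)"
  proof (rule eventually_subst, use z(3)[of i] in eventually_elim)
    case (elim t)
    show ?case
    proof (cases "t \<in> {s..c}")
      case True
      then have "frac_op_kernel (\<alpha> i) a c t s = frac_kernel (\<alpha> i) (t - s)" using s
        by (simp add: frac_op_kernel_def)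
      then show ?thesis using elim True v[OF True] by simp
    next
      case False
      then have "frac_op_kernel (\<alpha> i) a c t s = 0"
        by (auto simp: frac_op_kernel_def frac_kernel_def)
      then have "z i t = d * frac_op_kernel (\<alpha> i) a c t s + volt z i t"
        using v0[OF False] z(2)[OF False] by simp
      then show ?thesis using False by blast
    qed
  qed
qed

lemma left_solution_unique:
  fixes Y Y' A :: "real \<Rightarrow> real ^ 'm ^ 'm"
  assumes "a < c" and \<alpha>': "\<And>i. \<alpha>' $ i = \<alpha> i" "\<And>i. \<alpha> i \<le> 1"
    and BA: "\<And>i l. AE x\<in>{a..c} in lborel. B i l x = A x $ i $ l"
    and Y: "left_solution A (row_constant \<alpha>') a {a..c} Y"
      and Y': "left_solution A (row_constant \<alpha>') a {a..c} Y'"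
  shows "AE x\<in>{a..c} in lborel. Y x = Y' x"
proof -
  have \<alpha>1: "0 < \<alpha>' $ i \<and> \<alpha>' $ i \<le> 1" for i using \<alpha>' \<alpha>_pos by simp
  have a: "a \<in> {a..c}" "a \<le> c" using \<open>a < c\<close> by auto
  have col: "\<exists>z. (\<forall>i. integrable lborel (z i)) \<and> (\<forall>i. AE x\<in>{a..c} in lborel. z i x = Y x $ i $ j) \<and>
      (\<forall>i. AE t in lborel. z i t = (if i = j then 1 else 0) * frac_op_kernel (\<alpha> i) a c t a + volt z i t)"
    if Y: "left_solution A (row_constant \<alpha>') a {a..c} Y" for Y j
  proof -
    have "{a..c} \<in> sets lebesgue" by simp
    note L = left_solution_equation[OF \<alpha>1 this subset_refl a(2) Y]
    have "\<forall>i. \<exists>z. integrable lborel z \<and> (\<forall>x. x \<notin> {a..c} \<longrightarrow> z x = 0) \<and> (AE x\<in>{a..c} in lborel. z x = Y x $ i $ j)"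
    proof
      fix i
      show "\<exists>z. integrable lborel z \<and> (\<forall>x. x \<notin> {a..c} \<longrightarrow> z x = 0) \<and> (AE x\<in>{a..c} in lborel. z x = Y x $ i $ j)"
        by (rule absolutely_integrable_borel_version[OF L(1)[of i j]]) (intro exI conjI allI impI, assumption, assumption+)
    qed
    from choice[OF this] obtain z where z: "\<And>i. integrable lborel (z i)" "\<And>i x. x \<notin> {a..c} \<Longrightarrow> z i x = 0"
      "\<And>i. AE x\<in>{a..c} in lborel. z i x = Y x $ i $ j" by blast
    have "AE t in lborel. z i t = (if i = j then 1 else 0) * frac_op_kernel (\<alpha> i) a c t a + volt z i t" for i
      using L(2)[of i j] volterra_column(2)[OF a(1) BA z, of i "if i = j then 1 else 0"]
        by (simp add: \<alpha>')
    then show ?thesis using z by blast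
  qed
  have "AE x\<in>{a..c} in lborel. Y x $ i $ j = Y' x $ i $ j" for i j
  proof -
    from col[OF Y, of j]
    obtain z where z: "\<And>i. integrable lborel (z i)" "\<And>i. AE x\<in>{a..c} in lborel. z i x = Y x $ i $ j"
      "\<And>i. AE t in lborel. z i t = (if i = j then 1 else 0) * frac_op_kernel (\<alpha> i) a c t a + volt z i t"
      by blast
    from col[OF Y', of j]
    obtain z' where z': "\<And>i. integrable lborel (z' i)" "\<And>i. AE x\<in>{a..c} in lborel. z' i x = Y' x $ i $ j"
      "\<And>i. AE t in lborel. z' i t = (if i = j then 1 else 0) * frac_op_kernel (\<alpha> i) a c t a + volt z' i t"
      by blast
    have "AE t in lborel. z i t - z' i t = 0"
    proof (rule volterra_unique[OF a(2), where z="\<lambda>i t. z i t - z' i t" and i=i])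
      show "integrable lborel (\<lambda>t. z i t - z' i t)" for i using z(1) z'(1) by auto
      fix i
      have "integrable lborel (\<lambda>\<tau>. \<Sum>l\<in>UNIV. B i l \<tau> * z l \<tau>)" "integrable lborel (\<lambda>\<tau>. \<Sum>l\<in>UNIV. B i l \<tau> * z' l \<tau>)"
        by (intro Bochner_Integration.integrable_sum integrable_B_mult z z')+
      from lborel.AE_kop_diff[OF frac_op_kernel_kernel[OF \<alpha>_pos] this, of i a c] z(3)[of i] z'(3)[of i]
      show "AE t in lborel. z i t - z' i t = volt (\<lambda>i t. z i t - z' i t) i t"
        by eventually_elim (simp add: right_diff_distrib sum_subtractf)
    qed
    with z(2)[of i] z'(2)[of i] show ?thesis by eventually_elim auto
  qed
  then have "AE x in lborel. \<forall>i j. x \<in> {a..c} \<longrightarrow> Y x $ i $ j = Y' x $ i $ j"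
    by (simp only: AE_all_countable) simp
  then show ?thesis by eventually_elim (simp add: vec_eq_iff)
qed

end

section \<open>Borel versions and bounds uniform over the columns\<close>

lemma bounded_borel_version:
  fixes q :: "real \<Rightarrow> real"
  assumes q: "q \<in> borel_measurable (lebesgue_on {a..c})"
    and b: "AE t in lebesgue_on {a..c}. \<bar>q t\<bar> \<le> C"
  obtains q' where "q' \<in> borel_measurable borel" "\<And>x. \<bar>q' x\<bar> \<le> \<bar>C\<bar>" "AE x\<in>{a..c} in lborel. q' x = q x"
proof -
  have "(\<lambda>x. indicator {a..c} x *\<^sub>R q x) \<in> borel_measurable lebesgue"
    using q by (subst (asm) borel_measurable_restrict_space_iff) auto
  from completion_ex_borel_measurable_real[OF this] obtain r where r: "r \<in> borel_measurable borel"
    "AE x in lborel. indicator {a..c} x *\<^sub>R q x = r x" by auto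
  have b': "AE x\<in>{a..c} in lborel. \<bar>q x\<bar> \<le> C" using b by (simp add: AE_lebesgue_on_iff)
  show ?thesis
  \<comment> \<open>Clipping turns the essential bound into one at every point. The absolute value
    keeps the clipping interval nonempty even if \<open>C\<close> is negative.\<close>
  proof (rule that[of "\<lambda>x. max (- \<bar>C\<bar>) (min \<bar>C\<bar> (r x))"])
    show "(\<lambda>x. max (- \<bar>C\<bar>) (min \<bar>C\<bar> (r x))) \<in> borel_measurable borel" using r(1) by measurable
    show "AE x\<in>{a..c} in lborel. max (- \<bar>C\<bar>) (min \<bar>C\<bar> (r x)) = q x"
      using r(2) b' by eventually_elim auto
  qed auto
qed

text \<open>\<open>P\<close> need not be measurable, so Fubini is applied to a Borel null set that
  contains all exceptions.\<close>

lemma AE_lborel_pair_swap: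
  fixes P :: "real \<Rightarrow> real \<Rightarrow> bool"
  assumes "AE p in (lborel :: (real \<times> real) measure). P (fst p) (snd p)"
  shows "AE t in lborel. AE s in lborel. P t s" "AE s in lborel. AE t in lborel. P t s"
proof -
  obtain N where N: "\<And>p. p \<in> space lborel - N \<Longrightarrow> P (fst p) (snd p)" "N \<in> null_sets (lborel :: (real \<times> real) measure)"
    using AE_E3[OF assms] by metis
  have m: "{x \<in> space (lborel \<Otimes>\<^sub>M lborel). (fst x, snd x) \<notin> N} \<in> sets (lborel \<Otimes>\<^sub>M lborel)"
  proof -
    have "{x \<in> space (lborel \<Otimes>\<^sub>M lborel). (fst x, snd x) \<notin> N} = - N" by (auto simp: lborel_prod)
    moreover have "sets (lborel \<Otimes>\<^sub>M lborel) = sets (borel :: (real \<times> real) measure)"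
      using sets_pair_measure_cong[OF sets_lborel sets_lborel] by (simp only: borel_prod)
    moreover have "- N \<in> sets borel" using N(2) by (simp add: null_sets_def borel_comp)
    ultimately show ?thesis by (simp only:)
  qed
  have "AE p in lborel \<Otimes>\<^sub>M lborel. p \<notin> N" unfolding lborel_prod by (rule AE_not_in[OF N(2)])
  from lborel_pair.AE_pair[OF this] have 1: "AE t in lborel. AE s in lborel. (t, s) \<notin> N" by simp
  then have 2: "AE s in lborel. AE t in lborel. (t, s) \<notin> N"
    using lborel_pair.AE_commute[of "\<lambda>t s. (t, s) \<notin> N", OF m] by simp
  have P: "P t s" if "(t, s) \<notin> N" for t s using N(1)[of "(t, s)"] that by simp
  show "AE t in lborel. AE s in lborel. P t s"
    using 1 by eventually_elim (auto elim!: eventually_mono intro: P)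
  show "AE s in lborel. AE t in lborel. P t s"
    using 2 by eventually_elim (auto elim!: eventually_mono intro: P)
qed

text \<open>The null set \<open>N\<close> contains the \<open>s\<close> whose column \<open>Z(\<cdot>, s)\<close> differs from the Borel version on a set
  of positive measure; the version is set to \<open>0\<close> there, so that every column can be bounded.\<close>

lemma joint_borel_version:
  fixes Z :: "real \<Rightarrow> real \<Rightarrow> real ^ 'm ^ 'm"
  assumes m: "\<And>i j. (\<lambda>(t, s). Z t s $ i $ j) \<in> borel_measurable (lebesgue_on S)"
    and T: "T \<subseteq> S" "T \<in> sets borel"
  obtains N z where "N \<in> null_sets lborel"
    "\<And>i j. (\<lambda>(t, s). z i j t s) \<in> borel_measurable borel"
    "\<And>i j t s. (t, s) \<notin> T \<or> s \<in> N \<Longrightarrow> z i j t s = 0"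
    "AE t in lborel. AE s in lborel. (t, s) \<in> T \<longrightarrow> (\<forall>i j. z i j t s = Z t s $ i $ j)"
    "\<And>s. s \<notin> N \<Longrightarrow> AE t in lborel. (t, s) \<in> T \<longrightarrow> (\<forall>i j. z i j t s = Z t s $ i $ j)"
proof -
  define V where "V i j f \<longleftrightarrow> (AE p in lborel. indicator T p *\<^sub>R (case p of (t, s) \<Rightarrow> Z t s $ i $ j) = f p)" for i j f
  have "\<exists>f\<in>borel_measurable lborel. V i j f" for i j
    unfolding V_def
  proof (rule completion_ex_borel_measurable_real)
    have "(\<lambda>(t, s). Z t s $ i $ j) \<in> borel_measurable (lebesgue_on T)"
      using m T(1) by (rule measurable_restrict_mono)
    then show "(\<lambda>p. indicator T p *\<^sub>R (case p of (t, s) \<Rightarrow> Z t s $ i $ j)) \<in> borel_measurable lebesgue"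
      using T(2) by (subst (asm) borel_measurable_restrict_space_iff) auto
  qed
  then obtain f where f1: "\<And>i j. f i j \<in> borel_measurable lborel" and f2: "\<And>i j. V i j (f i j)"
    by metis
  note f = f1 f2[unfolded V_def]
  have "AE p in lborel. \<forall>i j. indicator T p *\<^sub>R (case p of (t, s) \<Rightarrow> Z t s $ i $ j) = f i j p"
    using f(2) by (simp only: AE_all_countable) simp
  then have "AE p in lborel. p \<in> T \<longrightarrow> (\<forall>i j. f i j p = (case p of (t, s) \<Rightarrow> Z t s $ i $ j))"
    by eventually_elim (auto split: prod.splits)
  then have ae: "AE p in lborel. (fst p, snd p) \<in> T \<longrightarrow> (\<forall>i j. f i j (fst p, snd p) = Z (fst p) (snd p) $ i $ j)"
    by eventually_elim (auto split: prod.splits)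
  note sw = AE_lborel_pair_swap[where P="\<lambda>t s. (t, s) \<in> T \<longrightarrow> (\<forall>i j. f i j (t, s) = Z t s $ i $ j)", OF ae]
  from AE_E3[OF sw(2)] obtain N where N: "\<And>s. s \<in> space lborel - N \<Longrightarrow> AE t in lborel. (t, s) \<in> T \<longrightarrow> (\<forall>i j. f i j (t, s) = Z t s $ i $ j)"
    "N \<in> null_sets (lborel :: real measure)"
    by blast
  define z where "z i j t s = indicator T (t, s) * indicator (- N) s * f i j (t, s)" for i j t s
  show ?thesis
  proof (rule that[OF N(2), of z])
    have [measurable]: "N \<in> sets borel" using N(2) by (simp add: null_sets_def)
    have [measurable]: "f i j \<in> borel_measurable (borel \<Otimes>\<^sub>M borel)" for i j
      unfolding borel_prod using f(1)[of i j] by simp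
    have [measurable]: "T \<in> sets (borel \<Otimes>\<^sub>M borel)" unfolding borel_prod by (rule T(2))
    have "(\<lambda>p. indicator T p * indicator (- N) (snd p) * f i j p) \<in> borel_measurable (borel \<Otimes>\<^sub>M borel)" for i j
      by measurable
    then show "(\<lambda>(t, s). z i j t s) \<in> borel_measurable borel" for i j
      unfolding z_def borel_prod case_prod_beta' prod.collapse .
    show "z i j t s = 0" if "(t, s) \<notin> T \<or> s \<in> N" for i j t s
      using that by (auto simp: z_def)
    show "AE t in lborel. AE s in lborel. (t, s) \<in> T \<longrightarrow> (\<forall>i j. z i j t s = Z t s $ i $ j)"
      using sw(1)
    proof eventually_elim
      case (elim t)
      then show ?case using AE_not_in[OF N(2)] by eventually_elim (auto simp: z_def)
    qed
    show "AE t in lborel. (t, s) \<in> T \<longrightarrow> (\<forall>i j. z i j t s = Z t s $ i $ j)" if "s \<notin> N" for s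
      using N(1)[of s] that by (auto elim!: eventually_mono simp: z_def)
  qed
qed

text \<open>The a priori constant does not depend on \<open>s\<close>, and the columns of the
  fractional kernels are bounded uniformly in \<open>s\<close>; this gives the uniform bound that
  separate integrability of the columns does not. The first alternative covers the columns that were
  set to 0.\<close>

lemma (in volterra_system) kernel_of_columns:
  assumes "a \<le> c" and m: "\<And>i j. case_prod (z i j) \<in> borel_measurable (lborel \<Otimes>\<^sub>M lborel)"
    and z: "\<And>s. (\<forall>i j. AE t in lborel. z i j t s = 0) \<or>
      ((\<forall>i j. integrable lborel (\<lambda>t. z i j t s)) \<and> (\<forall>i j. AE t in lborel. z i j t s =
        (if i = j then 1 else 0) * frac_op_kernel (\<alpha> i) a c t s + volt (\<lambda>l \<tau>. z l j \<tau> s) i t))"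
  shows "kernel lborel (z i j)"
proof -
  from volterra_bound[OF assms(1)] obtain K where K: "\<And>z f. volterra_solution f z \<Longrightarrow>
    (\<Sum>i\<in>UNIV. \<integral>\<^sup>+t. ennreal \<bar>z i t\<bar> \<partial>lborel) \<le> ennreal K * (\<Sum>i\<in>UNIV. \<integral>\<^sup>+t. ennreal \<bar>f i t\<bar> \<partial>lborel)"
    by blast
  have "\<forall>i. \<exists>D. \<forall>s. (\<integral>\<^sup>+t. ennreal \<bar>frac_op_kernel (\<alpha> i) a c t s\<bar> \<partial>lborel) \<le> ennreal D"
    using frac_op_kernel_kernel[OF \<alpha>_pos] unfolding kernel_def by auto
  then obtain D where D: "\<And>i s. (\<integral>\<^sup>+t. ennreal \<bar>frac_op_kernel (\<alpha> i) a c t s\<bar> \<partial>lborel) \<le> ennreal (D i)"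
    by metis
  define E where "E = max 0 K * (\<Sum>i\<in>UNIV. max 0 (D i))"
  have "(\<integral>\<^sup>+t. ennreal \<bar>z i j t s\<bar> \<partial>lborel) \<le> ennreal E" for s
    using z[of s]
  proof
    assume 0: "\<forall>i j. AE t in lborel. z i j t s = 0"
    have "(\<integral>\<^sup>+t. ennreal \<bar>z i j t s\<bar> \<partial>lborel) = (\<integral>\<^sup>+(t::real). 0 \<partial>lborel)"
      using 0[rule_format, of i j] by (intro nn_integral_cong_AE) (auto elim!: eventually_mono)
    then show ?thesis by simp
  next
    assume *: "(\<forall>i j. integrable lborel (\<lambda>t. z i j t s)) \<and> (\<forall>i j. AE t in lborel. z i j t s =
        (if i = j then 1 else 0) * frac_op_kernel (\<alpha> i) a c t s + volt (\<lambda>l \<tau>. z l j \<tau> s) i t)"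
    have "(\<integral>\<^sup>+t. ennreal \<bar>z i j t s\<bar> \<partial>lborel) \<le> (\<Sum>i\<in>UNIV. \<integral>\<^sup>+t. ennreal \<bar>z i j t s\<bar> \<partial>lborel)"
      by (rule member_le_sum) auto
    also have "\<dots> \<le> ennreal K * (\<Sum>i\<in>UNIV. \<integral>\<^sup>+t. ennreal \<bar>(if i = j then 1 else 0) * frac_op_kernel (\<alpha> i) a c t s\<bar> \<partial>lborel)"
      by (rule K[of "\<lambda>i t. (if i = j then 1 else 0) * frac_op_kernel (\<alpha> i) a c t s" "\<lambda>i t. z i j t s"])
         (use * in \<open>auto simp: volterra_solution_def intro!: integrable_mult_right integrable_frac_op_kernel \<alpha>_pos\<close>)
    also have "\<dots> \<le> ennreal (max 0 K) * (\<Sum>i\<in>UNIV. ennreal (max 0 (D i)))"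
    proof (intro mult_mono sum_mono)
      fix i
      have "(\<integral>\<^sup>+t. ennreal \<bar>(if i = j then 1 else 0) * frac_op_kernel (\<alpha> i) a c t s\<bar> \<partial>lborel) \<le> (\<integral>\<^sup>+t. ennreal \<bar>frac_op_kernel (\<alpha> i) a c t s\<bar> \<partial>lborel)"
        by (intro nn_integral_mono) auto
      also have "\<dots> \<le> ennreal (max 0 (D i))" by (rule order_trans[OF D ennreal_leI]) simp
      finally show "(\<integral>\<^sup>+t. ennreal \<bar>(if i = j then 1 else 0) * frac_op_kernel (\<alpha> i) a c t s\<bar> \<partial>lborel) \<le> ennreal (max 0 (D i))" .
    qed (auto intro: ennreal_leI)
    also have "\<dots> = ennreal E" by (simp add: E_def ennreal_mult sum_nonneg)
    finally show ?thesis .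
  qed
  then show ?thesis unfolding kernel_def using m by auto
qed

text \<open>The interval does not occur in the locale assumptions, so the reflected coefficients can
  be used on \<open>{- t..- a}\<close> for each \<open>t\<close>.\<close>

lemma (in volterra_system) reflect:
  "volterra_system \<alpha> (\<lambda>i l x. B l i (- x)) C"
  by unfold_locales (use \<alpha>_pos B_bound in \<open>auto\<close>)

section \<open>The right problem for almost every row\<close>

lemma interval_subset:
  fixes I :: "real set"
  assumes "I \<in> intervals_from a" "c \<in> I"
  shows "a \<in> I" "{a..c} \<subseteq> I" "I \<in> sets borel"
proof -
  have I: "is_interval I" using assms by (simp add: intervals_from_def)
  show a: "a \<in> I" using assms by (auto simp: intervals_from_def)
  show "{a..c} \<subseteq> I"
  proof
    fix x assume "x \<in> {a..c}"
    then show "x \<in> I" using mem_is_interval_1_I[OF I a assms(2), of x] by simp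
  qed
  show "I \<in> sets borel" by (rule real_interval_borel_measurable[OF I])
qed

text \<open>\<open>A\<close> has a global bound only on compact intervals, so a single contraction
  rate is available on each \<open>{a..c}\<close> but in general not on \<open>I\<close>.\<close>

lemma right_solution_on_compact:
  fixes A :: "real \<Rightarrow> real ^ 'm ^ 'm" and Z :: "real \<Rightarrow> real \<Rightarrow> real ^ 'm ^ 'm"
  assumes I: "I \<in> intervals_from a"
    and A: "\<And>i j. Linf_loc I (\<lambda>t. A t $ i $ j)"
    and \<alpha>: "\<And>i. 0 < \<alpha> $ i \<and> \<alpha> $ i \<le> 1"
    and Z: "state_transition_matrix I A (row_constant \<alpha>) Z"
    and c: "c \<in> I" "a < c"
  shows "AE t in lborel. t \<in> {a<..c} \<longrightarrow>
    right_solution A (column_constant \<alpha>) t {a..t} (Z t) \<and>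
    (\<forall>Y. right_solution A (column_constant \<alpha>) t {a..t} Y \<longrightarrow>
       (AE s in lebesgue_on {a..t}. Y s = Z t s))"
proof -
  note sub = interval_subset[OF I c(1)]
  \<comment> \<open>On this triangle the Borel version of \<open>Z\<close> has the same support as
    the cut-off kernels, which removes all case distinctions at the boundary from the integral
    equations.\<close>
  define T where "T = {(t, s). a \<le> s \<and> s < t \<and> t \<le> c}"

  define V where "V i l B C \<longleftrightarrow> B \<in> borel_measurable borel \<and> (\<forall>x. \<bar>B x\<bar> \<le> C) \<and> (AE x\<in>{a..c} in lborel. B x = A x $ i $ l)" for i l B C
  have "\<exists>B C. V i l B C" for i l
  proof -
    have "(\<lambda>t. A t $ i $ l) \<in> borel_measurable (lebesgue_on {a..c})"
      "\<exists>C. AE t in lebesgue_on {a..c}. \<bar>A t $ i $ l\<bar> \<le> C"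
      using A[of i l] sub(2) unfolding Linf_loc_def by blast+
    then obtain C where "(\<lambda>t. A t $ i $ l) \<in> borel_measurable (lebesgue_on {a..c})" "AE t in lebesgue_on {a..c}. \<bar>A t $ i $ l\<bar> \<le> C"
      by blast
    from bounded_borel_version[OF this] obtain b
      where "b \<in> borel_measurable borel" "\<And>x. \<bar>b x\<bar> \<le> \<bar>C\<bar>"
      "AE x\<in>{a..c} in lborel. b x = A x $ i $ l" by blast
    then have "V i l b \<bar>C\<bar>" by (simp add: V_def)
    then show ?thesis by blast
  qed
  then obtain B C where "\<And>i l. V i l (B i l) (C i l)" by metis
  then have B: "\<And>i l. B i l \<in> borel_measurable borel" "\<And>i l x. \<bar>B i l x\<bar> \<le> C i l"
    "\<And>i l. AE x\<in>{a..c} in lborel. B i l x = A x $ i $ l" by (auto simp: V_def)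
  \<comment> \<open>Adding up the bounds of all entries gives one bound for the whole
    matrix.\<close>
  define D where "D = (\<Sum>i\<in>UNIV. \<Sum>l\<in>UNIV. C i l)"
  have Cnn: "0 \<le> C i l" for i l using B(2)[of i l 0] by linarith
  have BD: "\<bar>B i l x\<bar> \<le> D" for i l x
  proof -
    have "C i l \<le> (\<Sum>l\<in>UNIV. C i l)" by (rule member_le_sum) (auto simp: Cnn)
    also have "\<dots> \<le> D" unfolding D_def
      by (rule member_le_sum[where f="\<lambda>i. \<Sum>l\<in>UNIV. C i l"]) (auto simp: Cnn intro: sum_nonneg)
    finally show ?thesis using B(2)[of i l x] by linarith
  qed
  interpret L: volterra_system "\<lambda>i. \<alpha> $ i" B a c D
    by unfold_locales (use \<alpha> B(1) BD in auto)

  have T: "T \<in> sets borel"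
  proof -
    have "T = {p. a \<le> snd p} \<inter> {p. snd p < fst p} \<inter> {p. fst p \<le> c}" by (auto simp: T_def)
    also have "\<dots> \<in> sets borel"
      by (intro sets.Int borel_closed borel_open closed_Collect_le open_Collect_less continuous_intros)
    finally show ?thesis .
  qed
  have TI: "T \<subseteq> {(t, s). t \<in> I \<and> s \<in> I \<and> s < t}" using sub(2) by (auto simp: T_def)
  have Zm: "(\<lambda>(t, s). Z t s $ i $ j) \<in> borel_measurable (lebesgue_on {(t, s). t \<in> I \<and> s \<in> I \<and> s < t})" for i j
    using Z by (simp add: state_transition_matrix_def)
  from joint_borel_version[OF Zm TI T]
  obtain N z where N: "N \<in> null_sets lborel"
    and zm: "\<And>i j. (\<lambda>(t, s). z i j t s) \<in> borel_measurable borel"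
    and z0: "\<And>i j t s. (t, s) \<notin> T \<or> s \<in> N \<Longrightarrow> z i j t s = 0"
    and zZ: "AE t in lborel. AE s in lborel. (t, s) \<in> T \<longrightarrow> (\<forall>i j. z i j t s = Z t s $ i $ j)"
    and zN: "\<And>s. s \<notin> N \<Longrightarrow> AE t in lborel. (t, s) \<in> T \<longrightarrow> (\<forall>i j. z i j t s = Z t s $ i $ j)"
    by blast
  have zm'[measurable]: "case_prod (z i j) \<in> borel_measurable (lborel \<Otimes>\<^sub>M lborel)" for i j
    using zm[of i j] unfolding lborel_prod by simp
  have zt[measurable]: "(\<lambda>t. z i j t s) \<in> borel_measurable borel" "(\<lambda>s. z i j t s) \<in> borel_measurable borel" for i j t s
    using measurable_Pair2[OF zm'[of i j], of s] measurable_Pair1[OF zm'[of i j], of t] by simp_all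

  have col: "(\<forall>i j. integrable lborel (\<lambda>t. z i j t s)) \<and> (\<forall>i j. AE t in lborel. z i j t s =
        (if i = j then 1 else 0) * frac_op_kernel (\<alpha> $ i) a c t s + L.volt (\<lambda>l \<tau>. z l j \<tau> s) i t)"
    if s: "s \<in> {a..<c}" "s \<notin> N" for s
  proof -
    have sI: "s \<in> I" "s < c" "s \<in> {a..c}" "{s..c} \<subseteq> {a..c}" using s sub(2) by auto
    have sol: "left_solution A (row_constant \<alpha>) s (I \<inter> {s..}) (\<lambda>t. Z t s)"
      using Z sI c(1) unfolding state_transition_matrix_def by blast
    have J: "I \<inter> {s..} \<in> sets lebesgue" "{s..c} \<subseteq> I \<inter> {s..}" "s \<le> c"
      using sub sI by auto
    note E = left_solution_equation[OF \<alpha> J sol]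
    have zs: "AE x\<in>{s..c} in lborel. z i j x s = Z x s $ i $ j" for i j
      using zN[OF s(2)] AE_lborel_singleton[of s] by eventually_elim (use s in \<open>auto simp: T_def\<close>)
    have zout: "z i j x s = 0" if "x \<notin> {s..c}" for i j x
      using z0[of x s] that by (auto simp: T_def)
    have int: "integrable lborel (\<lambda>t. z i j t s)" for i j
    proof -
      from absolutely_integrable_borel_version[OF E(1)[of i j]] obtain q where
        q: "integrable lborel q" "\<And>x. x \<notin> {s..c} \<Longrightarrow> q x = 0" "AE x\<in>{s..c} in lborel. q x = Z x s $ i $ j"
        by blast
      have "AE x in lborel. q x = z i j x s"
        using q(3) zs[of i j]
      proof eventually_elim
        case (elim x)
        then show ?case using q(2)[of x] zout[of x i j] by (cases "x \<in> {s..c}") simp_all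
      qed
      then show ?thesis using q(1) by (subst integrable_cong_AE[of _ _ q]) (auto elim!: eventually_mono)
    qed
    have BA: "AE x\<in>{s..c} in lborel. B i l x = A x $ i $ l" for i l
      using B(3)[of i l] by eventually_elim (use sI(4) in auto)
    have "AE t in lborel. z i j t s =
        (if i = j then 1 else 0) * frac_op_kernel (\<alpha> $ i) a c t s + L.volt (\<lambda>l \<tau>. z l j \<tau> s) i t" for i j
      using L.volterra_column(2)[OF sI(3) BA, of "\<lambda>l \<tau>. z l j \<tau> s" "\<lambda>t. Z t s" j i "if i = j then 1 else 0", OF int zout zs] E(2)[of i j]
      by simp
    then show ?thesis using int by blast
  qed
  have zker: "kernel lborel (z i j)" for i j
  proof (rule L.kernel_of_columns[OF less_imp_le[OF c(2)] zm'])
    fix s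
    show "(\<forall>i j. AE t in lborel. z i j t s = 0) \<or>
      ((\<forall>i j. integrable lborel (\<lambda>t. z i j t s)) \<and> (\<forall>i j. AE t in lborel. z i j t s =
        (if i = j then 1 else 0) * frac_op_kernel (\<alpha> $ i) a c t s + L.volt (\<lambda>l \<tau>. z l j \<tau> s) i t))"
    proof (cases "s \<in> {a..<c} \<and> s \<notin> N")
      case True
      then show ?thesis using col by blast
    next
      case False
      then have "z i j t s = 0" for i j t using z0[of t s] by (auto simp: T_def)
      then show ?thesis by simp
    qed
  qed
  \<comment> \<open>The entries of the composition of \<open>Z A\<close> with \<open>K\<close>, that
    is, the integral term of the right equation.\<close>
  define R where "R i j t s = kop lborel (\<lambda>t \<tau>. \<Sum>p\<in>UNIV. z i p t \<tau> * B p j \<tau>) (\<lambda>\<tau>. frac_op_kernel (\<alpha> $ j) a c \<tau> s) t" for i j t s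
  have "AE s in lborel. \<forall>i j. AE t in lborel. z i j t s =
      (if i = j then frac_op_kernel (\<alpha> $ i) a c t s else 0) + R i j t s"
    unfolding R_def
  proof (rule L.volterra_transposed[OF zker])
    show "AE s in lborel. \<forall>i j. AE t in lborel. z i j t s =
      (if i = j then frac_op_kernel (\<alpha> $ i) a c t s else 0) + L.volt (\<lambda>l \<tau>. z l j \<tau> s) i t"
      using AE_not_in[OF N]
    proof eventually_elim
      case (elim s)
      show ?case
      proof (cases "s \<in> {a..<c}")
        case True
        have k: "AE t in lborel. z i j t s =
          (if i = j then 1 else 0) * frac_op_kernel (\<alpha> $ i) a c t s + L.volt (\<lambda>l \<tau>. z l j \<tau> s) i t" for i j
          using col[OF True elim] by blast
        show ?thesis
        proof (intro allI)
          fix i j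
          show "AE t in lborel. z i j t s =
            (if i = j then frac_op_kernel (\<alpha> $ i) a c t s else 0) + L.volt (\<lambda>l \<tau>. z l j \<tau> s) i t"
            using k[of i j] by eventually_elim simp
        qed
      next
        case False
        then have "z i j t s = 0" "frac_op_kernel (\<alpha> $ i) a c t s = 0" for i j t
          using z0[of t s] by (auto simp: T_def frac_op_kernel_def frac_kernel_def)
        then show ?thesis by (simp add: kop_def)
      qed
    qed
  qed
  then have "AE s in lborel. AE t in lborel. \<forall>i j. z i j t s =
      (if i = j then frac_op_kernel (\<alpha> $ i) a c t s else 0) + R i j t s"
    by (simp only: AE_all_countable) simp
  \<comment> \<open>Exchanging \<open>s\<close> and \<open>t\<close> requires the set where the
    equation holds to be measurable in the product. For this reason the equation is stated for the
    Borel versions \<open>z\<close> and \<open>B\<close>, and not for \<open>Z\<close> and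
    \<open>A\<close>.\<close>
  moreover have "{x \<in> space (lborel \<Otimes>\<^sub>M lborel). \<forall>i j. z i j (fst x) (snd x) =
      (if i = j then frac_op_kernel (\<alpha> $ i) a c (fst x) (snd x) else 0) + R i j (fst x) (snd x)} \<in> sets (lborel \<Otimes>\<^sub>M lborel)"
  proof -
    have [measurable]: "B i l \<in> borel_measurable borel" for i l by (rule B(1))
    have "(\<lambda>x. R i j (fst x) (snd x)) \<in> borel_measurable (lborel \<Otimes>\<^sub>M lborel)" for i j
      unfolding R_def kop_def frac_op_kernel_def by measurable
    moreover have "(\<lambda>x. if i = j then frac_op_kernel (\<alpha> $ i) a c (fst x) (snd x) else 0) \<in> borel_measurable (lborel \<Otimes>\<^sub>M lborel)" for i j
      unfolding frac_op_kernel_def by measurable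
    ultimately show ?thesis by measurable
  qed
  ultimately have eqR: "AE t in lborel. AE s in lborel. \<forall>i j. z i j t s =
      (if i = j then frac_op_kernel (\<alpha> $ i) a c t s else 0) + R i j t s"
    by (subst lborel_pair.AE_commute)
  \<comment> \<open>Integrability of the rows is not among the hypotheses. A kernel acts on
    integrable functions, and acting on the indicator of \<open>{a..c}\<close> it makes almost every
    row integrable.\<close>
  have "integrable lborel (indicator {a..c} :: real \<Rightarrow> real)"
    by (rule integrable_real_indicator) (simp_all add: emeasure_lborel_Icc_eq)
  then have "AE t in lborel. \<forall>i j. integrable lborel (\<lambda>s. z i j t s * indicator {a..c} s)"
    using lborel.AE_kernel_integrable[OF zker] by (simp only: AE_all_countable) simp
  then have rowint: "AE t in lborel. \<forall>i j. integrable lborel (\<lambda>s. z i j t s)"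
  proof eventually_elim
    case (elim t)
    have e: "z i j t s * indicator {a..c} s = z i j t s" for i j s
    proof (cases "(t, s) \<in> T")
      case True
      then show ?thesis by (simp add: T_def)
    next
      case False
      then show ?thesis using z0[of t s i j] by simp
    qed
    show ?case using elim unfolding e .
  qed
  show ?thesis
    using zZ eqR rowint
  proof eventually_elim
    case (elim t)
    show ?case
    proof
      assume t: "t \<in> {a<..c}"
      define A' Y' where "A' x = transpose (A (- x))" and "Y' x = transpose (Z t (- x))" for x
      interpret V: volterra_system "\<lambda>i. \<alpha> $ i" "\<lambda>i l x. B l i (- x)" "- t" "- a" D
        by (rule L.reflect)
      have BA': "AE x\<in>{-t..-a} in lborel. B l i (- x) = A' x $ i $ l" for i l
        using AE_lborel_reflect[OF B(3)[of l i]]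
          by eventually_elim (use t in \<open>auto simp: A'_def transpose_def\<close>)
      \<comment> \<open>\<open>w i\<close> is row \<open>i\<close> of \<open>z\<close> at time
        \<open>t\<close>, run backwards; after transposition it represents column \<open>i\<close>
        of \<open>Y'\<close>.\<close>
      define w where "w i j x = z i j t (- x)" for i j x
      have wint: "integrable lborel (w i j)" for i j
        using lborel_integrable_real_affine[OF elim(3)[rule_format, of i j], of "-1" 0]
          by (simp add: w_def[abs_def])
      have w0: "w i j x = 0" if "x \<notin> {-t..-a}" for i j x
        using that z0[of t "- x" i j] by (auto simp: w_def T_def)
      have wY: "AE x\<in>{-t..-a} in lborel. w i j x = Y' x $ j $ i" for i j
        using AE_lborel_reflect[OF elim(1)] AE_lborel_singleton[of "- t"]
        by eventually_elim (use t in \<open>auto simp: w_def Y'_def transpose_def T_def\<close>)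
      have ta: "- t \<in> {-t..-a}" "- t < - a" using t by auto
      have vol: "V.volt (\<lambda>p. w i p) j (- s) = R i j t s" if "a \<le> s" for i j s
      proof -
        have "V.volt (\<lambda>p. w i p) j (- s) = (\<integral>\<xi>. frac_op_kernel (\<alpha> $ j) (- t) (- a) (- s) \<xi> * (\<Sum>p\<in>UNIV. B p j (- \<xi>) * w i p \<xi>) \<partial>lborel)"
          by (simp add: kop_def)
        also have "\<dots> = (\<integral>\<tau>. frac_op_kernel (\<alpha> $ j) (- t) (- a) (- s) (- \<tau>) * (\<Sum>p\<in>UNIV. B p j \<tau> * z i p t \<tau>) \<partial>lborel)"
          using lborel_integral_real_affine[of "-1" "\<lambda>\<xi>. frac_op_kernel (\<alpha> $ j) (- t) (- a) (- s) \<xi> * (\<Sum>p\<in>UNIV. B p j (- \<xi>) * w i p \<xi>)" 0]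
          by (simp add: w_def)
        also have "\<dots> = (\<integral>\<tau>. (\<Sum>p\<in>UNIV. z i p t \<tau> * B p j \<tau>) * frac_op_kernel (\<alpha> $ j) a c \<tau> s \<partial>lborel)"
        proof (rule Bochner_Integration.integral_cong)
          fix \<tau>
          show "frac_op_kernel (\<alpha> $ j) (- t) (- a) (- s) (- \<tau>) * (\<Sum>p\<in>UNIV. B p j \<tau> * z i p t \<tau>) =
             (\<Sum>p\<in>UNIV. z i p t \<tau> * B p j \<tau>) * frac_op_kernel (\<alpha> $ j) a c \<tau> s"
          \<comment> \<open>The reflected kernel is cut off at \<open>t\<close> and the original one
            at \<open>c\<close>. The difference is invisible because \<open>z i p t \<tau>\<close>
            vanishes for \<tau> beyond \<open>t\<close>.\<close>
          proof (cases "\<tau> < t")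
            case True
            then show ?thesis using that t by (simp add: frac_op_kernel_def mult_ac)
          next
            case False
            then have "z i p t \<tau> = 0" for p using z0[of t \<tau>] by (auto simp: T_def)
            then show ?thesis by simp
          qed
        qed simp
        finally show ?thesis by (simp add: R_def kop_def)
      qed
      have Veq: "AE x in lborel. w i j x = (if j = i then 1 else 0) * frac_op_kernel (\<alpha> $ j) (- t) (- a) x (- t) + V.volt (\<lambda>p. w i p) j x" for i j
        using AE_lborel_reflect[OF elim(2)]
      proof eventually_elim
        case (elim x)
        show ?case
        proof (cases "x \<le> - a")
          case True
          then have "frac_op_kernel (\<alpha> $ i) a c t (- x) = frac_op_kernel (\<alpha> $ i) (- t) (- a) x (- t)"
            using t by (auto simp: frac_op_kernel_def add.commute)
          then show ?thesis
            using elim[rule_format, of i j] vol[where s="- x" and i=i and j=j] True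
              by (auto simp: w_def)
        next
          case False
          then show ?thesis using w0[of x i j] by (simp add: kop_def frac_op_kernel_def)
        qed
      qed
      have Yint: "(\<lambda>x. Y' x $ j $ i) absolutely_integrable_on {-t..-a}" for i j
      proof (rule absolutely_integrable_of_borel_version[OF _ wY])
        show "set_integrable lborel {-t..-a} (w i j)"
          unfolding set_integrable_def by (intro integrable_mult_indicator wint) simp
      qed
      have sol': "left_solution A' (row_constant \<alpha>) (- t) {-t..-a} Y'"
      proof (rule left_solution_of_equation[OF \<alpha> ta(2) Yint])
        fix j i
        note col' = V.volterra_column[OF ta(1) BA', of "\<lambda>p. w i p" Y' i, OF wint w0 wY]
        show "(\<lambda>x. (A' x ** Y' x) $ j $ i) absolutely_integrable_on {-t..-a}" by (rule col'(1))
        show "AE x\<in>{-t..-a} in lborel. Y' x $ j $ i =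
           (if j = i then 1 else 0) * frac_kernel (\<alpha> $ j) (x - - t) + frac_int (\<alpha> $ j) (- t) (\<lambda>x. (A' x ** Y' x) $ j $ i) x"
          by (rule iffD2[OF col'(2)], assumption, rule Veq)
      qed
      have at: "a < t" using t by simp
      show "right_solution A (column_constant \<alpha>) t {a..t} (Z t) \<and>
        (\<forall>Y. right_solution A (column_constant \<alpha>) t {a..t} Y \<longrightarrow> (AE s in lebesgue_on {a..t}. Y s = Z t s))"
      proof (intro conjI allI impI)
        show "right_solution A (column_constant \<alpha>) t {a..t} (Z t)"
          using sol' unfolding right_solution_reflect[OF at] A'_def Y'_def .
        fix Y assume "right_solution A (column_constant \<alpha>) t {a..t} Y"
        then have "left_solution A' (row_constant \<alpha>) (- t) {-t..-a} (\<lambda>x. transpose (Y (- x)))"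
          unfolding right_solution_reflect[OF at] A'_def .
        from V.left_solution_unique[OF ta(2) refl _ BA' this sol']
        have "AE x\<in>{-t..-a} in lborel. transpose (Y (- x)) = Y' x" using \<alpha> by blast
        from AE_lborel_reflect[OF this]
        have "AE s\<in>{a..t} in lborel. Y s = Z t s"
          by eventually_elim (auto simp: Y'_def)
        then show "AE s in lebesgue_on {a..t}. Y s = Z t s" by (simp add: AE_lebesgue_on_iff)
      qed
    qed
  qed
qed

theorem theorem7:
  fixes a :: real and I :: "real set"
    and A :: "real \<Rightarrow> real ^ 'm ^ 'm"
    and \<alpha> :: "real ^ 'm"
    and Z :: "real \<Rightarrow> real \<Rightarrow> real ^ 'm ^ 'm"
  assumes "I \<in> intervals_from a"
    and "\<And>i j. Linf_loc I (\<lambda>t. A t $ i $ j)"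
    and "\<And>i. 0 < \<alpha> $ i \<and> \<alpha> $ i \<le> 1"
    and "state_transition_matrix I A (row_constant \<alpha>) Z"
  shows "AE t in lebesgue_on I. t > a \<longrightarrow>
    right_solution A (column_constant \<alpha>) t {a..t} (Z t) \<and>
    (\<forall>Y. right_solution A (column_constant \<alpha>) t {a..t} Y \<longrightarrow>
       (AE s in lebesgue_on {a..t}. Y s = Z t s))"
proof -
  define P where "P t \<longleftrightarrow> right_solution A (column_constant \<alpha>) t {a..t} (Z t) \<and>
    (\<forall>Y. right_solution A (column_constant \<alpha>) t {a..t} Y \<longrightarrow>
       (AE s in lebesgue_on {a..t}. Y s = Z t s))" for t
  obtain b where "b \<in> I" using assms(1) by (auto simp: intervals_from_def)
  have "I \<in> sets borel" by (rule interval_subset(3)[OF assms(1) \<open>b \<in> I\<close>])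
  then have IL: "I \<in> sets lebesgue" by simp
  \<comment> \<open>Exhausting \<open>I\<close> by intervals that end at a rational point of
    \<open>I\<close> costs only countably many null sets. It can miss just one point, the maximum of
    \<open>I\<close>; \<open>m\<close> is this point if it exists, and the default 0 is harmless
    since a single point is null.\<close>
  define m where "m = (if \<exists>c\<in>I. \<forall>x\<in>I. x \<le> c then SOME c. c \<in> I \<and> (\<forall>x\<in>I. x \<le> c) else 0)"
  have m: "x = m" if "x \<in> I" "\<And>q :: rat. of_rat q \<in> I \<Longrightarrow> of_rat q < x" for x
  proof -
    have top: "y \<le> x" if "y \<in> I" for y
    proof (rule ccontr)
      assume "\<not> y \<le> x"
      then obtain q :: rat where q: "x < of_rat q" "of_rat q < y" using of_rat_dense[of x y] by auto
      then have "of_rat q \<in> I"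
        using mem_is_interval_1_I[of I x y "of_rat q"] assms(1) \<open>x \<in> I\<close> \<open>y \<in> I\<close>
          by (simp add: intervals_from_def)
      then show False using q that(1) \<open>\<And>q :: rat. of_rat q \<in> I \<Longrightarrow> of_rat q < x\<close>[of q] by simp
    qed
    then have ex: "\<exists>c. c \<in> I \<and> (\<forall>x\<in>I. x \<le> c)" using \<open>x \<in> I\<close> by blast
    from someI_ex[OF ex] have "m \<in> I" "\<forall>x\<in>I. x \<le> m" using ex by (auto simp: m_def)
    then show "x = m" using top \<open>x \<in> I\<close> by (auto intro: antisym)
  qed
  have "AE t in lborel. of_rat q \<in> I \<longrightarrow> t \<in> {a<..of_rat q} \<longrightarrow> P t" for q :: rat
  proof (cases "of_rat q \<in> I \<and> a < of_rat q")
    case True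
    then show ?thesis
      using right_solution_on_compact[OF assms, of "of_rat q"]
        by (auto simp: P_def elim!: eventually_mono)
  qed auto
  then have "AE t in lborel. \<forall>q :: rat. of_rat q \<in> I \<longrightarrow> t \<in> {a<..of_rat q} \<longrightarrow> P t"
    by (simp only: AE_all_countable) simp
  then have "AE t in lborel. t \<in> I \<longrightarrow> t > a \<longrightarrow> P t"
    using AE_lborel_singleton[of m]
  proof eventually_elim
    case (elim t)
    show ?case
    proof (intro impI)
      assume t: "t \<in> I" "t > a"
      then obtain q :: rat where "of_rat q \<in> I" "t \<le> of_rat q" using m[of t] elim(2) by force
      then show "P t" using elim(1) t by auto
    qed
  qed
  then show ?thesis
    unfolding AE_lebesgue_on_iff[OF IL] P_def .
qed

end
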